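(* Let $\{X_i\}_{i\ge1}$ and $\{Y_i\}_{i\ge1}$ be all mutually independent real random variables, the $X_i$ having common distribution $F_1$ and the $Y_i$ common distribution $F_2$, with finite variances, and suppose $\mathbb{E}[h_{F_1}^2(X_1,X_2)]+\mathbb{E}[h_{F_2}^2(Y_1,Y_2)]<\infty$. Let $\kappa^*$ be the estimator of Bergsma's covariance based on $(X_1,Y_1),\dots,(X_n,Y_n)$. Then, as $n\to\infty$, $$n\kappa^*\xrightarrow{D}\sum_{k,l=0}^\infty\lambda_k\eta_l\,(Z_{kl}^2-1),$$ where $\{\lambda_k\}$ and $\{\eta_l\}$ are the eigenvalues of $h_{F_1}$ and $h_{F_2}$ respectively, and $\{Z_{kl}\}$ are i.i.d. standard normal variables.
   Context: For a distribution function $F$ on $\mathbb{R}$ with finite mean, with $Z_1,Z_2$ i.i.d. $F$, $h_F(z_1,z_2)=-\tfrac12\,\mathbb{E}\big(|z_1-z_2|-|z_1-Z_2|-|Z_1-z_2|+|Z_1-Z_2|\big)$. The eigenvalues of a symmetric kernel $h\in L^2(F\otimes F)$ are those (counted with multiplicity) of the integral operator $T_h f(x)=\int h(x,y)f(y)\,dF(y)$ on $L^2(F)$; here $F=F_1$ for $h_{F_1}$ and $F=F_2$ for $h_{F_2}$. Thus $h_{F_1}(x_1,x_2)=\sum_{k\ge0}\lambda_kg_{1k}(x_1)g_{1k}(x_2)$ and $h_{F_2}(y_1,y_2)=\sum_{k\ge0}\eta_kg_{2k}(y_1)g_{2k}(y_2)$ in the $L^2$ sense, with orthonormal eigenfunctions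 (sequences with finitely many terms are padded by zeros). For a sample $(x_i,y_i)$, $1\le i\le n$, $n\ge3$: $U_{1n}=\binom n2^{-1}\sum_{i<j}|x_i-x_j|$, $U_{2n}=\binom n2^{-1}\sum_{i<j}|y_i-y_j|$, $U_{12n}=\binom n2^{-1}\sum_{i<j}|x_i-x_j||y_i-y_j|$, $U_{3n}=\binom n3^{-1}\sum_{i<j<k}h((x_i,y_i),(x_j,y_j),(x_k,y_k))$ with $$h\big((x_1,y_1),(x_2,y_2),(x_3,y_3)\big)=\tfrac16\big[|x_1-x_2||y_1-y_3|+|x_2-x_1||y_2-y_3|+|x_1-x_3||y_1-y_2|+|x_2-x_3||y_2-y_1|+|x_3-x_1||y_3-y_2|+|x_3-x_2||y_3-y_1|\big],$$ and $\kappa^*=\frac14[U_{12n}+U_{1n}U_{2n}-2U_{3n}]$. *)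

theory Defs
  imports "HOL-Probability.Probability"
begin

text \<open>A distribution on the real line is represented by its Borel probability measure.\<close>

definition bergsma_kernel :: "real measure \<Rightarrow> real \<Rightarrow> real \<Rightarrow> real" where
  "bergsma_kernel F z1 z2 =
     - (1/2) * (\<integral>(u, v). (\<bar>z1 - z2\<bar> - \<bar>z1 - v\<bar> - \<bar>u - z2\<bar> + \<bar>u - v\<bar>) \<partial>(F \<Otimes>\<^sub>M F))"

definition square_integrable :: "'s measure \<Rightarrow> ('s \<Rightarrow> real) \<Rightarrow> bool" where
  "square_integrable F f \<longleftrightarrow> f \<in> borel_measurable F \<and> integrable F (\<lambda>x. (f x)\<^sup>2)"

definition integral_op :: "'s measure \<Rightarrow> ('s \<Rightarrow> 's \<Rightarrow> real) \<Rightarrow> ('s \<Rightarrow> real) \<Rightarrow> 's \<Rightarrow> real" where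
  "integral_op F h f x = (\<integral>y. h x y * f y \<partial>F)"

text \<open>Elements of \<open>L\<^sup>2(F)\<close> are represented by square integrable functions, with equality
  read as equality almost everywhere. The scalars are real: the operator of a symmetric real
  kernel is self-adjoint, so its eigenvalues are real and the real and complex dimensions of an
  eigenspace agree.\<close>

definition eigenspace :: "'s measure \<Rightarrow> ('s \<Rightarrow> 's \<Rightarrow> real) \<Rightarrow> real \<Rightarrow> ('s \<Rightarrow> real) set" where
  "eigenspace F h c =
     {f. square_integrable F f \<and> (AE x in F. integral_op F h f x = c * f x)}"

text \<open>The eigenspace of \<open>c\<close>, modulo equality almost everywhere, has a basis of \<open>m\<close> elements.
  For \<open>m = 0\<close> this says that \<open>c\<close> is not an eigenvalue.\<close>

definition eigen_multiplicity ::
    "'s measure \<Rightarrow> ('s \<Rightarrow> 's \<Rightarrow> real) \<Rightarrow> real \<Rightarrow> nat \<Rightarrow> bool" where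
  "eigen_multiplicity F h c m \<longleftrightarrow>
     (\<exists>g :: nat \<Rightarrow> 's \<Rightarrow> real.
        (\<forall>i<m. g i \<in> eigenspace F h c) \<and>
        (\<forall>a :: nat \<Rightarrow> real. (AE x in F. (\<Sum>i<m. a i * g i x) = 0) \<longrightarrow> (\<forall>i<m. a i = 0)) \<and>
        (\<forall>f \<in> eigenspace F h c. \<exists>a :: nat \<Rightarrow> real. AE x in F. f x = (\<Sum>i<m. a i * g i x)))"

text \<open>The sequence lists every nonzero eigenvalue as often as its multiplicity. The number of
  zero terms is left free: it covers both the padding of a finite list and any choice of how
  often the eigenvalue 0, whose multiplicity may be infinite, is listed.\<close>

definition eigenvalue_sequence ::
    "'s measure \<Rightarrow> ('s \<Rightarrow> 's \<Rightarrow> real) \<Rightarrow> (nat \<Rightarrow> real) \<Rightarrow> bool" where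
  "eigenvalue_sequence F h lam \<longleftrightarrow>
     (\<forall>c. c \<noteq> 0 \<longrightarrow> finite {k. lam k = c} \<and> eigen_multiplicity F h c (card {k. lam k = c}))"

text \<open>Samples are indexed from 0: the sample of size \<open>n\<close> is \<open>(x 0, y 0), \<dots>, (x (n-1), y (n-1))\<close>.\<close>

definition U1 :: "nat \<Rightarrow> (nat \<Rightarrow> real) \<Rightarrow> real" where
  "U1 n x = (\<Sum>j<n. \<Sum>i<j. \<bar>x i - x j\<bar>) / real (n choose 2)"

definition U12 :: "nat \<Rightarrow> (nat \<Rightarrow> real) \<Rightarrow> (nat \<Rightarrow> real) \<Rightarrow> real" where
  "U12 n x y = (\<Sum>j<n. \<Sum>i<j. \<bar>x i - x j\<bar> * \<bar>y i - y j\<bar>) / real (n choose 2)"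

definition h3 :: "real \<times> real \<Rightarrow> real \<times> real \<Rightarrow> real \<times> real \<Rightarrow> real" where
  "h3 = (\<lambda>(x1, y1) (x2, y2) (x3, y3).
     (1/6) * (\<bar>x1 - x2\<bar> * \<bar>y1 - y3\<bar> + \<bar>x2 - x1\<bar> * \<bar>y2 - y3\<bar> + \<bar>x1 - x3\<bar> * \<bar>y1 - y2\<bar>
            + \<bar>x2 - x3\<bar> * \<bar>y2 - y1\<bar> + \<bar>x3 - x1\<bar> * \<bar>y3 - y2\<bar> + \<bar>x3 - x2\<bar> * \<bar>y3 - y1\<bar>))"

definition U3 :: "nat \<Rightarrow> (nat \<Rightarrow> real) \<Rightarrow> (nat \<Rightarrow> real) \<Rightarrow> real" where
  "U3 n x y =
     (\<Sum>k<n. \<Sum>j<k. \<Sum>i<j. h3 (x i, y i) (x j, y j) (x k, y k)) / real (n choose 3)"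

definition kappa_star :: "nat \<Rightarrow> (nat \<Rightarrow> real) \<Rightarrow> (nat \<Rightarrow> real) \<Rightarrow> real" where
  "kappa_star n x y = (1/4) * (U12 n x y + U1 n x * U1 n y - 2 * U3 n x y)"

end

theory Submission
  imports Defs "HOL-Complex_Analysis.Great_Picard" "HOL-Real_Asymp.Real_Asymp"
begin

text \<open>
  Let \<open>\<phi>\<^sub>t x = 1\<^bsub>x \<le> t\<^esub> - F t\<close> be the centred step functions of a distribution \<open>F\<close>. Since
  \<open>\<bar>x - y\<bar> = \<integral> (1\<^bsub>x \<le> t\<^esub> - 1\<^bsub>y \<le> t\<^esub>)\<^sup>2 dt\<close>, the kernel is an inner product,
  \<open>h\<^sub>F x y = \<integral> \<phi>\<^sub>t x * \<phi>\<^sub>t y dt\<close> (\<open>ker_eq\<close>). Hence \<open>h\<^sub>F\<close> is positive semidefinite and degenerate (\<open>\<integral> h\<^sub>F x y dF = 0\<close>),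
  \<open>\<bar>x - y\<bar> = h\<^sub>F x x + h\<^sub>F y y - 2 * h\<^sub>F x y\<close>, and everything below rests on these two facts together
  with the finite trace \<open>tr = \<integral> h\<^sub>F x x dF\<close>.

  Let \<open>V\<^sub>n\<close> be the V-statistic \<open>(1/n) * (\<Sum>i j. h\<^sub>1 (X\<^sub>i) (X\<^sub>j) * h\<^sub>2 (Y\<^sub>i) (Y\<^sub>j))\<close>. It is
  nonnegative with mean \<open>tr\<^sub>1 * tr\<^sub>2\<close>, which comes from its diagonal alone. Writing the distances in
  terms of the kernels turns \<open>n * \<kappa>\<^sup>* - (V\<^sub>n - tr\<^sub>1 * tr\<^sub>2)\<close> into a sum of linear and bilinear forms
  in one sample whose coefficients are independent of that sample, and degeneracy makes all of them
  tend to zero in \<open>L\<^sup>2\<close> (\<open>kappa_star_expansion\<close>, \<open>bilinear_form_second_moment\<close>, \<open>kappa_star_approx\<close>).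

  The eigenvalues add up to the trace: \<open>\<Sum>\<^sub>k \<lambda>\<^sub>k = tr\<close> (\<open>lam_sums_tr\<close>). The quadratic form
  of the integral operator is bounded by the tail \<open>\<Sum>\<^bsub>k \<ge> K\<^esub> \<lambda>\<^sub>k\<close> on the complement of the first
  \<open>K\<close> eigenfunctions (\<open>quadratic_form_le_tail\<close>, by compactness), which forces Parseval's identity
  for every \<open>\<phi>\<^sub>t\<close>; integrating it over \<open>t\<close> gives the trace. Replacing both kernels by their first \<open>K\<close>
  spectral terms therefore decreases \<open>V\<^sub>n\<close> to a statistic \<open>V\<^sub>n\<^sup>K\<close> with
  \<open>E (V\<^sub>n - V\<^sub>n\<^sup>K) = tr\<^sub>1 * tr\<^sub>2 - \<Sum>\<^bsub>k,l < K\<^esub> \<lambda>\<^sub>k * \<eta>\<^sub>l\<close>, small uniformly in \<open>n\<close>, and the same bound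
  controls the truncation of the limit \<open>W = \<Sum>\<^sub>k\<^sub>l \<lambda>\<^sub>k * \<eta>\<^sub>l * Z\<^sub>k\<^sub>l\<^sup>2\<close>.

  The truncated statistic \<open>V\<^sub>n\<^sup>K\<close> is the squared length of a vector of normalised sums, and
  \<open>exp (- t * \<parallel>s\<parallel>\<^sup>2)\<close> is the mean of \<open>exp (\<i> * sqrt (2 * t) * (s \<bullet> Z))\<close>, so that the one-dimensional
  central limit theorem, applied for fixed \<open>Z\<close>, gives the limit of its Laplace transform
  (\<open>Laplace_transform_quadratic_form\<close>). Truncation error and nonnegativity carry this over to
  \<open>E (exp (- t * V\<^sub>n)) \<longlonglongrightarrow> E (exp (- t * W))\<close> (\<open>vstat_Laplace\<close>). With bounded means, convergence of
  Laplace transforms implies convergence of the means of all bounded continuous functions, in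
  particular of the characteristic functions of \<open>V\<^sub>n - tr\<^sub>1 * tr\<^sub>2\<close>; the \<open>L\<^sup>2\<close> approximation and
  Levy's continuity theorem conclude. Since \<open>\<Sum>\<^sub>k\<^sub>l \<lambda>\<^sub>k * \<eta>\<^sub>l\<close> is finite, the limit series converges
  absolutely almost surely and its centring may be summed separately.
\<close>

section \<open>Square integrable functions\<close>

definition l2_inner :: "'s measure \<Rightarrow> ('s \<Rightarrow> real) \<Rightarrow> ('s \<Rightarrow> real) \<Rightarrow> real" where
  "l2_inner F f g = (\<integral>x. f x * g x \<partial>F)"

lemma square_integrable_measurable [measurable_dest]:
  "square_integrable F f \<Longrightarrow> f \<in> borel_measurable F"
  by (simp add: square_integrable_def)

lemma square_integrable_mult:
  assumes "square_integrable F f" "square_integrable F g"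
  shows "integrable F (\<lambda>x. f x * g x)"
proof (rule Bochner_Integration.integrable_bound)
  show "integrable F (\<lambda>x. (f x)\<^sup>2 + (g x)\<^sup>2)"
    using assms by (auto simp: square_integrable_def)
  show "(\<lambda>x. f x * g x) \<in> borel_measurable F"
    using assms by (auto simp: square_integrable_def)
  have "\<bar>a * b\<bar> \<le> a\<^sup>2 + b\<^sup>2" for a b :: real
  proof -
    have "0 \<le> (\<bar>a\<bar> - \<bar>b\<bar>)\<^sup>2" by simp
    then have "2 * \<bar>a * b\<bar> \<le> a\<^sup>2 + b\<^sup>2" by (simp add: power2_diff abs_mult)
    then show ?thesis by linarith
  qed
  then show "AE x in F. norm (f x * g x) \<le> norm ((f x)\<^sup>2 + (g x)\<^sup>2)" by simp
qed

lemma square_integrable_lincomb: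
  assumes f: "square_integrable F f" and g: "square_integrable F g"
  shows "square_integrable F (\<lambda>x. a * f x + b * g x)"
proof -
  have eq: "(a * f x + b * g x)\<^sup>2 = a\<^sup>2 * (f x)\<^sup>2 + 2 * a * b * (f x * g x) + b\<^sup>2 * (g x)\<^sup>2" for x
    by (simp add: power2_eq_square algebra_simps)
  show ?thesis
    unfolding square_integrable_def eq
    using f g square_integrable_mult[OF f g] by (auto simp: square_integrable_def)
qed

lemma square_integrable_zero: "square_integrable F (\<lambda>x. 0)"
  by (simp add: square_integrable_def)

lemma square_integrable_cmult: "square_integrable F f \<Longrightarrow> square_integrable F (\<lambda>x. a * f x)"
  using square_integrable_lincomb[of F f f a 0] by simp

lemma square_integrable_diff:
  "square_integrable F f \<Longrightarrow> square_integrable F g \<Longrightarrow> square_integrable F (\<lambda>x. f x - g x)"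
  using square_integrable_lincomb[of F f g 1 "-1"] by simp

lemma square_integrable_sum:
  assumes "\<And>i. i \<in> I \<Longrightarrow> square_integrable F (g i)"
  shows "square_integrable F (\<lambda>x. \<Sum>i\<in>I. a i * g i x)"
  using assms
proof (induction I rule: infinite_finite_induct)
  case (insert i I)
  then show ?case
    using square_integrable_lincomb[of F "g i" "\<lambda>x. \<Sum>i\<in>I. a i * g i x" "a i" 1] by simp
qed (auto simp: square_integrable_zero)

lemma l2_inner_commute: "l2_inner F f g = l2_inner F g f"
  by (simp add: l2_inner_def mult.commute)

lemma l2_inner_self: "l2_inner F f f = (\<integral>x. (f x)\<^sup>2 \<partial>F)"
  by (simp add: l2_inner_def power2_eq_square)

lemma l2_inner_self_nonneg: "0 \<le> l2_inner F f f"
  by (simp add: l2_inner_self)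

lemma l2_inner_self_eq_0:
  assumes "square_integrable F f"
  shows "l2_inner F f f = 0 \<longleftrightarrow> (AE x in F. f x = 0)"
  unfolding l2_inner_self
  using assms by (subst integral_nonneg_eq_0_iff_AE) (auto simp: square_integrable_def)

lemma l2_inner_cong_AE:
  assumes "AE x in F. f x = f' x" and [measurable]: "f \<in> borel_measurable F" "f' \<in> borel_measurable F"
    "g \<in> borel_measurable F"
  shows "l2_inner F f g = l2_inner F f' g"
  unfolding l2_inner_def by (rule integral_cong_AE) (use assms in auto)

lemma l2_inner_lincomb:
  assumes "square_integrable F f" "square_integrable F g" "square_integrable F k"
  shows "l2_inner F (\<lambda>x. a * f x + b * g x) k = a * l2_inner F f k + b * l2_inner F g k"
  unfolding l2_inner_def
  by (simp add: distrib_right mult.assoc square_integrable_mult assms)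

lemma l2_inner_diff:
  assumes "square_integrable F f" "square_integrable F g" "square_integrable F k"
  shows "l2_inner F (\<lambda>x. f x - g x) k = l2_inner F f k - l2_inner F g k"
  using l2_inner_lincomb[OF assms, of 1 "-1"] by simp

lemma l2_inner_sum:
  assumes "\<And>i. i \<in> I \<Longrightarrow> square_integrable F (g i)" and k: "square_integrable F k"
  shows "l2_inner F (\<lambda>x. \<Sum>i\<in>I. a i * g i x) k = (\<Sum>i\<in>I. a i * l2_inner F (g i) k)"
proof -
  have "l2_inner F (\<lambda>x. \<Sum>i\<in>I. a i * g i x) k = (\<integral>x. (\<Sum>i\<in>I. a i * (g i x * k x)) \<partial>F)"
    by (simp add: l2_inner_def sum_distrib_right mult.assoc)
  also have "\<dots> = (\<Sum>i\<in>I. (\<integral>x. a i * (g i x * k x) \<partial>F))"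
    by (rule Bochner_Integration.integral_sum)
       (auto intro!: integrable_mult_right square_integrable_mult assms)
  finally show ?thesis by (simp add: l2_inner_def)
qed

lemma nonneg_quadratic_discriminant:
  fixes A B C :: real
  assumes "0 \<le> C" and nonneg: "\<And>t. 0 \<le> A + 2 * B * t + C * t\<^sup>2"
  shows "B\<^sup>2 \<le> A * C"
proof (cases "C = 0")
  case True
  have "B = 0"
  proof (rule ccontr)
    assume "B \<noteq> 0"
    then show False using nonneg[of "- (A + 1) / (2 * B)"] True by simp
  qed
  then show ?thesis using True by simp
next
  case False
  then have "C > 0" using assms by simp
  have "0 \<le> A + 2 * B * (- B / C) + C * (- B / C)\<^sup>2" by (rule nonneg)
  also have "\<dots> = A - B\<^sup>2 / C"
    using False by (simp add: power2_eq_square field_simps)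
  finally show ?thesis using \<open>C > 0\<close> by (simp add: field_simps)
qed

lemma l2_Cauchy_Schwarz:
  assumes f: "square_integrable F f" and g: "square_integrable F g"
  shows "(l2_inner F f g)\<^sup>2 \<le> l2_inner F f f * l2_inner F g g"
proof (rule nonneg_quadratic_discriminant)
  fix t
  have s: "square_integrable F (\<lambda>x. 1 * f x + t * g x)" by (rule square_integrable_lincomb[OF f g])
  have "l2_inner F (\<lambda>x. 1 * f x + t * g x) (\<lambda>x. 1 * f x + t * g x)
      = l2_inner F f f + 2 * l2_inner F f g * t + l2_inner F g g * t\<^sup>2"
    apply (subst l2_inner_lincomb[OF f g s])
    apply (subst (1 2) l2_inner_commute)
    apply (subst (1 2) l2_inner_lincomb[OF f g])
    using f g by (auto simp: l2_inner_commute[of F g f] algebra_simps power2_eq_square)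
  then show "0 \<le> l2_inner F f f + 2 * l2_inner F f g * t + l2_inner F g g * t\<^sup>2"
    by (metis l2_inner_self_nonneg)
qed (rule l2_inner_self_nonneg)

lemma l2_Cauchy_Schwarz_abs:
  assumes f: "square_integrable F f" and g: "square_integrable F g"
  shows "\<bar>l2_inner F f g\<bar> \<le> sqrt (l2_inner F f f) * sqrt (l2_inner F g g)"
  using l2_Cauchy_Schwarz[OF assms] real_le_rsqrt by (simp add: real_sqrt_mult[symmetric] real_le_rsqrt)

text \<open>The error of the best approximation of \<open>f\<close> in the span of the family \<open>d\<close> when that is orthonormal.\<close>

definition l2_residual :: "'s measure \<Rightarrow> ('i \<Rightarrow> 's \<Rightarrow> real) \<Rightarrow> 'i set \<Rightarrow> ('s \<Rightarrow> real) \<Rightarrow> 's \<Rightarrow> real" where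
  "l2_residual F d I f = (\<lambda>x. f x - (\<Sum>i\<in>I. l2_inner F f (d i) * d i x))"

text \<open>Zero vectors are admitted in the orthogonal family, so that a sequence of eigenfunctions may
  carry a zero wherever the eigenvalue is zero.\<close>

lemma
  assumes f: "square_integrable F f" and d: "\<And>i. i \<in> I \<Longrightarrow> square_integrable F (d i)" and I: "finite I"
    and orth: "\<And>i j. i \<in> I \<Longrightarrow> j \<in> I \<Longrightarrow> i \<noteq> j \<Longrightarrow> l2_inner F (d i) (d j) = 0"
    and unit: "\<And>i. i \<in> I \<Longrightarrow> l2_inner F (d i) (d i) \<in> {0, 1}"
  shows square_integrable_residual: "square_integrable F (l2_residual F d I f)"
    and l2_inner_residual: "square_integrable F g \<Longrightarrow> l2_inner F (l2_residual F d I f) g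
          = l2_inner F f g - (\<Sum>i\<in>I. l2_inner F f (d i) * l2_inner F (d i) g)"
    and residual_orthogonal: "j \<in> I \<Longrightarrow> l2_inner F (l2_residual F d I f) (d j) = 0"
    and residual_norm: "l2_inner F (l2_residual F d I f) (l2_residual F d I f)
          = l2_inner F f f - (\<Sum>i\<in>I. (l2_inner F f (d i))\<^sup>2)"
    and Bessel_inequality: "(\<Sum>i\<in>I. (l2_inner F f (d i))\<^sup>2) \<le> l2_inner F f f"
proof -
  have s: "square_integrable F (\<lambda>x. \<Sum>i\<in>I. l2_inner F f (d i) * d i x)"
    by (rule square_integrable_sum[OF d])
  show r: "square_integrable F (l2_residual F d I f)"
    unfolding l2_residual_def by (rule square_integrable_diff[OF f s])
  have inner: "l2_inner F (l2_residual F d I f) g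
          = l2_inner F f g - (\<Sum>i\<in>I. l2_inner F f (d i) * l2_inner F (d i) g)"
    if "square_integrable F g" for g
    unfolding l2_residual_def using that f s d
    by (simp add: l2_inner_diff l2_inner_sum)
  then show "square_integrable F g \<Longrightarrow> l2_inner F (l2_residual F d I f) g
          = l2_inner F f g - (\<Sum>i\<in>I. l2_inner F f (d i) * l2_inner F (d i) g)" .
  have orth0: "l2_inner F (l2_residual F d I f) (d j) = 0" if "j \<in> I" for j
  proof -
    have "(\<Sum>i\<in>I. l2_inner F f (d i) * l2_inner F (d i) (d j))
        = (\<Sum>i\<in>I. if i = j then l2_inner F f (d j) * l2_inner F (d j) (d j) else 0)"
      using orth that by (intro sum.cong) auto
    also have "\<dots> = l2_inner F f (d j) * l2_inner F (d j) (d j)"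
      using that I by simp
    also have "\<dots> = l2_inner F f (d j)"
    proof (cases "l2_inner F (d j) (d j) = 1")
      case False
      then have "l2_inner F (d j) (d j) = 0" using unit that by auto
      then have "(l2_inner F f (d j))\<^sup>2 \<le> 0" using l2_Cauchy_Schwarz[OF f d[OF that]] by simp
      then show ?thesis by simp
    qed simp
    finally show ?thesis using inner[OF d[OF that]] by simp
  qed
  then show "j \<in> I \<Longrightarrow> l2_inner F (l2_residual F d I f) (d j) = 0" .
  have "l2_inner F (l2_residual F d I f) (l2_residual F d I f)
      = l2_inner F f (l2_residual F d I f)
        - (\<Sum>i\<in>I. l2_inner F f (d i) * l2_inner F (d i) (l2_residual F d I f))"
    by (rule inner[OF r])
  also have "(\<Sum>i\<in>I. l2_inner F f (d i) * l2_inner F (d i) (l2_residual F d I f)) = 0"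
    using orth0 by (intro sum.neutral) (auto simp: l2_inner_commute)
  also have "l2_inner F f (l2_residual F d I f) - 0 = l2_inner F (l2_residual F d I f) f"
    by (simp add: l2_inner_commute)
  also have "\<dots> = l2_inner F f f - (\<Sum>i\<in>I. (l2_inner F f (d i))\<^sup>2)"
    proof -
    have "(\<Sum>i\<in>I. l2_inner F f (d i) * l2_inner F (d i) f) = (\<Sum>i\<in>I. (l2_inner F f (d i))\<^sup>2)"
      by (intro sum.cong refl) (metis l2_inner_commute power2_eq_square)
    then show ?thesis using inner[OF f] by simp
  qed
  finally show n: "l2_inner F (l2_residual F d I f) (l2_residual F d I f)
          = l2_inner F f f - (\<Sum>i\<in>I. (l2_inner F f (d i))\<^sup>2)" .
  show "(\<Sum>i\<in>I. (l2_inner F f (d i))\<^sup>2) \<le> l2_inner F f f"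
    using n l2_inner_self_nonneg[of F "l2_residual F d I f"] by simp
qed

text \<open>The coefficients \<open>b\<close> are needed in the induction: if the residual of the next function vanished,
  it would turn into a linear dependence among the given functions. They also show that the new
  functions stay in every linear space that contains the old ones.\<close>

lemma Gram_Schmidt:
  fixes g :: "nat \<Rightarrow> 's \<Rightarrow> real"
  assumes g: "\<And>i. i < m \<Longrightarrow> square_integrable F (g i)"
    and indep: "\<And>a :: nat \<Rightarrow> real. (AE x in F. (\<Sum>i<m. a i * g i x) = 0) \<Longrightarrow> \<forall>i<m. a i = 0"
  shows "\<exists>(e :: nat \<Rightarrow> 's \<Rightarrow> real) b. (\<forall>i<m. e i = (\<lambda>x. \<Sum>j<m. b i j * g j x)) \<and>
     (\<forall>i<m. \<forall>j<m. l2_inner F (e i) (e j) = (if i = j then 1 else 0)) \<and>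
     (\<forall>f. square_integrable F f \<longrightarrow> (\<forall>i<m. l2_inner F f (e i) = 0) \<longrightarrow> (\<forall>i<m. l2_inner F f (g i) = 0))"
  using assms
proof (induction m)
  case 0
  then show ?case by simp
next
  case (Suc m)
  have "\<forall>i<m. a i = 0" if ae: "AE x in F. (\<Sum>i<m. a i * g i x) = 0" for a :: "nat \<Rightarrow> real"
  proof -
    have "\<forall>i<Suc m. (a(m := 0)) i = 0"
      by (rule Suc.prems(2)) (use ae in simp)
    then show ?thesis by (metis fun_upd_other less_Suc_eq less_irrefl)
  qed
  note dep = this
  have "\<exists>(e :: nat \<Rightarrow> 's \<Rightarrow> real) b. (\<forall>i<m. e i = (\<lambda>x. \<Sum>j<m. b i j * g j x)) \<and>
     (\<forall>i<m. \<forall>j<m. l2_inner F (e i) (e j) = (if i = j then 1 else 0)) \<and>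
     (\<forall>f. square_integrable F f \<longrightarrow> (\<forall>i<m. l2_inner F f (e i) = 0) \<longrightarrow> (\<forall>i<m. l2_inner F f (g i) = 0))"
    by (rule Suc.IH) (use Suc.prems(1) dep in auto)
  then obtain e :: "nat \<Rightarrow> 's \<Rightarrow> real" and b :: "nat \<Rightarrow> nat \<Rightarrow> real"
    where e_all: "\<forall>i<m. e i = (\<lambda>x. \<Sum>j<m. b i j * g j x)"
    and on_all: "\<forall>i<m. \<forall>j<m. l2_inner F (e i) (e j) = (if i = j then 1 else 0)"
    and perp_all: "\<forall>f. square_integrable F f \<longrightarrow> (\<forall>i<m. l2_inner F f (e i) = 0)
       \<longrightarrow> (\<forall>i<m. l2_inner F f (g i) = 0)"
    by (elim exE conjE)
  have e: "e i = (\<lambda>x. \<Sum>j<m. b i j * g j x)" if "i < m" for i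
    using e_all that by blast
  have on: "l2_inner F (e i) (e j) = (if i = j then 1 else 0)" if "i < m" "j < m" for i j
    using on_all that by blast
  have perp: "l2_inner F f (g i) = 0" 
    if "square_integrable F f" "\<And>i. i < m \<Longrightarrow> l2_inner F f (e i) = 0" "i < m" for f i
    using perp_all that by blast
  have se: "square_integrable F (e i)" if "i < m" for i
    unfolding e[OF that] using Suc.prems(1) by (intro square_integrable_sum) auto
  have sg: "square_integrable F (g m)" using Suc.prems(1) by simp
  define r where "r = l2_residual F e {..<m} (g m)"
  have sr: "square_integrable F r"
    unfolding r_def by (rule square_integrable_residual) (use sg se on in auto)
  have r_e: "l2_inner F r (e i) = 0" if "i < m" for i
    unfolding r_def by (rule residual_orthogonal) (use sg se on that in auto)
  define c where "c j = (if j = m then 1 else - (\<Sum>i<m. l2_inner F (g m) (e i) * b i j))" for j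
  have r_g: "r x = (\<Sum>j<Suc m. c j * g j x)" for x
  proof -
    have "(\<Sum>i<m. l2_inner F (g m) (e i) * e i x)
        = (\<Sum>i<m. \<Sum>j<m. l2_inner F (g m) (e i) * b i j * g j x)"
      by (simp add: e sum_distrib_left mult.assoc)
    also have "\<dots> = (\<Sum>j<m. (\<Sum>i<m. l2_inner F (g m) (e i) * b i j) * g j x)"
      by (subst sum.swap) (simp add: sum_distrib_right)
    also have "\<dots> = - (\<Sum>j<m. c j * g j x)"
      by (simp add: c_def sum_negf)
    finally show ?thesis by (simp add: r_def l2_residual_def c_def)
  qed
  have "l2_inner F r r \<noteq> 0"
  proof
    assume "l2_inner F r r = 0"
    then have "AE x in F. r x = 0" using l2_inner_self_eq_0[OF sr] by simp
    then have "\<forall>i<Suc m. c i = 0" by (intro Suc.prems(2)) (simp add: r_g)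
    then show False by (auto simp: c_def)
  qed
  then have rr: "l2_inner F r r > 0" using l2_inner_self_nonneg[of F r] by simp
  define w where "w = 1 / sqrt (l2_inner F r r)"
  define e' where "e' = e(m := (\<lambda>x. w * r x))"
  define b' where "b' i j = (if i = m then w * c j else if j = m then 0 else b i j)" for i j
  have w: "l2_inner F (\<lambda>x. w * r x) f = w * l2_inner F r f" if "square_integrable F f" for f
    using l2_inner_lincomb[OF sr sr that, of w 0] by simp
  have w': "l2_inner F f (\<lambda>x. w * r x) = w * l2_inner F f r" if "square_integrable F f" for f
    using w[OF that] by (simp add: l2_inner_commute)
  have ww: "w * (w * l2_inner F r r) = 1"
    using rr by (simp add: w_def field_simps)
  show ?case
  proof (rule exI[of _ e'], rule exI[of _ b'], intro conjI allI impI)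
    fix i assume "i < Suc m"
    then show "e' i = (\<lambda>x. \<Sum>j<Suc m. b' i j * g j x)"
      by (auto simp: e'_def b'_def r_g e sum_distrib_left distrib_left mult.assoc)
  next
    fix i j assume "i < Suc m" "j < Suc m"
    then show "l2_inner F (e' i) (e' j) = (if i = j then 1 else 0)"
      using on r_e se sr ww square_integrable_cmult[OF sr]
      by (auto simp: e'_def less_Suc_eq w w' l2_inner_commute)
  next
    fix f i assume f: "square_integrable F f" and 0: "\<forall>i<Suc m. l2_inner F f (e' i) = 0" and i: "i < Suc m"
    have fe: "l2_inner F f (e i) = 0" if "i < m" for i
      using 0 that by (auto simp: e'_def dest: spec[of _ i])
    have "w * l2_inner F f r = 0"
      using 0 w'[OF f] by (auto simp: e'_def)
    then have "l2_inner F r f = 0" using rr by (auto simp: w_def l2_inner_commute)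
    moreover have "l2_inner F r f = l2_inner F (g m) f - (\<Sum>i<m. l2_inner F (g m) (e i) * l2_inner F (e i) f)"
      unfolding r_def by (rule l2_inner_residual) (use sg se on f in auto)
    moreover have "(\<Sum>i<m. l2_inner F (g m) (e i) * l2_inner F (e i) f) = 0"
      using fe by (intro sum.neutral) (auto simp: l2_inner_commute)
    ultimately have "l2_inner F f (g m) = 0" by (simp add: l2_inner_commute)
    then show "l2_inner F f (g i) = 0" using perp[OF f fe] i by (auto simp: less_Suc_eq)
  qed
qed

section \<open>The kernel as an inner product of centred step functions\<close>

definition step :: "real \<Rightarrow> real \<Rightarrow> real" where
  "step x t = (if x \<le> t then 1 else 0)"

lemma measurable_step [measurable]:
  assumes [measurable]: "f \<in> borel_measurable M" "g \<in> borel_measurable M"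
  shows "(\<lambda>p. step (f p) (g p)) \<in> borel_measurable M"
  unfolding step_def by measurable

lemma abs_step_diff: "\<bar>step x t - step y t\<bar> = indicator {min x y..<max x y} t"
  by (auto simp: step_def indicator_def)

lemma integrable_step_diff: "integrable lborel (\<lambda>t. step x t - step y t)"
  and integral_abs_step_diff: "(\<integral>t. \<bar>step x t - step y t\<bar> \<partial>lborel) = \<bar>x - y\<bar>"
proof -
  have i: "integrable lborel (\<lambda>t. \<bar>step x t - step y t\<bar>)"
    unfolding abs_step_diff by (rule integrable_real_indicator) auto
  show "integrable lborel (\<lambda>t. step x t - step y t)"
    using i by (subst integrable_abs_iff[symmetric]) auto
  show "(\<integral>t. \<bar>step x t - step y t\<bar> \<partial>lborel) = \<bar>x - y\<bar>"
    unfolding abs_step_diff by (auto simp: max_def min_def)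
qed

lemma integral_step_product:
  shows "integrable lborel (\<lambda>t. (step x t - step u t) * (step y t - step v t))"
    and "(\<integral>t. (step x t - step u t) * (step y t - step v t) \<partial>lborel)
      = - (1/2) * (\<bar>x - y\<bar> - \<bar>x - v\<bar> - \<bar>u - y\<bar> + \<bar>u - v\<bar>)"
proof -
  have sq: "(step a t - step b t)\<^sup>2 = \<bar>step a t - step b t\<bar>" for a b t
    by (auto simp: step_def)
  have eq: "(step x t - step u t) * (step y t - step v t)
    = 1/2 * (\<bar>step x t - step v t\<bar> + \<bar>step u t - step y t\<bar> - \<bar>step x t - step y t\<bar> - \<bar>step u t - step v t\<bar>)" for t
    unfolding sq[symmetric] by (simp add: power2_eq_square algebra_simps)
  show "integrable lborel (\<lambda>t. (step x t - step u t) * (step y t - step v t))"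
    unfolding eq by (intro integrable_mult_right Bochner_Integration.integrable_diff
        Bochner_Integration.integrable_add integrable_abs integrable_step_diff)
  show "(\<integral>t. (step x t - step u t) * (step y t - step v t) \<partial>lborel)
      = - (1/2) * (\<bar>x - y\<bar> - \<bar>x - v\<bar> - \<bar>u - y\<bar> + \<bar>u - v\<bar>)"
    unfolding eq by (simp add: integrable_abs integrable_step_diff integral_abs_step_diff field_simps)
qed

locale finite_variance_distribution = real_distribution F for F :: "real measure" +
  assumes integrable_square: "integrable F (\<lambda>x. x\<^sup>2)"
begin

text \<open>The pairing with \<open>centred_step\<close> takes \<open>L\<^sup>2(F)\<close> to \<open>L\<^sup>2\<close> of the line (\<open>coef\<close> below) and factorises
  the integral operator \<open>T\<close> of the kernel.\<close>

definition centred_step :: "real \<Rightarrow> real \<Rightarrow> real" where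
  "centred_step t x = step x t - cdf F t"

definition mean_dist :: "real \<Rightarrow> real" where
  "mean_dist x = (\<integral>u. \<bar>x - u\<bar> \<partial>F)"

abbreviation ker :: "real \<Rightarrow> real \<Rightarrow> real" where
  "ker \<equiv> bergsma_kernel F"

abbreviation T :: "(real \<Rightarrow> real) \<Rightarrow> real \<Rightarrow> real" where
  "T \<equiv> integral_op F ker"

definition coef :: "(real \<Rightarrow> real) \<Rightarrow> real \<Rightarrow> real" where
  "coef f t = l2_inner F (centred_step t) f"

definition tr :: real where
  "tr = (\<integral>x. ker x x \<partial>F)"

definition nrm :: "(real \<Rightarrow> real) \<Rightarrow> real" where
  "nrm f = sqrt (l2_inner F f f)"

sublocale FL: pair_sigma_finite F lborel ..
sublocale FF: pair_prob_space F F ..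

lemma prob_UNIV [simp]: "prob UNIV = 1"
  using prob_space by simp

lemma sqi_borel: "square_integrable F f \<Longrightarrow> f \<in> borel_measurable borel"
  unfolding square_integrable_def by (metis events_eq_borel measurable_cong_sets)

lemma sqi_lborel_borel: "square_integrable lborel f \<Longrightarrow> f \<in> borel_measurable borel"
  unfolding square_integrable_def by simp

lemma sqi_id: "square_integrable F (\<lambda>x. x)"
  using integrable_square by (simp add: square_integrable_def)

lemma sqi_const: "square_integrable F (\<lambda>x. c)"
  by (simp add: square_integrable_def)

lemma sqi_integrable: "square_integrable F f \<Longrightarrow> integrable F f"
  using square_integrable_mult[OF _ sqi_const[of 1]] by simp

lemma sqi_dominated:
  assumes g: "square_integrable F g" and [measurable]: "f \<in> borel_measurable F" and "\<And>x. \<bar>f x\<bar> \<le> \<bar>g x\<bar>"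
  shows "square_integrable F f"
  unfolding square_integrable_def
proof
  show "integrable F (\<lambda>x. (f x)\<^sup>2)"
    by (rule Bochner_Integration.integrable_bound[of F "\<lambda>x. (g x)\<^sup>2"])
       (use g assms(3) in \<open>auto simp: square_integrable_def abs_le_square_iff\<close>)
qed simp

lemma integrable_id: "integrable F (\<lambda>x. x)"
  by (rule sqi_integrable[OF sqi_id])

lemma integrable_abs_diff: "integrable F (\<lambda>u. \<bar>x - u\<bar>)"
  using integrable_id by auto

lemma cdf_eq_integral: "cdf F t = (\<integral>u. step u t \<partial>F)"
proof -
  have "(\<integral>u. step u t \<partial>F) = (\<integral>u. indicator {..t} u \<partial>F)"
    by (intro Bochner_Integration.integral_cong) (auto simp: step_def indicator_def)
  then show ?thesis by (simp add: cdf_def)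
qed

lemma integrable_step: "integrable F (\<lambda>u. step u t)"
  by (rule integrable_const_bound[of _ 1]) (auto simp: step_def)

lemma measurable_cdf [measurable]: "cdf F \<in> borel_measurable borel"
  unfolding cdf_eq_integral by measurable

lemma measurable_centred_step [measurable]:
  assumes [measurable]: "f \<in> borel_measurable M" "g \<in> borel_measurable M"
  shows "(\<lambda>p. centred_step (f p) (g p)) \<in> borel_measurable M"
  unfolding centred_step_def by measurable

lemma abs_centred_step_le_1: "\<bar>centred_step t x\<bar> \<le> 1"
  using cdf_nonneg[of t] cdf_bounded_prob[of t] by (auto simp: centred_step_def step_def)

lemma centred_step_eq_integral: "centred_step t x = (\<integral>u. step x t - step u t \<partial>F)"
  by (simp add: centred_step_def cdf_eq_integral integrable_step prob_space)

lemma integral_centred_step: "(\<integral>x. centred_step t x \<partial>F) = 0"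
  by (simp add: centred_step_def cdf_eq_integral integrable_step prob_space)

lemma mean_dist_nonneg: "0 \<le> mean_dist x"
  by (simp add: mean_dist_def)

lemma measurable_mean_dist [measurable]: "mean_dist \<in> borel_measurable borel"
  unfolding mean_dist_def by measurable

lemma sqi_mean_dist: "square_integrable F mean_dist"
proof (rule sqi_dominated)
  have i: "integrable F (\<lambda>u. \<bar>u\<bar>)" using integrable_id by simp
  show "square_integrable F (\<lambda>x. 1 * \<bar>x\<bar> + (\<integral>u. \<bar>u\<bar> \<partial>F) * 1)"
    using sqi_id by (intro square_integrable_lincomb sqi_const) (simp add: square_integrable_def)
  show "\<bar>mean_dist x\<bar> \<le> \<bar>1 * \<bar>x\<bar> + (\<integral>u. \<bar>u\<bar> \<partial>F) * 1\<bar>" for x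
  proof -
    have "mean_dist x \<le> (\<integral>u. \<bar>x\<bar> + \<bar>u\<bar> \<partial>F)"
      unfolding mean_dist_def by (rule integral_mono) (use integrable_abs_diff i in auto)
    also have "\<dots> = \<bar>x\<bar> + (\<integral>u. \<bar>u\<bar> \<partial>F)" using i by (simp add: prob_space)
    finally show ?thesis using mean_dist_nonneg[of x] by simp
  qed
qed simp

text \<open>\<open>centred_step t x\<close> averages \<open>step x t - step u t\<close> over \<open>u\<close>, and the absolute value of the latter
  integrates to \<open>|x - u|\<close> over \<open>t\<close>.\<close>

lemma integrable_centred_step: "integrable lborel (\<lambda>t. centred_step t x)"
  and integral_abs_centred_step: "(\<integral>t. \<bar>centred_step t x\<bar> \<partial>lborel) \<le> mean_dist x"
proof -
  have int: "integrable (F \<Otimes>\<^sub>M lborel) (\<lambda>(u, t). step x t - step u t)"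
  proof (rule FL.Fubini_integrable)
    show "(\<lambda>(u, t). step x t - step u t) \<in> borel_measurable (F \<Otimes>\<^sub>M lborel)"
      by measurable
    show "integrable F (\<lambda>u. \<integral>t. norm (case (u, t) of (u, t) \<Rightarrow> step x t - step u t) \<partial>lborel)"
      by (simp add: integral_abs_step_diff integrable_abs_diff)
    show "AE u in F. integrable lborel (\<lambda>t. case (u, t) of (u, t) \<Rightarrow> step x t - step u t)"
      by (simp add: integrable_step_diff)
  qed
  show i: "integrable lborel (\<lambda>t. centred_step t x)"
    unfolding centred_step_eq_integral by (rule FL.integrable_snd[OF int])
  have int': "integrable (F \<Otimes>\<^sub>M lborel) (\<lambda>(u, t). \<bar>step x t - step u t\<bar>)"
    using integrable_abs[OF int] by (simp add: case_prod_unfold)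
  have "(\<integral>t. \<bar>centred_step t x\<bar> \<partial>lborel) \<le> (\<integral>t. (\<integral>u. \<bar>step x t - step u t\<bar> \<partial>F) \<partial>lborel)"
  proof (rule integral_mono)
    show "integrable lborel (\<lambda>t. \<integral>u. \<bar>step x t - step u t\<bar> \<partial>F)"
      by (rule FL.integrable_snd[OF int'])
    show "\<bar>centred_step t x\<bar> \<le> (\<integral>u. \<bar>step x t - step u t\<bar> \<partial>F)" for t
      unfolding centred_step_eq_integral by (rule integral_abs_bound)
  qed (use i in auto)
  also have "\<dots> = (\<integral>u. (\<integral>t. \<bar>step x t - step u t\<bar> \<partial>lborel) \<partial>F)"
    by (rule FL.Fubini_integral[OF int'])
  also have "\<dots> = mean_dist x" by (simp add: integral_abs_step_diff mean_dist_def)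
  finally show "(\<integral>t. \<bar>centred_step t x\<bar> \<partial>lborel) \<le> mean_dist x" .
qed

lemma integrable_centred_step_mult:
  assumes [measurable]: "g \<in> borel_measurable lborel" and "\<And>t. \<bar>g t\<bar> \<le> C"
  shows "integrable lborel (\<lambda>t. centred_step t x * g t)"
proof (rule Bochner_Integration.integrable_bound)
  show "integrable lborel (\<lambda>t. C * centred_step t x)" using integrable_centred_step by simp
  show "AE t in lborel. norm (centred_step t x * g t) \<le> norm (C * centred_step t x)"
  proof (rule AE_I2)
    fix t
    have "\<bar>g t\<bar> * \<bar>centred_step t x\<bar> \<le> \<bar>C\<bar> * \<bar>centred_step t x\<bar>"
      using assms(2)[of t] by (intro mult_right_mono) auto
    then show "norm (centred_step t x * g t) \<le> norm (C * centred_step t x)"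
      by (simp add: abs_mult mult.commute)
  qed
qed simp

lemma sqi_centred_step: "square_integrable F (centred_step t)"
  by (rule sqi_dominated[OF sqi_const[of 1]]) (auto simp: abs_centred_step_le_1)

lemma sqi_lborel_centred_step: "square_integrable lborel (\<lambda>t. centred_step t x)"
  using integrable_centred_step_mult[of "\<lambda>t. centred_step t x" 1 x] abs_centred_step_le_1
  by (simp add: square_integrable_def power2_eq_square)

text \<open>Averaging the product of step differences over independent \<open>u\<close> and \<open>v\<close> gives the double
  centring of \<open>-|x - y| / 2\<close> on one side and the product of centred steps on the other.\<close>

lemma ker_eq: "ker x y = (\<integral>t. centred_step t x * centred_step t y \<partial>lborel)"
proof -
  interpret PL: pair_sigma_finite "F \<Otimes>\<^sub>M F" lborel ..
  let ?f = "\<lambda>(p :: real \<times> real) t. (step x t - step (fst p) t) * (step y t - step (snd p) t)"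
  have le: "\<bar>step a t - step b t\<bar> \<le> 1" for a b t by (simp add: step_def)
  have int: "integrable ((F \<Otimes>\<^sub>M F) \<Otimes>\<^sub>M lborel) (case_prod ?f)"
  proof (rule PL.Fubini_integrable)
    have "(\<integral>t. \<bar>?f p t\<bar> \<partial>lborel) \<le> \<bar>x - fst p\<bar>" for p
    proof -
      have "(\<integral>t. \<bar>?f p t\<bar> \<partial>lborel) \<le> (\<integral>t. \<bar>step x t - step (fst p) t\<bar> \<partial>lborel)"
        using integrable_abs[OF integral_step_product(1)[of x "fst p" y "snd p"]]
        by (intro integral_mono) (auto intro!: integrable_step_diff mult_left_le le simp: abs_mult)
      then show ?thesis by (simp add: integral_abs_step_diff)
    qed
    moreover have "integrable (F \<Otimes>\<^sub>M F) (\<lambda>p. \<bar>x - fst p\<bar>)"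
      using FF.integrable_fst'[of "\<lambda>p. \<bar>x - fst p\<bar>"] integrable_abs_diff[of x]
      by (intro FF.Fubini_integrable) (auto simp: prob_space)
    ultimately show "integrable (F \<Otimes>\<^sub>M F) (\<lambda>p. \<integral>t. norm (case (p, t) of (p, t) \<Rightarrow> ?f p t) \<partial>lborel)"
      by (elim Bochner_Integration.integrable_bound) (auto intro!: AE_I2 simp: abs_of_nonneg)
  qed (auto intro: integral_step_product)
  have "ker x y = (\<integral>p. (\<integral>t. ?f p t \<partial>lborel) \<partial>(F \<Otimes>\<^sub>M F))"
    unfolding bergsma_kernel_def integral_step_product by (simp add: case_prod_unfold)
  also have "\<dots> = (\<integral>t. (\<integral>p. ?f p t \<partial>(F \<Otimes>\<^sub>M F)) \<partial>lborel)"
    by (rule PL.Fubini_integral[OF int, symmetric])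
  also have "(\<lambda>t. (\<integral>p. ?f p t \<partial>(F \<Otimes>\<^sub>M F))) = (\<lambda>t. centred_step t x * centred_step t y)"
  proof
    fix t
    have "integrable (F \<Otimes>\<^sub>M F) (\<lambda>p. ?f p t)"
      by (rule FF.P.integrable_const_bound[of _ 1]) (auto simp: abs_mult mult_le_one le)
    then have "(\<integral>p. ?f p t \<partial>(F \<Otimes>\<^sub>M F)) = (\<integral>u. (\<integral>v. ?f (u, v) t \<partial>F) \<partial>F)"
      by (rule FF.integral_fst'[symmetric])
    then show "(\<integral>p. ?f p t \<partial>(F \<Otimes>\<^sub>M F)) = centred_step t x * centred_step t y"
      by (simp add: centred_step_eq_integral)
  qed
  finally show ?thesis .
qed

lemma ker_commute: "ker x y = ker y x"
  by (simp add: ker_eq mult.commute)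

lemma ker_eq_inner: "ker x y = l2_inner lborel (\<lambda>t. centred_step t x) (\<lambda>t. centred_step t y)"
  by (simp add: ker_eq l2_inner_def)

lemma measurable_ker [measurable]:
  assumes [measurable]: "f \<in> borel_measurable M" "g \<in> borel_measurable M"
  shows "(\<lambda>p. ker (f p) (g p)) \<in> borel_measurable M"
  unfolding ker_eq by measurable

lemma abs_ker_le: "\<bar>ker x y\<bar> \<le> mean_dist x"
proof -
  have "\<bar>ker x y\<bar> \<le> (\<integral>t. \<bar>centred_step t x * centred_step t y\<bar> \<partial>lborel)"
    unfolding ker_eq by (rule integral_abs_bound)
  also have "\<dots> \<le> (\<integral>t. \<bar>centred_step t x\<bar> \<partial>lborel)"
    using integrable_abs[OF integrable_centred_step_mult[of "\<lambda>t. centred_step t y" 1 x]]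
    by (intro integral_mono)
       (auto intro!: integrable_centred_step mult_left_le simp: abs_mult abs_centred_step_le_1)
  also have "\<dots> \<le> mean_dist x" by (rule integral_abs_centred_step)
  finally show ?thesis .
qed

lemma ker_diag_nonneg: "0 \<le> ker x x"
  by (simp add: ker_eq_inner l2_inner_self_nonneg)

lemma integrable_ker_diag: "integrable F (\<lambda>x. ker x x)"
  by (rule Bochner_Integration.integrable_bound[OF sqi_integrable[OF sqi_mean_dist]])
     (auto simp: abs_ker_le mean_dist_nonneg)

lemma tr_nonneg: "0 \<le> tr"
  by (simp add: tr_def ker_diag_nonneg)

lemma nrm_nonneg: "0 \<le> nrm f"
  by (simp add: nrm_def l2_inner_self_nonneg)

lemma nrm_centred_step_le_1: "nrm (centred_step t) \<le> 1"
proof -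
  have "l2_inner F (centred_step t) (centred_step t) \<le> (\<integral>x. 1 \<partial>F)"
    unfolding l2_inner_self using sqi_centred_step[of t] abs_centred_step_le_1[of t]
    by (intro integral_mono) (auto simp: square_integrable_def abs_square_le_1)
  then show ?thesis by (simp add: nrm_def)
qed

lemma l2_Cauchy_Schwarz_nrm:
  "square_integrable F f \<Longrightarrow> square_integrable F g \<Longrightarrow> \<bar>l2_inner F f g\<bar> \<le> nrm f * nrm g"
  unfolding nrm_def by (rule l2_Cauchy_Schwarz_abs)

lemma integrable_centred_step_prod:
  assumes g: "square_integrable F g"
  shows "integrable (F \<Otimes>\<^sub>M lborel) (\<lambda>(x, t). centred_step t x * g x)"
proof (rule FL.Fubini_integrable)
  have [measurable]: "g \<in> borel_measurable borel" by (rule sqi_borel[OF g])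
  show "(\<lambda>(x, t). centred_step t x * g x) \<in> borel_measurable (F \<Otimes>\<^sub>M lborel)" by measurable
  show "integrable F (\<lambda>x. \<integral>t. norm (case (x, t) of (x, t) \<Rightarrow> centred_step t x * g x) \<partial>lborel)"
  proof (rule Bochner_Integration.integrable_bound[OF square_integrable_mult[OF sqi_mean_dist g]])
    show "AE x in F. norm (\<integral>t. norm (case (x, t) of (x, t) \<Rightarrow> centred_step t x * g x) \<partial>lborel)
        \<le> norm (mean_dist x * g x)"
      using integral_abs_centred_step mean_dist_nonneg
      by (auto intro!: AE_I2 mult_right_mono simp: abs_mult)
  qed measurable
  show "AE x in F. integrable lborel (\<lambda>t. case (x, t) of (x, t) \<Rightarrow> centred_step t x * g x)"
    using integrable_centred_step by auto
qed

lemma integrable_coef: "square_integrable F f \<Longrightarrow> integrable lborel (coef f)"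
  using FL.integrable_snd[OF integrable_centred_step_prod] by (simp add: coef_def[abs_def] l2_inner_def)

lemma abs_coef_le: "square_integrable F f \<Longrightarrow> \<bar>coef f t\<bar> \<le> nrm f"
  using l2_Cauchy_Schwarz_nrm[OF sqi_centred_step[of t]] nrm_centred_step_le_1[of t]
    mult_right_mono[of "nrm (centred_step t)" 1 "nrm f"] nrm_nonneg[of f]
  unfolding coef_def by fastforce

lemma sqi_coef: 
  assumes f: "square_integrable F f" shows "square_integrable lborel (coef f)"
  unfolding square_integrable_def
proof
  have i: "integrable lborel (coef f)" by (rule integrable_coef[OF f])
  then show [measurable]: "coef f \<in> borel_measurable lborel" by simp
  show "integrable lborel (\<lambda>t. (coef f t)\<^sup>2)"
  proof (rule Bochner_Integration.integrable_bound)
    show "integrable lborel (\<lambda>t. nrm f * coef f t)" using i by simp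
    show "AE t in lborel. norm ((coef f t)\<^sup>2) \<le> norm (nrm f * coef f t)"
      using mult_right_mono[OF abs_coef_le[OF f] abs_ge_zero] nrm_nonneg[of f]
      by (auto intro!: AE_I2 simp: power2_eq_square abs_mult simp del: abs_mult_self_eq)
  qed simp
qed

lemma coef_lincomb:
  assumes "square_integrable F f" "square_integrable F g"
  shows "coef (\<lambda>x. a * f x + b * g x) t = a * coef f t + b * coef g t"
  unfolding coef_def l2_inner_commute[of F "centred_step t"]
  by (rule l2_inner_lincomb[OF assms sqi_centred_step])

lemma T_eq:
  assumes f: "square_integrable F f"
  shows "T f x = (\<integral>t. centred_step t x * coef f t \<partial>lborel)"
proof -
  have [measurable]: "f \<in> borel_measurable borel" by (rule sqi_borel[OF f])
  have int: "integrable (F \<Otimes>\<^sub>M lborel) (\<lambda>(y, t). centred_step t x * centred_step t y * f y)"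
  proof (rule Bochner_Integration.integrable_bound[OF integrable_centred_step_prod[OF f]])
    show "AE p in F \<Otimes>\<^sub>M lborel. norm (case p of (y, t) \<Rightarrow> centred_step t x * centred_step t y * f y)
         \<le> norm (case p of (x, t) \<Rightarrow> centred_step t x * f x)"
      by (auto intro!: AE_I2 mult_right_mono mult_left_le_one_le simp: abs_mult abs_centred_step_le_1)
  qed measurable
  have "T f x = (\<integral>y. (\<integral>t. centred_step t x * centred_step t y * f y \<partial>lborel) \<partial>F)"
    by (simp add: integral_op_def ker_eq)
  also have "\<dots> = (\<integral>t. (\<integral>y. centred_step t x * centred_step t y * f y \<partial>F) \<partial>lborel)"
    by (rule FL.Fubini_integral[OF int, symmetric])
  finally show ?thesis by (simp add: coef_def l2_inner_def mult.assoc)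
qed

lemma measurable_T [measurable]: "square_integrable F f \<Longrightarrow> T f \<in> borel_measurable borel"
proof -
  assume f: "square_integrable F f"
  have [measurable]: "coef f \<in> borel_measurable borel" by (rule sqi_lborel_borel[OF sqi_coef[OF f]])
  show "T f \<in> borel_measurable borel"
    by (subst measurable_cong[OF T_eq[OF f]]) measurable
qed

lemma abs_T_le:
  assumes f: "square_integrable F f"
  shows "\<bar>T f x\<bar> \<le> mean_dist x * nrm f"
proof -
  have [measurable]: "coef f \<in> borel_measurable borel" by (rule sqi_lborel_borel[OF sqi_coef[OF f]])
  have "\<bar>T f x\<bar> \<le> (\<integral>t. \<bar>centred_step t x * coef f t\<bar> \<partial>lborel)"
    unfolding T_eq[OF f] by (rule integral_abs_bound)
  also have "\<dots> \<le> (\<integral>t. \<bar>centred_step t x\<bar> * nrm f \<partial>lborel)"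
    using integrable_abs[OF integrable_centred_step_mult[of "coef f" "nrm f" x]] 
    by (intro integral_mono)
       (auto intro!: integrable_abs integrable_centred_step
         integrable_mult_left mult_left_mono simp: abs_mult abs_coef_le[OF f])
  also have "\<dots> \<le> mean_dist x * nrm f"
    using integral_abs_centred_step nrm_nonneg by (simp add: mult_right_mono)
  finally show ?thesis .
qed

lemma T_Lipschitz:
  assumes f: "square_integrable F f"
  shows "\<bar>T f x - T f y\<bar> \<le> \<bar>x - y\<bar> * nrm f"
proof -
  have [measurable]: "coef f \<in> borel_measurable borel" by (rule sqi_lborel_borel[OF sqi_coef[OF f]])
  have i: "integrable lborel (\<lambda>t. centred_step t z * coef f t)" for z
    by (rule integrable_centred_step_mult[of _ "nrm f"]) (auto simp: abs_coef_le[OF f])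
  have eq: "(step x t - step y t) * coef f t = centred_step t x * coef f t - centred_step t y * coef f t" for t
    by (simp add: centred_step_def algebra_simps)
  have i': "integrable lborel (\<lambda>t. (step x t - step y t) * coef f t)"
    unfolding eq using i by simp
  have "T f x - T f y = (\<integral>t. (step x t - step y t) * coef f t \<partial>lborel)"
    unfolding T_eq[OF f] eq using i by simp
  then have "\<bar>T f x - T f y\<bar> \<le> (\<integral>t. \<bar>(step x t - step y t) * coef f t\<bar> \<partial>lborel)"
    by (metis integral_abs_bound)
  also have "\<dots> \<le> (\<integral>t. \<bar>step x t - step y t\<bar> * nrm f \<partial>lborel)"
    using integrable_abs[OF i'] by (intro integral_mono)
       (auto intro!: integrable_abs integrable_step_diff integrable_mult_left mult_left_mono
         simp: abs_mult abs_coef_le[OF f])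
  also have "\<dots> = \<bar>x - y\<bar> * nrm f"
    by (simp add: integral_abs_step_diff)
  finally show ?thesis .
qed

lemma sqi_T: 
  assumes f: "square_integrable F f" shows "square_integrable F (T f)"
proof (rule sqi_dominated)
  show "square_integrable F (\<lambda>x. nrm f * mean_dist x)" by (rule square_integrable_cmult[OF sqi_mean_dist])
  show "\<bar>T f x\<bar> \<le> \<bar>nrm f * mean_dist x\<bar>" for x
    using abs_T_le[OF f, of x] by (simp add: mult.commute)
qed (use f in measurable)

text \<open>\<open>T\<close> is the composition of \<open>coef\<close> with its adjoint, hence symmetric and positive.\<close>

lemma l2_inner_T:
  assumes f: "square_integrable F f" and g: "square_integrable F g"
  shows "l2_inner F (T f) g = l2_inner lborel (coef f) (coef g)"
proof -
  have [measurable]: "coef f \<in> borel_measurable borel" "g \<in> borel_measurable borel"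
    by (rule sqi_lborel_borel[OF sqi_coef[OF f]], rule sqi_borel[OF g])
  have int: "integrable (F \<Otimes>\<^sub>M lborel) (\<lambda>(x, t). centred_step t x * g x * coef f t)"
  proof (rule Bochner_Integration.integrable_bound)
    show "integrable (F \<Otimes>\<^sub>M lborel) (\<lambda>p. nrm f * (case p of (x, t) \<Rightarrow> centred_step t x * g x))"
      by (rule integrable_mult_right[OF integrable_centred_step_prod[OF g]])
    show "AE p in F \<Otimes>\<^sub>M lborel. norm (case p of (x, t) \<Rightarrow> centred_step t x * g x * coef f t)
         \<le> norm (nrm f * (case p of (x, t) \<Rightarrow> centred_step t x * g x))"
    proof (rule AE_I2, clarify)
      fix x t
      have "\<bar>coef f t\<bar> * \<bar>centred_step t x * g x\<bar> \<le> nrm f * \<bar>centred_step t x * g x\<bar>"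
        by (rule mult_right_mono[OF abs_coef_le[OF f]]) simp
      then show "norm (centred_step t x * g x * coef f t) \<le> norm (nrm f * (centred_step t x * g x))"
        using nrm_nonneg[of f] by (simp add: abs_mult mult_ac)
    qed
  qed measurable
  have "l2_inner F (T f) g = (\<integral>x. (\<integral>t. centred_step t x * g x * coef f t \<partial>lborel) \<partial>F)"
    unfolding l2_inner_def T_eq[OF f] integral_mult_left_zero[symmetric] by (simp add: mult_ac)
  also have "\<dots> = (\<integral>t. (\<integral>x. centred_step t x * g x * coef f t \<partial>F) \<partial>lborel)"
    by (rule FL.Fubini_integral[OF int, symmetric])
  also have "\<dots> = l2_inner lborel (coef f) (coef g)"
    by (simp add: coef_def[of g] l2_inner_def mult.commute)
  finally show ?thesis .
qed

lemma l2_inner_T_commute: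
  "square_integrable F f \<Longrightarrow> square_integrable F g \<Longrightarrow> l2_inner F (T f) g = l2_inner F f (T g)"
  by (metis l2_inner_T l2_inner_commute)

text \<open>The trace is the integral of the squares of \<open>centred_step t x\<close> over both variables, here taken in
  the other order.\<close>

lemma tr_eq: "integrable lborel (\<lambda>t. l2_inner F (centred_step t) (centred_step t))"
  "tr = (\<integral>t. l2_inner F (centred_step t) (centred_step t) \<partial>lborel)"
proof -
  have int: "integrable (F \<Otimes>\<^sub>M lborel) (\<lambda>(x, t). centred_step t x * centred_step t x)"
  proof (rule Bochner_Integration.integrable_bound[OF integrable_centred_step_prod[OF sqi_const[of 1]]])
    show "AE p in F \<Otimes>\<^sub>M lborel. norm (case p of (y, t) \<Rightarrow> centred_step t y * centred_step t y)
         \<le> norm (case p of (x, t) \<Rightarrow> centred_step t x * 1)"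
      by (auto intro!: AE_I2 mult_left_le_one_le
          simp: abs_mult abs_centred_step_le_1 simp del: abs_mult_self_eq)
  qed measurable
  show "integrable lborel (\<lambda>t. l2_inner F (centred_step t) (centred_step t))"
    using FL.integrable_snd[OF int] by (simp add: l2_inner_def)
  show "tr = (\<integral>t. l2_inner F (centred_step t) (centred_step t) \<partial>lborel)"
    using FL.Fubini_integral[OF int] by (simp add: l2_inner_def tr_def ker_eq)
qed

lemma l2_inner_coef_le_tr:
  assumes f: "square_integrable F f"
  shows "l2_inner lborel (coef f) (coef f) \<le> tr * l2_inner F f f"
proof -
  have "l2_inner lborel (coef f) (coef f)
      \<le> (\<integral>t. l2_inner F (centred_step t) (centred_step t) * l2_inner F f f \<partial>lborel)"
    unfolding l2_inner_self[of lborel]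
  proof (rule integral_mono)
    show "integrable lborel (\<lambda>t. (coef f t)\<^sup>2)"
      using sqi_coef[OF f] by (simp add: square_integrable_def)
    show "(coef f t)\<^sup>2 \<le> l2_inner F (centred_step t) (centred_step t) * l2_inner F f f" for t
      unfolding coef_def by (rule l2_Cauchy_Schwarz[OF sqi_centred_step f])
  qed (use tr_eq in simp)
  then show ?thesis by (simp add: tr_eq)
qed

end

section \<open>Spectral expansion and trace\<close>

lemma l2_inner_self_lincomb:
  assumes f: "square_integrable F f" and g: "square_integrable F g"
  shows "l2_inner F (\<lambda>x. a * f x + b * g x) (\<lambda>x. a * f x + b * g x)
    = a\<^sup>2 * l2_inner F f f + 2 * a * b * l2_inner F f g + b\<^sup>2 * l2_inner F g g"
proof -
  have s: "square_integrable F (\<lambda>x. a * f x + b * g x)" by (rule square_integrable_lincomb[OF f g])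
  have 1: "l2_inner F f (\<lambda>x. a * f x + b * g x) = a * l2_inner F f f + b * l2_inner F f g"
    using l2_inner_lincomb[OF f g f] by (metis l2_inner_commute)
  have 2: "l2_inner F g (\<lambda>x. a * f x + b * g x) = a * l2_inner F f g + b * l2_inner F g g"
    using l2_inner_lincomb[OF f g g] by (metis l2_inner_commute)
  show ?thesis
    unfolding l2_inner_lincomb[OF f g s] 1 2 by (simp add: power2_eq_square algebra_simps)
qed

context finite_variance_distribution
begin

lemma sqi_ker: "square_integrable F (ker x)"
proof (rule sqi_dominated[OF sqi_const[of "mean_dist x"]])
  show "\<bar>ker x y\<bar> \<le> \<bar>mean_dist x\<bar>" for y using abs_ker_le[of x y] mean_dist_nonneg[of x] by simp
qed measurable

lemma T_eq_inner: "T f x = l2_inner F f (ker x)"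
  by (simp add: integral_op_def l2_inner_def mult.commute)

lemma T_lincomb:
  "square_integrable F f \<Longrightarrow> square_integrable F g \<Longrightarrow> T (\<lambda>x. a * f x + b * g x) x = a * T f x + b * T g x"
  unfolding T_eq_inner by (rule l2_inner_lincomb[OF _ _ sqi_ker])

lemma T_sum:
  "(\<And>i. i \<in> I \<Longrightarrow> square_integrable F (g i)) \<Longrightarrow> T (\<lambda>x. \<Sum>i\<in>I. a i * g i x) x = (\<Sum>i\<in>I. a i * T (g i) x)"
  unfolding T_eq_inner by (rule l2_inner_sum[OF _ sqi_ker])

lemma eigenspace_sqi: "f \<in> eigenspace F ker c \<Longrightarrow> square_integrable F f"
  by (simp add: eigenspace_def)

lemma eigenspace_l2_inner_T:
  assumes f: "f \<in> eigenspace F ker c" and g: "square_integrable F g"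
  shows "l2_inner F (T f) g = c * l2_inner F f g"
proof -
  have "l2_inner F (T f) g = l2_inner F (\<lambda>x. c * f x) g"
    using f sqi_borel[OF g] sqi_borel[OF eigenspace_sqi[OF f]] measurable_T[OF eigenspace_sqi[OF f]]
    by (intro l2_inner_cong_AE) (auto simp: eigenspace_def)
  then show ?thesis by (simp add: l2_inner_def mult.assoc)
qed

lemma eigenspace_orthogonal:
  assumes f: "f \<in> eigenspace F ker a" and g: "g \<in> eigenspace F ker b" and "a \<noteq> b"
  shows "l2_inner F f g = 0"
proof -
  have "a * l2_inner F f g = b * l2_inner F f g"
    using eigenspace_l2_inner_T[OF f eigenspace_sqi[OF g]] eigenspace_l2_inner_T[OF g eigenspace_sqi[OF f]]
      l2_inner_T_commute[OF eigenspace_sqi[OF f] eigenspace_sqi[OF g]]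
    by (simp add: l2_inner_commute)
  then show ?thesis using \<open>a \<noteq> b\<close> by simp
qed

lemma eigenspace_sum:
  fixes a :: "nat \<Rightarrow> real"
  assumes g: "\<And>i. i < m \<Longrightarrow> g i \<in> eigenspace F ker c"
  shows "(\<lambda>x. \<Sum>i<m. a i * g i x) \<in> eigenspace F ker c"
  unfolding eigenspace_def mem_Collect_eq
proof
  show "square_integrable F (\<lambda>x. \<Sum>i<m. a i * g i x)"
    using eigenspace_sqi[OF g] by (intro square_integrable_sum) auto
  have "AE x in F. \<forall>i\<in>{..<m}. T (g i) x = c * g i x"
    using g by (intro AE_finite_allI) (auto simp: eigenspace_def)
  then show "AE x in F. T (\<lambda>x. \<Sum>i<m. a i * g i x) x = c * (\<Sum>i<m. a i * g i x)"
  proof eventually_elim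
    case (elim x)
    have "T (\<lambda>x. \<Sum>i<m. a i * g i x) x = (\<Sum>i<m. a i * T (g i) x)"
      using eigenspace_sqi[OF g] by (intro T_sum) auto
    then show ?case using elim by (simp add: sum_distrib_left mult_ac)
  qed
qed

text \<open>The basis is indexed by \<open>K\<close>, which will be the set of positions at which a sequence lists the
  eigenvalue \<open>c\<close>.\<close>

lemma eigenspace_orthonormal_basis:
  fixes K :: "nat set"
  assumes K: "finite K" and mult: "eigen_multiplicity F ker c (card K)"
  shows "\<exists>e. (\<forall>k\<in>K. e k \<in> eigenspace F ker c) \<and>
     (\<forall>k\<in>K. \<forall>l\<in>K. l2_inner F (e k) (e l) = (if k = l then 1 else 0)) \<and>
     (\<forall>f\<in>eigenspace F ker c. (\<forall>k\<in>K. l2_inner F f (e k) = 0) \<longrightarrow> l2_inner F f f = 0)"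
proof -
  let ?m = "card K"
  obtain g :: "nat \<Rightarrow> real \<Rightarrow> real"
    where g: "\<And>i. i < ?m \<Longrightarrow> g i \<in> eigenspace F ker c"
    and ind: "\<And>a :: nat \<Rightarrow> real. (AE x in F. (\<Sum>i<?m. a i * g i x) = 0) \<Longrightarrow> \<forall>i<?m. a i = 0"
    and span: "\<And>f. f \<in> eigenspace F ker c \<Longrightarrow> \<exists>a :: nat \<Rightarrow> real. AE x in F. f x = (\<Sum>i<?m. a i * g i x)"
    using mult unfolding eigen_multiplicity_def by blast
  have "\<exists>(e :: nat \<Rightarrow> real \<Rightarrow> real) b. (\<forall>i<?m. e i = (\<lambda>x. \<Sum>j<?m. b i j * g j x)) \<and>
     (\<forall>i<?m. \<forall>j<?m. l2_inner F (e i) (e j) = (if i = j then 1 else 0)) \<and>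
     (\<forall>f. square_integrable F f \<longrightarrow> (\<forall>i<?m. l2_inner F f (e i) = 0) \<longrightarrow> (\<forall>i<?m. l2_inner F f (g i) = 0))"
    by (rule Gram_Schmidt[OF eigenspace_sqi[OF g] ind])
  then obtain e :: "nat \<Rightarrow> real \<Rightarrow> real" and b :: "nat \<Rightarrow> nat \<Rightarrow> real"
    where e: "\<forall>i<?m. e i = (\<lambda>x. \<Sum>j<?m. b i j * g j x)"
      and on: "\<forall>i<?m. \<forall>j<?m. l2_inner F (e i) (e j) = (if i = j then 1 else 0)"
      and perp: "\<forall>f. square_integrable F f \<longrightarrow> (\<forall>i<?m. l2_inner F f (e i) = 0) \<longrightarrow> (\<forall>i<?m. l2_inner F f (g i) = 0)"
    by (elim exE conjE)
  obtain h where h: "bij_betw h K {0..<?m}" using ex_bij_betw_finite_nat[OF K] by blast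
  have hK: "h k < ?m" if "k \<in> K" for k using h that by (auto simp: bij_betw_def)
  have inj: "h k = h l \<longleftrightarrow> k = l" if "k \<in> K" "l \<in> K" for k l
    using h that by (auto simp: bij_betw_def inj_on_def)
  show ?thesis
  proof (rule exI[of _ "\<lambda>k. e (h k)"], intro conjI ballI impI)
    fix k assume "k \<in> K"
    then show "e (h k) \<in> eigenspace F ker c" using e hK eigenspace_sum[OF g] by simp
  next
    fix k l assume "k \<in> K" "l \<in> K"
    then show "l2_inner F (e (h k)) (e (h l)) = (if k = l then 1 else 0)"
      using on hK inj by simp
  next
    fix f assume f: "f \<in> eigenspace F ker c" and 0: "\<forall>k\<in>K. l2_inner F f (e (h k)) = 0"
    have "l2_inner F f (e i) = 0" if "i < ?m" for i
    proof -
      have "i \<in> h ` K" using h that by (auto simp: bij_betw_def)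
      then show ?thesis using 0 by auto
    qed
    then have fg: "l2_inner F f (g i) = 0" if "i < ?m" for i
      using perp eigenspace_sqi[OF f] that by blast
    obtain a :: "nat \<Rightarrow> real" where a: "AE x in F. f x = (\<Sum>i<?m. a i * g i x)" using span[OF f] by blast
    have "l2_inner F f f = l2_inner F (\<lambda>x. \<Sum>i<?m. a i * g i x) f"
      using square_integrable_sum[of "{..<?m}" F g a] eigenspace_sqi[OF f] eigenspace_sqi[OF g]
      by (intro l2_inner_cong_AE[OF a]) (simp_all add: square_integrable_measurable)
    also have "\<dots> = (\<Sum>i<?m. a i * l2_inner F (g i) f)"
      using eigenspace_sqi[OF f] eigenspace_sqi[OF g] by (intro l2_inner_sum) auto
    also have "\<dots> = 0" using fg by (intro sum.neutral) (auto simp: l2_inner_commute)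
    finally show "l2_inner F f f = 0" .
  qed
qed

text \<open>Positions with eigenvalue zero carry a null function, since the sequence says nothing about how
  often zero is listed. The last clause expresses that the eigenspaces of the nonzero eigenvalues
  are exhausted.\<close>

definition eigenbasis :: "(nat \<Rightarrow> real) \<Rightarrow> (nat \<Rightarrow> real \<Rightarrow> real) \<Rightarrow> bool" where
  "eigenbasis lam e \<longleftrightarrow> (\<forall>k. e k \<in> eigenspace F ker (lam k)) \<and>
     (\<forall>k l. l2_inner F (e k) (e l) = (if k = l \<and> lam k \<noteq> 0 then 1 else 0)) \<and>
     (\<forall>c f. c \<noteq> 0 \<longrightarrow> f \<in> eigenspace F ker c \<longrightarrow>
        (\<forall>k. lam k = c \<longrightarrow> l2_inner F f (e k) = 0) \<longrightarrow> l2_inner F f f = 0)"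

lemma eigenbasis_exists:
  assumes lam: "eigenvalue_sequence F ker lam"
  shows "\<exists>e. eigenbasis lam e"
proof -
  have "\<forall>c. \<exists>e. c \<noteq> 0 \<longrightarrow> (\<forall>k\<in>{k. lam k = c}. e k \<in> eigenspace F ker c) \<and>
     (\<forall>k\<in>{k. lam k = c}. \<forall>l\<in>{k. lam k = c}. l2_inner F (e k) (e l) = (if k = l then 1 else 0)) \<and>
     (\<forall>f\<in>eigenspace F ker c. (\<forall>k\<in>{k. lam k = c}. l2_inner F f (e k) = 0) \<longrightarrow> l2_inner F f f = 0)"
    (is "\<forall>c. ?P c")
  proof
    fix c :: real
    show "?P c"
      using eigenspace_orthonormal_basis[of "{k. lam k = c}" c] lam
      unfolding eigenvalue_sequence_def by (cases "c = 0") auto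
  qed
  from choice[OF this] obtain E where E: "\<forall>c. c \<noteq> 0 \<longrightarrow> (\<forall>k\<in>{k. lam k = c}. E c k \<in> eigenspace F ker c) \<and>
     (\<forall>k\<in>{k. lam k = c}. \<forall>l\<in>{k. lam k = c}. l2_inner F (E c k) (E c l) = (if k = l then 1 else 0)) \<and>
     (\<forall>f\<in>eigenspace F ker c. (\<forall>k\<in>{k. lam k = c}. l2_inner F f (E c k) = 0) \<longrightarrow> l2_inner F f f = 0)"
    by blast
  define e where "e k = (if lam k = 0 then (\<lambda>x. 0) else E (lam k) k)" for k
  have zero: "(\<lambda>x. 0) \<in> eigenspace F ker 0"
    by (simp add: eigenspace_def square_integrable_zero integral_op_def)
  have mem: "e k \<in> eigenspace F ker (lam k)" for k
    using E zero by (simp add: e_def)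
  have on: "l2_inner F (e k) (e l) = (if k = l \<and> lam k \<noteq> 0 then 1 else 0)" for k l
  proof (cases "lam k = lam l")
    case True
    then show ?thesis using E by (auto simp: e_def l2_inner_def[of F "\<lambda>x. 0"])
  next
    case False
    then show ?thesis using eigenspace_orthogonal[OF mem mem False] by auto
  qed
  show ?thesis
    unfolding eigenbasis_def
    by (rule exI[of _ e], intro conjI allI impI mem on) (use E in \<open>simp add: e_def\<close>)
qed

end

locale bergsma_spectrum = finite_variance_distribution +
  fixes lam :: "nat \<Rightarrow> real"
  assumes eigenvalues: "eigenvalue_sequence F ker lam"
begin

definition eigenfun :: "nat \<Rightarrow> real \<Rightarrow> real" where
  "eigenfun = (SOME e. eigenbasis lam e)"

lemma eigenfun_eigenspace: "eigenfun k \<in> eigenspace F ker (lam k)"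
  and eigenfun_inner: "l2_inner F (eigenfun k) (eigenfun l) = (if k = l \<and> lam k \<noteq> 0 then 1 else 0)"
  and eigenfun_complete: "c \<noteq> 0 \<Longrightarrow> f \<in> eigenspace F ker c \<Longrightarrow>
    (\<And>k. lam k = c \<Longrightarrow> l2_inner F f (eigenfun k) = 0) \<Longrightarrow> l2_inner F f f = 0"
  using someI_ex[OF eigenbasis_exists[OF eigenvalues], folded eigenfun_def] unfolding eigenbasis_def by blast+

lemma sqi_eigenfun: "square_integrable F (eigenfun k)"
  by (rule eigenspace_sqi[OF eigenfun_eigenspace])

lemma coef_eigenfun_inner:
  "l2_inner lborel (coef (eigenfun k)) (coef (eigenfun l)) = (if k = l then lam k else 0)"
  using l2_inner_T[OF sqi_eigenfun sqi_eigenfun, of k l]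
    eigenspace_l2_inner_T[OF eigenfun_eigenspace sqi_eigenfun, of k l] by (auto simp: eigenfun_inner split: if_splits)

lemma lam_nonneg: "0 \<le> lam k"
  using l2_inner_self_nonneg[of lborel "coef (eigenfun k)"] by (simp add: coef_eigenfun_inner)

lemma integral_coef_eigenfun:
  "integrable lborel (\<lambda>t. (coef (eigenfun k) t)\<^sup>2)" "(\<integral>t. (coef (eigenfun k) t)\<^sup>2 \<partial>lborel) = lam k"
  using sqi_coef[OF sqi_eigenfun] coef_eigenfun_inner[of k k]
  by (auto simp: square_integrable_def l2_inner_self)

abbreviation resid :: "nat \<Rightarrow> (real \<Rightarrow> real) \<Rightarrow> real \<Rightarrow> real" where
  "resid K \<equiv> l2_residual F eigenfun {..<K}"

lemma
  assumes f: "square_integrable F f"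
  shows sqi_resid: "square_integrable F (resid K f)"
    and inner_resid: "square_integrable F g \<Longrightarrow> l2_inner F (resid K f) g
          = l2_inner F f g - (\<Sum>i<K. l2_inner F f (eigenfun i) * l2_inner F (eigenfun i) g)"
    and resid_orthogonal: "j < K \<Longrightarrow> l2_inner F (resid K f) (eigenfun j) = 0"
    and resid_norm: "l2_inner F (resid K f) (resid K f)
          = l2_inner F f f - (\<Sum>i<K. (l2_inner F f (eigenfun i))\<^sup>2)"
    and eigenfun_Bessel: "(\<Sum>i<K. (l2_inner F f (eigenfun i))\<^sup>2) \<le> l2_inner F f f"
proof -
  note r = f sqi_eigenfun finite_lessThan
  have o: "\<And>i j. i \<noteq> j \<Longrightarrow> l2_inner F (eigenfun i) (eigenfun j) = 0"
      "\<And>i. l2_inner F (eigenfun i) (eigenfun i) \<in> {0, 1}" by (auto simp: eigenfun_inner)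
  show "square_integrable F (resid K f)" by (rule square_integrable_residual[OF r o])
  show "square_integrable F g \<Longrightarrow> l2_inner F (resid K f) g
          = l2_inner F f g - (\<Sum>i<K. l2_inner F f (eigenfun i) * l2_inner F (eigenfun i) g)"
    by (rule l2_inner_residual[OF r o])
  show "j < K \<Longrightarrow> l2_inner F (resid K f) (eigenfun j) = 0" by (rule residual_orthogonal[OF r o]) auto
  show "l2_inner F (resid K f) (resid K f) = l2_inner F f f - (\<Sum>i<K. (l2_inner F f (eigenfun i))\<^sup>2)"
    by (rule residual_norm[OF r o])
  show "(\<Sum>i<K. (l2_inner F f (eigenfun i))\<^sup>2) \<le> l2_inner F f f" by (rule Bessel_inequality[OF r o])
qed

lemma sum_coef_eigenfun_le:
  "(\<Sum>k<K. (coef (eigenfun k) t)\<^sup>2) \<le> l2_inner F (centred_step t) (centred_step t)"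
  unfolding coef_def by (rule eigenfun_Bessel[OF sqi_centred_step])

text \<open>Bessel's inequality for \<open>centred_step t\<close>, integrated over \<open>t\<close>.\<close>

lemma sum_lam_le_tr: "(\<Sum>k<K. lam k) \<le> tr"
proof -
  have "(\<Sum>k<K. lam k) = (\<integral>t. (\<Sum>k<K. (coef (eigenfun k) t)\<^sup>2) \<partial>lborel)"
    by (simp add: integral_coef_eigenfun)
  also have "\<dots> \<le> tr"
    unfolding tr_eq(2)
    by (rule integral_mono) (auto intro!: tr_eq(1) integral_coef_eigenfun sum_coef_eigenfun_le)
  finally show ?thesis .
qed

lemma summable_lam: "summable lam"
  by (rule summableI_nonneg_bounded[OF lam_nonneg sum_lam_le_tr])

definition tail :: "nat \<Rightarrow> real" where
  "tail K = suminf lam - (\<Sum>k<K. lam k)"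

lemma tail_tendsto: "tail \<longlonglongrightarrow> 0"
  unfolding tail_def[abs_def] using tendsto_diff[OF tendsto_const[of "suminf lam"] summable_LIMSEQ[OF summable_lam]] by simp

lemma lam_le_tail:
  assumes "K \<le> j" shows "lam j \<le> tail K"
proof -
  have "(\<Sum>k<K. lam k) + lam j = (\<Sum>k\<in>insert j {..<K}. lam k)" using assms by simp
  also have "\<dots> \<le> suminf lam"
    by (rule sum_le_suminf[OF summable_lam]) (auto simp: lam_nonneg)
  finally show ?thesis by (simp add: tail_def)
qed

lemma tail_nonneg: "0 \<le> tail K"
  using lam_le_tail[of K K] lam_nonneg[of K] by simp

end

context finite_variance_distribution
begin

text \<open>Compactness of \<open>T\<close>: images of the unit ball are equi-Lipschitz and dominated by the square
  integrable function \<open>mean_dist\<close>.\<close>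

lemma T_compact:
  assumes f: "\<And>n :: nat. square_integrable F (f n)" and le: "\<And>n. nrm (f n) \<le> 1"
  shows "\<exists>k g. strict_mono (k :: nat \<Rightarrow> nat) \<and> square_integrable F g \<and>
    (\<forall>x. (\<lambda>n. T (f (k n)) x) \<longlonglongrightarrow> g x) \<and>
    (\<lambda>n. nrm (\<lambda>x. T (f (k n)) x - g x)) \<longlonglongrightarrow> 0 \<and> (\<lambda>n. nrm (T (f (k n)))) \<longlonglongrightarrow> nrm g"
proof -
  have bd: "\<bar>T (f n) x\<bar> \<le> mean_dist x" for n x
    using abs_T_le[OF f[of n], of x] mult_left_mono[OF le[of n] mean_dist_nonneg[of x]] by simp
  have lip: "\<bar>T (f n) x - T (f n) y\<bar> \<le> \<bar>x - y\<bar>" for n x y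
    using T_Lipschitz[OF f[of n], of x y] mult_left_mono[OF le[of n] abs_ge_zero[of "x - y"]] by simp
  \<comment> \<open>Dividing by \<open>1 + mean_dist\<close> makes the bound uniform in the point, as the diagonal argument over
    the rationals requires; the Lipschitz bound extends convergence to all points.\<close>
  have pos: "1 + mean_dist x > 0" for x using mean_dist_nonneg[of x] by simp
  have bd1: "norm (T (f n) x / (1 + mean_dist x)) \<le> 1" if "x \<in> \<rat>" for n x
  proof -
    have "\<bar>1 + mean_dist x\<bar> = 1 + mean_dist x" using pos[of x] by (rule abs_of_pos)
    then show ?thesis using bd[of n x] pos[of x] by (simp only: real_norm_def abs_divide divide_le_eq_1_pos)
  qed
  obtain k where k: "strict_mono (k :: nat \<Rightarrow> nat)"
    and conv: "\<And>x. x \<in> \<rat> \<Longrightarrow> \<exists>l. (\<lambda>n. T (f (k n)) x / (1 + mean_dist x)) \<longlonglongrightarrow> l"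
    by (rule function_convergent_subsequence
          [of "\<rat>" "\<lambda>n x. T (f n) x / (1 + mean_dist x)" 1, OF countable_rat]) (erule bd1, rule that)
  have conv': "convergent (\<lambda>n. T (f (k n)) x)" if x: "x \<in> \<rat>" for x
  proof -
    obtain l where "(\<lambda>n. T (f (k n)) x / (1 + mean_dist x)) \<longlonglongrightarrow> l" using conv[OF x] by blast
    from tendsto_mult[OF this tendsto_const[of "1 + mean_dist x"]]
    have "(\<lambda>n. T (f (k n)) x) \<longlonglongrightarrow> l * (1 + mean_dist x)" using pos[of x] by simp
    then show ?thesis by (rule convergentI)
  qed
  have "Cauchy (\<lambda>n. T (f (k n)) x)" for x
  proof (rule metric_CauchyI)
    fix e :: real assume "0 < e"
    obtain r where r: "r \<in> \<rat>" "x < r" "r < x + e / 3"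
      using Rats_dense_in_real[of x "x + e / 3"] \<open>0 < e\<close> by auto
    from convergent_Cauchy[OF conv'[OF r(1)]] obtain N
      where N: "\<And>m n. m \<ge> N \<Longrightarrow> n \<ge> N \<Longrightarrow> dist (T (f (k m)) r) (T (f (k n)) r) < e / 3"
      using metric_CauchyD[of _ "e / 3"] \<open>0 < e\<close> by (metis divide_pos_pos zero_less_numeral)
    have "dist (T (f (k m)) x) (T (f (k n)) x) < e" if "m \<ge> N" "n \<ge> N" for m n
      using N[OF that] lip[of "k m" x r] lip[of "k n" x r] r(2,3) unfolding dist_real_def by linarith
    then show "\<exists>M. \<forall>m\<ge>M. \<forall>n\<ge>M. dist (T (f (k m)) x) (T (f (k n)) x) < e" by blast
  qed
  then have "\<forall>x. \<exists>l. (\<lambda>n. T (f (k n)) x) \<longlonglongrightarrow> l"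
    by (simp add: Cauchy_convergent_iff convergent_def)
  then obtain g where g: "\<And>x. (\<lambda>n. T (f (k n)) x) \<longlonglongrightarrow> g x" by metis
  have [measurable]: "T (f (k n)) \<in> borel_measurable borel" for n by (rule measurable_T[OF f])
  have gm [measurable]: "g \<in> borel_measurable borel"
    by (rule borel_measurable_LIMSEQ_real[OF g]) auto
  have gbd: "\<bar>g x\<bar> \<le> mean_dist x" for x
    by (rule LIMSEQ_le_const2[OF tendsto_rabs[OF g]]) (use bd in auto)
  have sg: "square_integrable F g"
    by (rule sqi_dominated[OF sqi_mean_dist]) (use gbd mean_dist_nonneg in \<open>simp_all add: abs_of_nonneg\<close>)
  have im: "integrable F (\<lambda>x. (mean_dist x)\<^sup>2)"
    using sqi_mean_dist by (simp add: square_integrable_def)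
  have "(\<lambda>n. (\<integral>x. (T (f (k n)) x - g x)\<^sup>2 \<partial>F)) \<longlonglongrightarrow> (\<integral>x. 0 \<partial>F)"
  proof (rule integral_dominated_convergence[where w = "\<lambda>x. 4 * (mean_dist x)\<^sup>2"])
    show "AE x in F. (\<lambda>n. (T (f (k n)) x - g x)\<^sup>2) \<longlonglongrightarrow> 0"
    proof (rule AE_I2)
      fix x
      have "(\<lambda>n. (T (f (k n)) x - g x)\<^sup>2) \<longlonglongrightarrow> (g x - g x)\<^sup>2" by (intro tendsto_intros g)
      then show "(\<lambda>n. (T (f (k n)) x - g x)\<^sup>2) \<longlonglongrightarrow> 0" by simp
    qed
    show "AE x in F. norm ((T (f (k n)) x - g x)\<^sup>2) \<le> 4 * (mean_dist x)\<^sup>2" for n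
    proof (rule AE_I2)
      fix x
      have "\<bar>T (f (k n)) x - g x\<bar> \<le> \<bar>2 * mean_dist x\<bar>" using bd[of "k n" x] gbd[of x] by simp
      then show "norm ((T (f (k n)) x - g x)\<^sup>2) \<le> 4 * (mean_dist x)\<^sup>2"
        by (simp add: abs_le_square_iff power_mult_distrib)
    qed
  qed (use im in auto)
  then have "(\<lambda>n. nrm (\<lambda>x. T (f (k n)) x - g x)) \<longlonglongrightarrow> sqrt 0"
    unfolding nrm_def l2_inner_self by (intro tendsto_real_sqrt) simp
  moreover have "(\<lambda>n. (\<integral>x. (T (f (k n)) x)\<^sup>2 \<partial>F)) \<longlonglongrightarrow> (\<integral>x. (g x)\<^sup>2 \<partial>F)"
  proof (rule integral_dominated_convergence[where w = "\<lambda>x. (mean_dist x)\<^sup>2"])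
    show "AE x in F. norm ((T (f (k n)) x)\<^sup>2) \<le> (mean_dist x)\<^sup>2" for n
      using bd mean_dist_nonneg by (auto intro!: AE_I2 simp flip: abs_le_square_iff)
  qed (use im g in \<open>auto intro!: AE_I2 tendsto_intros\<close>)
  then have "(\<lambda>n. nrm (T (f (k n)))) \<longlonglongrightarrow> nrm g"
    unfolding nrm_def l2_inner_self by (intro tendsto_real_sqrt)
  ultimately show ?thesis using k sg g by auto
qed

end

context bergsma_spectrum
begin

text \<open>If the supremum \<open>s\<close> of the quadratic form over the unit ball of the orthogonal complement of the
  first \<open>K\<close> eigenfunctions exceeded the tail, it would be positive and attained by compactness,
  hence an eigenvalue with an eigenfunction in that complement. As the eigenspaces are exhausted,
  \<open>s\<close> would be listed at a position not below \<open>K\<close> and so be at most the tail.\<close>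

lemma quadratic_form_le_tail:
  assumes f: "square_integrable F f" and perp: "\<And>k. k < K \<Longrightarrow> l2_inner F f (eigenfun k) = 0"
  shows "l2_inner lborel (coef f) (coef f) \<le> tail K * l2_inner F f f"
proof -
  define q where "q f = l2_inner lborel (coef f) (coef f)" for f
  define S where "S = {f. square_integrable F f \<and> (\<forall>k<K. l2_inner F f (eigenfun k) = 0)}"
  define Q where "Q = q ` {f \<in> S. l2_inner F f f \<le> 1}"
  define s where "s = Sup Q"
  have q_le: "q f \<le> tr * l2_inner F f f" if "f \<in> S" for f
    using l2_inner_coef_le_tr that by (simp add: q_def S_def)
  have "q f \<le> tr" if "f \<in> S" "l2_inner F f f \<le> 1" for f
    using q_le[OF that(1)] mult_left_mono[OF that(2) tr_nonneg] by simp
  then have bdd: "bdd_above Q" unfolding Q_def by (intro bdd_aboveI[of _ tr]) auto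
  have zero: "(\<lambda>x. 0) \<in> S" by (simp add: S_def square_integrable_zero l2_inner_def)
  have ne: "Q \<noteq> {}" using zero by (auto simp: Q_def l2_inner_def intro!: exI[of _ "\<lambda>x. 0"])
  have scale: "q (\<lambda>x. a * f x) = a\<^sup>2 * q f" "l2_inner F (\<lambda>x. a * f x) (\<lambda>x. a * f x) = a\<^sup>2 * l2_inner F f f"
    "(\<lambda>x. a * f x) \<in> S" if "f \<in> S" for a f
  proof -
    have sf: "square_integrable F f" using that by (simp add: S_def)
    have "coef (\<lambda>x. a * f x) = (\<lambda>t. a * coef f t)"
      using coef_lincomb[OF sf sf, of a 0] by (simp add: fun_eq_iff)
    then show "q (\<lambda>x. a * f x) = a\<^sup>2 * q f"
      by (simp add: q_def l2_inner_self power_mult_distrib)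
    show "l2_inner F (\<lambda>x. a * f x) (\<lambda>x. a * f x) = a\<^sup>2 * l2_inner F f f"
      by (simp add: l2_inner_self power_mult_distrib)
    show "(\<lambda>x. a * f x) \<in> S"
      using that square_integrable_cmult[OF sf] by (simp add: S_def l2_inner_def mult.assoc)
  qed
  have q_le_s: "q f \<le> s * l2_inner F f f" if fS: "f \<in> S" for f
  proof (cases "l2_inner F f f = 0")
    case True
    then show ?thesis using q_le[OF fS] by simp
  next
    case False
    then have pos: "l2_inner F f f > 0" using l2_inner_self_nonneg[of F f] by simp
    define a where "a = 1 / sqrt (l2_inner F f f)"
    have a2: "a\<^sup>2 = 1 / l2_inner F f f" using pos by (simp add: a_def power_divide)
    have "q (\<lambda>x. a * f x) \<in> Q"
      unfolding Q_def using scale[OF fS, of a] pos by (intro imageI) (simp add: a2)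
    then have "q (\<lambda>x. a * f x) \<le> s" unfolding s_def by (rule cSup_upper[OF _ bdd])
    then show ?thesis using pos scale(1)[OF fS] by (simp add: a2 field_simps)
  qed
  have s_tail: "s \<le> tail K"
  proof (rule ccontr)
    assume "\<not> s \<le> tail K"
    then have s_tail: "tail K < s" by simp
    have s0: "0 < s" using s_tail tail_nonneg[of K] by simp
    have "\<exists>f. f \<in> S \<and> l2_inner F f f \<le> 1 \<and> s - 1 / real (Suc n) < q f" for n
    proof -
      have "s - 1 / real (Suc n) < Sup Q" by (simp add: s_def)
      then show ?thesis using less_cSupE[OF _ ne] unfolding Q_def by blast
    qed
    then obtain fn where fnS: "\<And>n. fn n \<in> S" and fn1: "\<And>n. l2_inner F (fn n) (fn n) \<le> 1"
      and fnq: "\<And>n. s - 1 / real (Suc n) < q (fn n)" by metis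
    have sfn: "square_integrable F (fn n)" for n using fnS by (simp add: S_def)
    have fn_nrm: "nrm (fn n) \<le> 1" for n using fn1[of n] by (simp add: nrm_def)
    obtain k g where k: "strict_mono (k :: nat \<Rightarrow> nat)" and sg: "square_integrable F g"
      and gx: "\<And>x. (\<lambda>n. T (fn (k n)) x) \<longlonglongrightarrow> g x"
      and g2: "(\<lambda>n. nrm (\<lambda>x. T (fn (k n)) x - g x)) \<longlonglongrightarrow> 0"
      and gn: "(\<lambda>n. nrm (T (fn (k n)))) \<longlonglongrightarrow> nrm g"
      using T_compact[of fn, OF sfn fn_nrm] by blast
    define u where "u n = T (fn (k n))" for n
    have su: "square_integrable F (u n)" for n unfolding u_def by (rule sqi_T[OF sfn])
    have uS: "T f \<in> S" if "f \<in> S" for f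
    proof -
      have sf: "square_integrable F f" using that by (simp add: S_def)
      have "l2_inner F (T f) (eigenfun j) = 0" if "j < K" for j
        using l2_inner_T_commute[OF sf sqi_eigenfun, of j] \<open>f \<in> S\<close> that
          eigenspace_l2_inner_T[OF eigenfun_eigenspace sf, of j]
        by (simp add: S_def l2_inner_commute)
      then show ?thesis using sqi_T[OF sf] by (simp add: S_def)
    qed
    have Tf_le: "l2_inner F (T f) (T f) \<le> s * q f" if fS: "f \<in> S" for f
    proof (cases "l2_inner F (T f) (T f) = 0")
      case True
      then show ?thesis using s0 l2_inner_self_nonneg[of lborel "coef f"] by (simp add: q_def)
    next
      case False
      then have pos: "l2_inner F (T f) (T f) > 0" using l2_inner_self_nonneg[of F "T f"] by simp
      have sf: "square_integrable F f" using fS by (simp add: S_def)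
      have "(l2_inner F (T f) (T f))\<^sup>2 \<le> q f * q (T f)"
        unfolding q_def l2_inner_T[OF sf sqi_T[OF sf]]
        by (rule l2_Cauchy_Schwarz[OF sqi_coef[OF sf] sqi_coef[OF sqi_T[OF sf]]])
      also have "\<dots> \<le> q f * (s * l2_inner F (T f) (T f))"
        using q_le_s[OF uS[OF fS]] l2_inner_self_nonneg[of lborel "coef f"]
        by (intro mult_left_mono) (auto simp: q_def)
      finally show ?thesis using pos by (simp add: power2_eq_square mult_ac)
    qed
    \<comment> \<open>A maximising sequence is asymptotically an eigenfunction: \<open>T f - s * f\<close> has squared norm at most
      \<open>s * (s - q f)\<close>.\<close>
    define d where "d n = (\<lambda>x. 1 * u n x + (- s) * fn (k n) x)" for n
    have sd: "square_integrable F (d n)" for n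
      unfolding d_def by (rule square_integrable_lincomb[OF su sfn])
    have d_le: "l2_inner F (d n) (d n) \<le> s / real (Suc (k n))" for n
    proof -
      have "l2_inner F (d n) (d n) = l2_inner F (u n) (u n) - 2 * s * q (fn (k n)) + s\<^sup>2 * l2_inner F (fn (k n)) (fn (k n))"
        unfolding d_def l2_inner_self_lincomb[OF su sfn] using l2_inner_T[OF sfn sfn, of "k n" "k n"]
        by (simp add: u_def q_def)
      also have "\<dots> \<le> s * q (fn (k n)) - 2 * s * q (fn (k n)) + s\<^sup>2 * 1"
        using Tf_le[OF fnS] fn1 s0 by (intro add_mono diff_mono mult_left_mono) (auto simp: u_def)
      also have "\<dots> = s * (s - q (fn (k n)))" by (simp add: power2_eq_square algebra_simps)
      also have "\<dots> \<le> s * (1 / real (Suc (k n)))"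
        using fnq[of "k n"] s0 by (intro mult_left_mono) auto
      finally show ?thesis by simp
    qed
    have "(\<lambda>n. s / real (Suc (k n))) \<longlonglongrightarrow> 0"
      using LIMSEQ_subseq_LIMSEQ[OF LIMSEQ_Suc[OF lim_const_over_n[of s]] k] by (simp add: o_def)
    then have "(\<lambda>n. l2_inner F (d n) (d n)) \<longlonglongrightarrow> 0"
      by (rule tendsto_sandwich[OF _ _ tendsto_const, rotated 2])
         (auto intro!: always_eventually simp: l2_inner_self_nonneg d_le simp del: of_nat_Suc)
    then have d0: "(\<lambda>n. nrm (d n)) \<longlonglongrightarrow> 0" unfolding nrm_def using tendsto_real_sqrt by fastforce
    have T0: "(\<lambda>n. T (h n) x) \<longlonglongrightarrow> 0" if "\<And>n. square_integrable F (h n)" "(\<lambda>n. nrm (h n)) \<longlonglongrightarrow> 0" for h x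
    proof -
      have "(\<lambda>n. mean_dist x * nrm (h n)) \<longlonglongrightarrow> mean_dist x * 0"
        by (intro tendsto_mult tendsto_const that(2))
      then show ?thesis
        by (intro Lim_null_comparison[where g = "\<lambda>n. mean_dist x * nrm (h n)" and f = "\<lambda>n. T (h n) x"])
           (auto simp: abs_T_le that(1))
    qed
    have Tg: "T g x = s * g x" for x
    proof -
      have 1: "T (\<lambda>x. u n x - g x) x = T (u n) x - T g x" for n
        using T_lincomb[OF su[of n] sg, of 1 "-1" x] by simp
      have "(\<lambda>n. T (u n) x - T g x) \<longlonglongrightarrow> 0"
        unfolding 1[symmetric] by (rule T0) (use square_integrable_diff[OF su sg] g2 in \<open>auto simp: u_def\<close>)
      then have a: "(\<lambda>n. T (u n) x) \<longlonglongrightarrow> T g x" by (simp add: LIM_zero_iff)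
      have 2: "T (d n) x = T (u n) x - s * u n x" for n
        unfolding d_def using T_lincomb[OF su[of n] sfn[of "k n"], of 1 "-s" x] by (simp add: u_def)
      have "(\<lambda>n. T (u n) x - s * u n x) \<longlonglongrightarrow> 0"
        unfolding 2[symmetric] by (rule T0[OF sd d0])
      moreover have "(\<lambda>n. T (u n) x - s * u n x) \<longlonglongrightarrow> T g x - s * g x"
        using gx by (intro tendsto_intros a) (simp add: u_def)
      ultimately show ?thesis using LIMSEQ_unique by fastforce
    qed
    have g_eig: "g \<in> eigenspace F ker s" using sg Tg by (simp add: eigenspace_def)
    have g_perp: "l2_inner F g (eigenfun j) = 0" if "j < K" for j
    proof -
      have le: "\<bar>l2_inner F g (eigenfun j)\<bar> \<le> nrm (\<lambda>x. u n x - g x) * nrm (eigenfun j)" for n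
      proof -
        have "l2_inner F (u n) (eigenfun j) = 0"
          using uS[OF fnS] that by (simp add: u_def S_def)
        then have "l2_inner F (\<lambda>x. u n x - g x) (eigenfun j) = - l2_inner F g (eigenfun j)"
          using l2_inner_diff[OF su sg sqi_eigenfun, of n j] by simp
        then show ?thesis
          using l2_Cauchy_Schwarz_nrm[OF square_integrable_diff[OF su sg] sqi_eigenfun, of n j] by simp
      qed
      have "(\<lambda>n. nrm (\<lambda>x. u n x - g x) * nrm (eigenfun j)) \<longlonglongrightarrow> 0 * nrm (eigenfun j)"
        using g2 by (intro tendsto_mult tendsto_const) (simp add: u_def)
      then have "\<bar>l2_inner F g (eigenfun j)\<bar> \<le> 0 * nrm (eigenfun j)"
        by (rule LIMSEQ_le_const) (use le in auto)
      then show ?thesis by simp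
    qed
    have "s \<le> nrm g"
    proof (rule LIMSEQ_le[OF _ gn])
      have "(\<lambda>n. 1 / real (Suc (k n))) \<longlonglongrightarrow> 0"
        using LIMSEQ_subseq_LIMSEQ[OF LIMSEQ_Suc[OF lim_const_over_n[of 1]] k] by (simp add: o_def)
      from tendsto_diff[OF tendsto_const[of s] this]
      show "(\<lambda>n. s - 1 / real (Suc (k n))) \<longlonglongrightarrow> s" by simp
      have "s - 1 / real (Suc (k n)) \<le> nrm (T (fn (k n)))" for n
      proof -
        have "q (fn (k n)) \<le> nrm (u n) * nrm (fn (k n))"
          using l2_Cauchy_Schwarz_nrm[OF su sfn, of n "k n"] l2_inner_T[OF sfn sfn, of "k n" "k n"]
          by (simp add: u_def q_def)
        also have "\<dots> \<le> nrm (u n) * 1" by (rule mult_left_mono[OF fn_nrm nrm_nonneg])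
        finally show ?thesis using fnq[of "k n"] by (simp add: u_def)
      qed
      then show "\<exists>N. \<forall>n\<ge>N. s - 1 / real (Suc (k n)) \<le> nrm (T (fn (k n)))" by blast
    qed
    then have "l2_inner F g g \<noteq> 0" using s0 by (auto simp: nrm_def)
    then obtain j where j: "lam j = s" "l2_inner F g (eigenfun j) \<noteq> 0"
      using eigenfun_complete[OF _ g_eig] s0 by blast
    then have "K \<le> j" using g_perp not_le by blast
    then show False using lam_le_tail j s_tail by fastforce
  qed
  have "q f \<le> s * l2_inner F f f" using f perp by (intro q_le_s) (simp add: S_def)
  also have "\<dots> \<le> tail K * l2_inner F f f"
    by (rule mult_right_mono[OF s_tail l2_inner_self_nonneg])
  finally show ?thesis by (simp add: q_def)
qed

text \<open>The residual \<open>r\<close> of \<open>centred_step t\<close> has small quadratic form, that is, its inner products with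
  \<open>centred_step s\<close> are small in mean square over \<open>s\<close>. If the squared norm of \<open>r\<close>, its inner product
  with \<open>centred_step t\<close>, stayed above some \<open>e\<close>, then right continuity in \<open>s\<close> would keep the inner
  products above \<open>e / 2\<close> on an interval to the right of \<open>t\<close>.\<close>

lemma coef_eigenfun_Parseval:
  "(\<lambda>K. \<Sum>k<K. (coef (eigenfun k) t)\<^sup>2) \<longlonglongrightarrow> l2_inner F (centred_step t) (centred_step t)"
proof -
  define r where "r K = resid K (centred_step t)" for K
  define G where "G K = l2_inner F (r K) (r K)" for K
  have G_eq: "G K = l2_inner F (centred_step t) (centred_step t) - (\<Sum>k<K. (coef (eigenfun k) t)\<^sup>2)" for K
    by (simp add: G_def r_def resid_norm[OF sqi_centred_step] coef_def)
  have sr: "square_integrable F (r K)" for K unfolding r_def by (rule sqi_resid[OF sqi_centred_step])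
  have nr: "nrm (r K) \<le> 1" for K
  proof -
    have "G K \<le> l2_inner F (centred_step t) (centred_step t)" by (simp add: G_eq sum_nonneg)
    then have "nrm (r K) \<le> nrm (centred_step t)" by (simp add: nrm_def G_def)
    then show ?thesis using nrm_centred_step_le_1[of t] by simp
  qed
  have G_inner: "l2_inner F (centred_step t) (r K) = G K" for K
  proof -
    have "G K = l2_inner F (centred_step t) (r K)
        - (\<Sum>i<K. l2_inner F (centred_step t) (eigenfun i) * l2_inner F (eigenfun i) (r K))"
      unfolding G_def using inner_resid[OF sqi_centred_step sr, of K t K] by (simp add: r_def)
    also have "(\<Sum>i<K. l2_inner F (centred_step t) (eigenfun i) * l2_inner F (eigenfun i) (r K)) = 0"
      using resid_orthogonal[OF sqi_centred_step] 
      by (intro sum.neutral) (auto simp: r_def l2_inner_commute[of F "eigenfun _"])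
    finally show ?thesis by simp
  qed
  have small: "\<exists>K. G K < e" if "0 < e" for e
  proof (rule ccontr)
    assume "\<not> (\<exists>K. G K < e)"
    then have Ge: "e \<le> G K" for K by (meson not_le)
    have "continuous (at_right t) (cdf F)" by (rule cdf_is_right_cont)
    then have "(cdf F \<longlongrightarrow> cdf F t) (at_right t)" by (simp add: continuous_within)
    then have "eventually (\<lambda>s. dist (cdf F s) (cdf F t) < e\<^sup>2 / 8) (at_right t)"
      using that by (intro tendstoD) auto
    then obtain b where b: "b > t" "\<And>s. t < s \<Longrightarrow> s < b \<Longrightarrow> dist (cdf F s) (cdf F t) < e\<^sup>2 / 8"
      by (auto simp: eventually_at_right_field)
    have step_close: "nrm (\<lambda>x. centred_step s x - centred_step t x) \<le> e / 2" if s: "t < s" "s < b" for s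
    proof -
      let ?p = "cdf F s - cdf F t"
      have p: "0 \<le> ?p" "?p \<le> 1" "?p < e\<^sup>2 / 8"
        using cdf_nondecreasing[of t s] cdf_bounded_prob[of s] cdf_nonneg[of t] b(2)[OF s] s
        by (auto simp: dist_real_def)
      have le: "(centred_step s x - centred_step t x)\<^sup>2 \<le> (step x s - step x t) + ?p" for x
      proof -
        have "step x s - step x t = 0 \<or> step x s - step x t = 1" using s by (auto simp: step_def)
        moreover have "?p\<^sup>2 \<le> ?p" using p by (simp add: power2_eq_square mult_left_le)
        ultimately show ?thesis using p unfolding centred_step_def
          by (auto simp: power2_eq_square algebra_simps)
      qed
      have "l2_inner F (\<lambda>x. centred_step s x - centred_step t x) (\<lambda>x. centred_step s x - centred_step t x)
          \<le> (\<integral>x. (step x s - step x t) + ?p \<partial>F)"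
        unfolding l2_inner_self
        using square_integrable_diff[OF sqi_centred_step sqi_centred_step, of s t] integrable_step le
        by (intro integral_mono) (auto simp: square_integrable_def)
      also have "\<dots> = 2 * ?p" using integrable_step by (simp add: cdf_eq_integral)
      also have "\<dots> \<le> (e / 2)\<^sup>2" using p by (simp add: power2_eq_square)
      finally show ?thesis unfolding nrm_def using \<open>0 < e\<close> by (intro real_le_lsqrt) auto
    qed
    have coef_ge: "e / 2 \<le> coef (r K) s" if s: "t < s" "s < b" for s K
    proof -
      have "\<bar>l2_inner F (\<lambda>x. centred_step s x - centred_step t x) (r K)\<bar>
          \<le> nrm (\<lambda>x. centred_step s x - centred_step t x) * nrm (r K)"
        by (rule l2_Cauchy_Schwarz_nrm[OF square_integrable_diff[OF sqi_centred_step sqi_centred_step] sr])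
      also have "\<dots> \<le> e / 2 * 1"
        using step_close[OF s] nr nrm_nonneg that \<open>0 < e\<close> by (intro mult_mono) auto
      finally have "\<bar>coef (r K) s - G K\<bar> \<le> e / 2"
        by (simp add: l2_inner_diff[OF sqi_centred_step sqi_centred_step sr] coef_def G_inner)
      then show ?thesis using Ge[of K] by linarith
    qed
    have "(b - t) * (e / 2)\<^sup>2 \<le> tail K" for K
    proof -
      have "(\<integral>s. indicator {t<..<b} s * (e / 2)\<^sup>2 \<partial>lborel) \<le> (\<integral>s. (coef (r K) s)\<^sup>2 \<partial>lborel)"
      proof (rule integral_mono)
        show "integrable lborel (\<lambda>s. indicator {t<..<b} s * (e / 2)\<^sup>2)"
          using b(1) by (intro integrable_mult_left integrable_real_indicator) auto
        show "integrable lborel (\<lambda>s. (coef (r K) s)\<^sup>2)"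
          using sqi_coef[OF sr] by (simp add: square_integrable_def)
        show "indicator {t<..<b} s * (e / 2)\<^sup>2 \<le> (coef (r K) s)\<^sup>2" for s
          using power_mono[OF coef_ge[of s K], of 2] \<open>0 < e\<close> by (auto simp: indicator_def)
      qed
      also have "\<dots> \<le> tail K * l2_inner F (r K) (r K)"
        unfolding l2_inner_self[symmetric]
        by (rule quadratic_form_le_tail[OF sr]) (simp add: r_def resid_orthogonal[OF sqi_centred_step])
      also have "\<dots> \<le> tail K * 1"
        using nr[of K] by (intro mult_left_mono tail_nonneg) (simp add: nrm_def)
      finally show ?thesis using b(1) by simp
    qed
    then have "(b - t) * (e / 2)\<^sup>2 \<le> 0"
      by (intro LIMSEQ_le_const[OF tail_tendsto]) auto
    then show False using b(1) \<open>0 < e\<close> by (simp add: mult_le_0_iff)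
  qed
  have mono: "G L \<le> G K" if "K \<le> L" for K L
    unfolding G_eq using that by (intro diff_left_mono sum_mono2) auto
  have "G \<longlonglongrightarrow> 0"
  proof (rule LIMSEQ_I)
    fix e :: real assume "0 < e"
    then obtain K where "G K < e" using small by blast
    then have "\<forall>n\<ge>K. norm (G n - 0) < e"
      using mono l2_inner_self_nonneg[of F "r _"] by (fastforce simp: G_def)
    then show "\<exists>no. \<forall>n\<ge>no. norm (G n - 0) < e" by blast
  qed
  from tendsto_diff[OF tendsto_const[of "l2_inner F (centred_step t) (centred_step t)"] this]
  show ?thesis by (simp add: G_eq)
qed

text \<open>Parseval's identity, integrated over \<open>t\<close>.\<close>

lemma lam_sums_tr: "lam sums tr"
proof -
  have "(\<lambda>K. \<integral>t. (\<Sum>k<K. (coef (eigenfun k) t)\<^sup>2) \<partial>lborel)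
      \<longlonglongrightarrow> (\<integral>t. l2_inner F (centred_step t) (centred_step t) \<partial>lborel)"
  proof (rule integral_dominated_convergence[where w = "\<lambda>t. l2_inner F (centred_step t) (centred_step t)"])
    show "AE t in lborel. norm (\<Sum>k<K. (coef (eigenfun k) t)\<^sup>2) \<le> l2_inner F (centred_step t) (centred_step t)" for K
      using sum_coef_eigenfun_le by (auto intro!: AE_I2 simp: abs_of_nonneg sum_nonneg)
    show "(\<lambda>t. \<Sum>k<K. (coef (eigenfun k) t)\<^sup>2) \<in> borel_measurable lborel" for K
      using integral_coef_eigenfun(1) by (intro borel_measurable_sum) auto
  qed (use tr_eq(1) coef_eigenfun_Parseval in auto)
  then show ?thesis
    unfolding sums_def tr_eq(2) by (simp add: integral_coef_eigenfun)
qed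

section \<open>Feature functions and the truncated kernel\<close>

text \<open>\<open>feature k\<close> is a version of \<open>sqrt (lam k)\<close> times the \<open>k\<close>-th eigenfunction that is defined at every
  point, so that it can be evaluated at sample points and compared with the kernel there.\<close>

definition feature :: "nat \<Rightarrow> real \<Rightarrow> real" where
  "feature k x = (if lam k = 0 then 0 else T (eigenfun k) x / sqrt (lam k))"

lemma measurable_feature [measurable]: "feature k \<in> borel_measurable borel"
  using measurable_T[OF sqi_eigenfun[of k]] unfolding feature_def[abs_def] by (cases "lam k = 0") auto

lemma sqi_feature: "square_integrable F (feature k)"
  using square_integrable_cmult[OF sqi_T[OF sqi_eigenfun[of k]], of "1 / sqrt (lam k)"] square_integrable_zero[of F]
  unfolding feature_def[abs_def] by (cases "lam k = 0") auto

lemma feature_inner: "l2_inner F (feature k) (feature l) = (if k = l then lam k else 0)"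
proof (cases "lam k = 0 \<or> lam l = 0")
  case True
  then show ?thesis by (auto simp: feature_def[abs_def] l2_inner_def)
next
  case False
  have "l2_inner F (T (eigenfun k)) (T (eigenfun l)) = lam k * (lam l * l2_inner F (eigenfun k) (eigenfun l))"
    using eigenspace_l2_inner_T[OF eigenfun_eigenspace sqi_T[OF sqi_eigenfun], of k l]
      eigenspace_l2_inner_T[OF eigenfun_eigenspace sqi_eigenfun, of l k]
    by (simp add: l2_inner_commute)
  then have *: "l2_inner F (T (eigenfun k)) (T (eigenfun l)) = (if k = l then lam k * lam k else 0)"
    using False by (simp add: eigenfun_inner)
  have "l2_inner F (feature k) (feature l)
      = l2_inner F (T (eigenfun k)) (T (eigenfun l)) / (sqrt (lam k) * sqrt (lam l))"
    using False by (simp add: feature_def[abs_def] l2_inner_def)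
  then show ?thesis unfolding * using False lam_nonneg[of k] by auto
qed

lemma integral_feature: "(\<integral>x. feature k x \<partial>F) = 0"
proof -
  have c1: "coef (\<lambda>x. 1) = (\<lambda>t. 0)"
    by (simp add: coef_def[abs_def] l2_inner_def integral_centred_step)
  have "(\<integral>x. T (eigenfun k) x \<partial>F) = l2_inner F (T (eigenfun k)) (\<lambda>x. 1)" by (simp add: l2_inner_def)
  also have "\<dots> = 0" unfolding l2_inner_T[OF sqi_eigenfun sqi_const] c1 by (simp add: l2_inner_def)
  finally show ?thesis by (cases "lam k = 0") (simp_all add: feature_def[abs_def])
qed

definition ker_trunc :: "nat \<Rightarrow> real \<Rightarrow> real \<Rightarrow> real" where
  "ker_trunc K x y = (\<Sum>k<K. feature k x * feature k y)"

text \<open>In \<open>L\<^sup>2\<close> of the line the features of \<open>x\<close> are the coefficients of the function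
  \<open>\<lambda>t. centred_step t x\<close> in an orthonormal system, so this is Bessel's inequality.\<close>

lemma ker_residual_psd:
  fixes x a :: "nat \<Rightarrow> real"
  shows "(\<Sum>i<n. \<Sum>j<n. a i * a j * ker_trunc K (x i) (x j)) \<le> (\<Sum>i<n. \<Sum>j<n. a i * a j * ker (x i) (x j))"
proof -
  define d where "d k t = (if lam k = 0 then 0 else coef (eigenfun k) t / sqrt (lam k))" for k t
  have sd: "square_integrable lborel (d k)" for k
    using square_integrable_cmult[OF sqi_coef[OF sqi_eigenfun[of k]], of "1 / sqrt (lam k)"]
      square_integrable_zero[of lborel] unfolding d_def[abs_def] by (cases "lam k = 0") auto
  have dd: "l2_inner lborel (d k) (d l) = (if k = l \<and> lam k \<noteq> 0 then 1 else 0)" for k l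
  proof (cases "lam k = 0 \<or> lam l = 0")
    case True
    then show ?thesis by (auto simp: d_def[abs_def] l2_inner_def)
  next
    case False
    then have "l2_inner lborel (d k) (d l)
        = l2_inner lborel (coef (eigenfun k)) (coef (eigenfun l)) / (sqrt (lam k) * sqrt (lam l))"
      by (simp add: d_def[abs_def] l2_inner_def)
    then show ?thesis using False lam_nonneg[of k] by (auto simp: coef_eigenfun_inner)
  qed
  have feat: "l2_inner lborel (\<lambda>t. centred_step t y) (d k) = feature k y" for y k
    by (simp add: feature_def d_def[abs_def] l2_inner_def T_eq[OF sqi_eigenfun])
  define g where "g t = (\<Sum>i<n. a i * centred_step t (x i))" for t
  have sg: "square_integrable lborel g"
    unfolding g_def[abs_def] by (rule square_integrable_sum[OF sqi_lborel_centred_step])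
  have gi: "l2_inner lborel g f = (\<Sum>i<n. a i * l2_inner lborel (\<lambda>t. centred_step t (x i)) f)"
    if "square_integrable lborel f" for f
    unfolding g_def[abs_def] by (rule l2_inner_sum[OF sqi_lborel_centred_step that])
  have gk: "l2_inner lborel g (d k) = (\<Sum>i<n. a i * feature k (x i))" for k
    using gi[OF sd, of k] by (simp add: feat)
  have "(\<Sum>i<n. \<Sum>j<n. a i * a j * ker_trunc K (x i) (x j)) = (\<Sum>k<K. (l2_inner lborel g (d k))\<^sup>2)"
  proof -
    have "(\<Sum>k<K. (l2_inner lborel g (d k))\<^sup>2)
        = (\<Sum>k<K. \<Sum>i<n. \<Sum>j<n. a i * a j * (feature k (x i) * feature k (x j)))"
      by (simp add: gk power2_eq_square sum_product mult_ac)
    also have "\<dots> = (\<Sum>i<n. \<Sum>k<K. \<Sum>j<n. a i * a j * (feature k (x i) * feature k (x j)))"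
      by (rule sum.swap)
    also have "\<dots> = (\<Sum>i<n. \<Sum>j<n. \<Sum>k<K. a i * a j * (feature k (x i) * feature k (x j)))"
      by (intro sum.cong refl sum.swap)
    finally show ?thesis by (simp add: ker_trunc_def sum_distrib_left)
  qed
  also have "\<dots> \<le> l2_inner lborel g g"
    by (rule Bessel_inequality[OF sg sd]) (auto simp: dd)
  also have "\<dots> = (\<Sum>i<n. a i * (\<Sum>j<n. a j * ker (x j) (x i)))"
    unfolding gi[OF sg]
    by (subst l2_inner_commute, subst gi) (auto simp: sqi_lborel_centred_step ker_eq_inner)
  also have "\<dots> = (\<Sum>i<n. \<Sum>j<n. a i * a j * ker (x i) (x j))"
    by (simp add: sum_distrib_left mult.assoc ker_commute)
  finally show ?thesis .
qed

end

section \<open>Laplace transforms and weak limits\<close>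

lemma abs_exp_minus_diff_le:
  fixes a b t :: real
  assumes "0 \<le> a" "0 \<le> b" "0 \<le> t"
  shows "\<bar>exp (- t * a) - exp (- t * b)\<bar> \<le> t * \<bar>a - b\<bar>"
proof -
  have *: "\<bar>exp (- t * a) - exp (- t * b)\<bar> \<le> t * \<bar>a - b\<bar>" if "0 \<le> a" "a \<le> b" for a b
  proof -
    have "exp (- t * a) - exp (- t * b) = exp (- t * a) * (1 - exp (- t * (b - a)))"
      by (simp add: algebra_simps flip: exp_add)
    also have "\<dots> \<le> 1 * (t * (b - a))"
      using exp_ge_add_one_self[of "- t * (b - a)"] that assms by (intro mult_mono) auto
    finally have "exp (- t * a) - exp (- t * b) \<le> t * (b - a)" by simp
    moreover have "exp (- t * b) \<le> exp (- t * a)" using that assms by (simp add: mult_left_mono)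
    ultimately show ?thesis using that by simp
  qed
  show ?thesis using *[of a b] *[of b a] assms by (cases "a \<le> b") (auto simp: abs_minus_commute)
qed

lemma norm_iexp_diff_le: "norm (iexp a - iexp b) \<le> \<bar>a - b\<bar>"
proof -
  have "iexp a - iexp b = iexp b * (iexp (a - b) - 1)"
    by (simp add: algebra_simps flip: exp_add)
  then have "norm (iexp a - iexp b) = norm (iexp (a - b) - 1)" by (simp add: norm_mult)
  also have "\<dots> \<le> \<bar>a - b\<bar>" using iexp_approx1[of "a - b" 0] by simp
  finally show ?thesis .
qed

text \<open>In the variable \<open>u = exp (- d * v)\<close> the damped function \<open>G u = f (- ln u / d) * u\<close> is continuous on
  the whole interval \<open>{0..1}\<close>, because \<open>f\<close> is bounded.\<close>

lemma exp_polynomial_approximation: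
  fixes f :: "real \<Rightarrow> real"
  assumes cont: "continuous_on UNIV f" and bd: "\<And>v. \<bar>f v\<bar> \<le> B" and d: "0 < d" and e: "0 < e"
  shows "\<exists>a n. \<forall>v\<ge>0. \<bar>f v * exp (- d * v) - (\<Sum>i\<le>n. a i * exp (- d * v) ^ i)\<bar> < e"
proof -
  define G where "G u = (if u \<le> 0 then 0 else f (- ln u / d) * u)" for u
  have "continuous_on {0<..} (\<lambda>u. f (- ln u / d) * u)"
    using d by (intro continuous_intros continuous_on_compose2[OF cont]) auto
  then have G_pos: "continuous_on {0<..} G"
    by (rule continuous_on_eq) (auto simp: G_def)
  have "continuous_on {0..1} G"
    unfolding continuous_on_eq_continuous_within
  proof
    fix u :: real assume "u \<in> {0..1}"
    show "continuous (at u within {0..1}) G"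
    proof (cases "u = 0")
      case True
      have B: "0 \<le> B" using bd[of 0] by simp
      have le: "norm (G v) \<le> norm v * B" for v
        using mult_right_mono[OF bd, of v "- ln v / d"] B by (auto simp: G_def abs_mult mult.commute mult_nonneg_nonpos)
      have lim: "((\<lambda>v. norm v * B) \<longlongrightarrow> 0) (at 0 within {0..1})"
        by (auto intro!: tendsto_eq_intros)
      have "(G \<longlongrightarrow> 0) (at 0 within {0..1})"
        by (rule Lim_null_comparison[OF always_eventually lim]) (rule allI, rule le)
      then show ?thesis using True by (simp add: continuous_within G_def)
    next
      case False
      then have "u > 0" using \<open>u \<in> {0..1}\<close> by simp
      then have "continuous (at u) G"
        using G_pos by (simp add: continuous_on_eq_continuous_at)
      then show ?thesis by (rule continuous_at_imp_continuous_within)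
    qed
  qed
  then obtain p where p: "real_polynomial_function p" "\<And>u. u \<in> {0..1} \<Longrightarrow> \<bar>G u - p u\<bar> < e"
    using Stone_Weierstrass_real_polynomial_function[of "{0..1 :: real}" G e] e by auto
  obtain a n where a: "p = (\<lambda>x. \<Sum>i\<le>n. a i * x ^ i)"
    using real_polynomial_function_imp_sum[OF p(1)] by blast
  have "\<bar>f v * exp (- d * v) - (\<Sum>i\<le>n. a i * exp (- d * v) ^ i)\<bar> < e" if "0 \<le> v" for v
  proof -
    have "exp (- d * v) \<in> {0..1}" using that d by simp
    moreover have "G (exp (- d * v)) = f v * exp (- d * v)" using d by (simp add: G_def)
    ultimately show ?thesis using p(2)[of "exp (- d * v)"] by (simp add: a)
  qed
  then show ?thesis by blast
qed

text \<open>Undoing the damping costs at most \<open>B * (1 - exp (- d * v)) \<le> B * d * v\<close>, which the mean controls.\<close>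

lemma (in prob_space) expectation_exp_polynomial:
  fixes f V :: "_ \<Rightarrow> real"
  assumes cont: "continuous_on UNIV f" and bd: "\<And>v. \<bar>f v\<bar> \<le> B" and d: "0 < d"
    and approx: "\<And>v. 0 \<le> v \<Longrightarrow> \<bar>f v * exp (- d * v) - (\<Sum>i\<le>n. a i * exp (- d * v) ^ i)\<bar> < e"
    and V: "integrable M V" and V0: "\<And>\<omega>. 0 \<le> V \<omega>"
  shows "\<bar>expectation (\<lambda>\<omega>. f (V \<omega>)) - (\<Sum>i\<le>n. a i * expectation (\<lambda>\<omega>. exp (- (real i * d) * V \<omega>)))\<bar>
    \<le> B * d * expectation V + e"
proof -
  have [measurable]: "f \<in> borel_measurable borel" by (rule borel_measurable_continuous_onI[OF cont])
  have [measurable]: "V \<in> borel_measurable M" using V by simp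
  let ?P = "\<lambda>\<omega>. \<Sum>i\<le>n. a i * exp (- (real i * d) * V \<omega>)"
  have iE: "integrable M (\<lambda>\<omega>. exp (- (real i * d) * V \<omega>))" for i
    by (rule integrable_const_bound[of _ 1]) (use V0 d in auto)
  have iP: "integrable M ?P"
    by (intro Bochner_Integration.integrable_sum integrable_mult_right iE)
  have if': "integrable M (\<lambda>\<omega>. f (V \<omega>))"
    by (rule integrable_const_bound[of _ B]) (use bd in auto)
  have B: "0 \<le> B" using bd[of 0] by simp
  have le: "\<bar>f (V \<omega>) - ?P \<omega>\<bar> \<le> B * d * V \<omega> + e" for \<omega>
  proof -
    let ?u = "exp (- d * V \<omega>)"
    have "?P \<omega> = (\<Sum>i\<le>n. a i * ?u ^ i)"
      by (simp add: exp_of_nat_mult[symmetric] mult_ac)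
    then have 1: "\<bar>f (V \<omega>) * ?u - ?P \<omega>\<bar> < e" using approx[OF V0] by simp
    have "\<bar>f (V \<omega>) - f (V \<omega>) * ?u\<bar> = \<bar>f (V \<omega>)\<bar> * \<bar>1 - ?u\<bar>"
      by (simp add: right_diff_distrib flip: abs_mult)
    also have "\<dots> \<le> B * (d * V \<omega>)"
      using abs_exp_minus_diff_le[of 0 "V \<omega>" d] V0[of \<omega>] d bd B by (intro mult_mono) auto
    finally show ?thesis using 1 by linarith
  qed
  have "\<bar>expectation (\<lambda>\<omega>. f (V \<omega>)) - expectation ?P\<bar> = \<bar>expectation (\<lambda>\<omega>. f (V \<omega>) - ?P \<omega>)\<bar>"
    by (subst Bochner_Integration.integral_diff[OF if' iP]) simp
  also have "\<dots> \<le> expectation (\<lambda>\<omega>. \<bar>f (V \<omega>) - ?P \<omega>\<bar>)"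
    by (rule integral_abs_bound)
  also have "\<dots> \<le> expectation (\<lambda>\<omega>. B * d * V \<omega> + e)"
    using V if' iP le by (intro integral_mono) auto
  also have "\<dots> = B * d * expectation V + e" using V by (simp add: prob_space)
  also have "expectation ?P = (\<Sum>i\<le>n. a i * expectation (\<lambda>\<omega>. exp (- (real i * d) * V \<omega>)))"
    using iE by (subst Bochner_Integration.integral_sum) auto
  finally show ?thesis .
qed

text \<open>The Laplace transforms give the convergence for polynomials in \<open>exp (- d * v)\<close>; the bound \<open>C\<close> on
  the means makes the error of the approximation uniform in \<open>n\<close>.\<close>

lemma Laplace_convergence_imp_weak_convergence:
  fixes V :: "nat \<Rightarrow> 'a \<Rightarrow> real" and W :: "'b \<Rightarrow> real" and f :: "real \<Rightarrow> real"
  assumes M: "prob_space M" and N: "prob_space N"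
    and V: "\<And>n. integrable M (V n)" "\<And>n \<omega>. 0 \<le> V n \<omega>" "\<And>n. (\<integral>\<omega>. V n \<omega> \<partial>M) \<le> C"
    and W: "integrable N W" "\<And>\<omega>. 0 \<le> W \<omega>"
    and lap: "\<And>t. 0 \<le> t \<Longrightarrow> (\<lambda>n. \<integral>\<omega>. exp (- t * V n \<omega>) \<partial>M) \<longlonglongrightarrow> (\<integral>\<omega>. exp (- t * W \<omega>) \<partial>N)"
    and f: "continuous_on UNIV f" "\<And>v. \<bar>f v\<bar> \<le> B"
  shows "(\<lambda>n. \<integral>\<omega>. f (V n \<omega>) \<partial>M) \<longlonglongrightarrow> (\<integral>\<omega>. f (W \<omega>) \<partial>N)"
proof (rule LIMSEQ_I)
  fix r :: real assume r: "0 < r"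
  interpret M: prob_space M by fact
  interpret N: prob_space N by fact
  \<comment> \<open>Of the five errors of size \<open>r / 5\<close>, two come from the damping, whose rate \<open>d\<close> is chosen accordingly.\<close>
  define D where "D = (B + 1) * (\<bar>C\<bar> + (\<integral>\<omega>. W \<omega> \<partial>N) + 1)"
  have W0: "0 \<le> (\<integral>\<omega>. W \<omega> \<partial>N)" using W by simp
  have B: "0 \<le> B" using f(2)[of 0] by simp
  have D: "0 < D" unfolding D_def using W0 B by (intro mult_pos_pos) auto
  define d where "d = r / (5 * D)"
  have d: "0 < d" using r D by (simp add: d_def)
  have small: "B * d * c \<le> r / 5" if "c \<le> \<bar>C\<bar> + (\<integral>\<omega>. W \<omega> \<partial>N) + 1" "0 \<le> c" for c
  proof -
    have "B * c \<le> D" unfolding D_def using that B by (intro mult_mono) auto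
    then have "d * (B * c) \<le> d * D" using d by (intro mult_left_mono) auto
    then show ?thesis using D by (simp add: d_def mult_ac)
  qed
  obtain a n where a: "\<And>v. 0 \<le> v \<Longrightarrow> \<bar>f v * exp (- d * v) - (\<Sum>i\<le>n. a i * exp (- d * v) ^ i)\<bar> < r / 5"
    using exp_polynomial_approximation[OF f d, of "r / 5"] r by auto
  define P where "P k = (\<Sum>i\<le>n. a i * (\<integral>\<omega>. exp (- (real i * d) * V k \<omega>) \<partial>M))" for k
  define Q where "Q = (\<Sum>i\<le>n. a i * (\<integral>\<omega>. exp (- (real i * d) * W \<omega>) \<partial>N))"
  have "P \<longlonglongrightarrow> Q" unfolding P_def[abs_def] Q_def
    using d by (intro tendsto_sum tendsto_mult tendsto_const lap) auto
  then obtain k0 where k0: "\<And>k. k \<ge> k0 \<Longrightarrow> \<bar>P k - Q\<bar> < r / 5"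
    using LIMSEQ_D[of P Q "r / 5"] r by auto
  have "norm ((\<integral>\<omega>. f (V k \<omega>) \<partial>M) - (\<integral>\<omega>. f (W \<omega>) \<partial>N)) < r" if "k \<ge> k0" for k
  proof -
    have "\<bar>(\<integral>\<omega>. f (V k \<omega>) \<partial>M) - P k\<bar> \<le> B * d * (\<integral>\<omega>. V k \<omega> \<partial>M) + r / 5"
      unfolding P_def by (rule M.expectation_exp_polynomial[OF f d a V(1,2)])
    moreover have "B * d * (\<integral>\<omega>. V k \<omega> \<partial>M) \<le> r / 5"
      using V(2,3)[of k] W0 by (intro small) (auto intro!: order.trans[OF V(3)[of k]])
    moreover have "\<bar>(\<integral>\<omega>. f (W \<omega>) \<partial>N) - Q\<bar> \<le> B * d * (\<integral>\<omega>. W \<omega> \<partial>N) + r / 5"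
      unfolding Q_def by (rule N.expectation_exp_polynomial[OF f d a W])
    moreover have "B * d * (\<integral>\<omega>. W \<omega> \<partial>N) \<le> r / 5" using W0 by (intro small) auto
    moreover have "\<bar>P k - Q\<bar> < r / 5" using k0[OF that] .
    ultimately show ?thesis unfolding real_norm_def by linarith
  qed
  then show "\<exists>no. \<forall>k\<ge>no. norm ((\<integral>\<omega>. f (V k \<omega>) \<partial>M) - (\<integral>\<omega>. f (W \<omega>) \<partial>N)) < r" by blast
qed

section \<open>Gaussian quadratic forms\<close>

lemma (in prob_space) std_normal_distr:
  assumes "distributed M lborel Z std_normal_density"
  shows "Z \<in> borel_measurable M" "distr M borel Z = std_normal_distribution"
proof -
  show "Z \<in> borel_measurable M" using distributed_measurable[OF assms] by simp
  have "distr M borel Z = distr M lborel Z" by (rule distr_cong) auto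
  then show "distr M borel Z = std_normal_distribution" using distributed_distr_eq_density[OF assms] by simp
qed

lemma (in prob_space) std_normal_square:
  assumes Z: "distributed M lborel Z std_normal_density"
  shows "integrable M (\<lambda>\<omega>. (Z \<omega>)\<^sup>2)" "expectation (\<lambda>\<omega>. (Z \<omega>)\<^sup>2) = 1"
proof -
  note [measurable] = std_normal_distr(1)[OF Z]
  have h: "has_bochner_integral std_normal_distribution (\<lambda>x. x\<^sup>2) 1"
    using std_normal_moment_even[of 1] by (subst has_bochner_integral_density) (auto simp: fact_numeral)
  then have h': "has_bochner_integral (distr M borel Z) (\<lambda>x. x\<^sup>2) 1"
    unfolding std_normal_distr(2)[OF Z] .
  show "integrable M (\<lambda>\<omega>. (Z \<omega>)\<^sup>2)"
    using integrable.intros[OF h'] by (subst (asm) integrable_distr_eq) auto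
  show "expectation (\<lambda>\<omega>. (Z \<omega>)\<^sup>2) = 1"
    using has_bochner_integral_integral_eq[OF h'] by (subst (asm) integral_distr) auto
qed

lemma (in prob_space) gaussian_linear_form_char:
  assumes I: "finite I" and ind: "indep_vars (\<lambda>_. borel) Z I"
    and Z: "\<And>i. i \<in> I \<Longrightarrow> distributed M lborel (Z i) std_normal_density"
  shows "(CLINT \<omega>|M. iexp (\<Sum>i\<in>I. a i * Z i \<omega>)) = complex_of_real (exp (- (\<Sum>i\<in>I. (a i)\<^sup>2) / 2))"
proof -
  have ind': "indep_vars (\<lambda>_. borel) (\<lambda>i \<omega>. a i * Z i \<omega>) I"
    by (rule indep_vars_compose2[OF ind]) auto
  have [measurable]: "i \<in> I \<Longrightarrow> Z i \<in> borel_measurable M" for i using std_normal_distr(1)[OF Z] .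
  have "(CLINT \<omega>|M. iexp (\<Sum>i\<in>I. a i * Z i \<omega>)) = char (distr M borel (\<lambda>\<omega>. \<Sum>i\<in>I. a i * Z i \<omega>)) 1"
    unfolding char_def by (subst integral_distr) auto
  also have "\<dots> = (\<Prod>i\<in>I. char (distr M borel (\<lambda>\<omega>. a i * Z i \<omega>)) 1)"
    by (rule char_distr_sum[OF ind'])
  also have "\<dots> = (\<Prod>i\<in>I. complex_of_real (exp (- (a i)\<^sup>2 / 2)))"
  proof (rule prod.cong[OF refl])
    fix i assume i: "i \<in> I"
    have "char (distr M borel (\<lambda>\<omega>. a i * Z i \<omega>)) 1 = char (distr M borel (Z i)) (a i)"
      unfolding char_def using i by (subst (1 2) integral_distr) auto
    then show "char (distr M borel (\<lambda>\<omega>. a i * Z i \<omega>)) 1 = complex_of_real (exp (- (a i)\<^sup>2 / 2))"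
      by (simp add: std_normal_distr(2)[OF Z[OF i]] char_std_normal_distribution)
  qed
  also have "\<dots> = complex_of_real (exp (\<Sum>i\<in>I. - (a i)\<^sup>2 / 2))"
    using I by (simp only: exp_sum of_real_prod)
  also have "(\<Sum>i\<in>I. - (a i)\<^sup>2 / 2) = - (\<Sum>i\<in>I. (a i)\<^sup>2) / 2"
    by (simp add: sum_negf flip: sum_divide_distrib)
  finally show ?thesis .
qed

text \<open>The degenerate case of zero variance is included; it arises when eigenvalues vanish.\<close>

lemma (in prob_space) CLT_char:
  fixes X :: "nat \<Rightarrow> 'a \<Rightarrow> real"
  assumes ind: "indep_vars (\<lambda>_. borel) X UNIV" and distr: "\<And>i. distr M borel (X i) = \<mu>"
    and sq: "integrable \<mu> (\<lambda>x. x\<^sup>2)" and mean: "(\<integral>x. x \<partial>\<mu>) = 0"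
  shows "(\<lambda>n. CLINT \<omega>|M. iexp ((\<Sum>i<n. X i \<omega>) / sqrt (real n))) \<longlonglongrightarrow> complex_of_real (exp (- (\<integral>x. x\<^sup>2 \<partial>\<mu>) / 2))"
proof -
  have rv [measurable]: "X i \<in> borel_measurable M" for i using ind by (auto simp: indep_vars_def2)
  have sqX: "integrable M (\<lambda>\<omega>. (X i \<omega>)\<^sup>2)" for i
    using sq unfolding distr[of i, symmetric] by (subst (asm) integrable_distr_eq) auto
  have meanX: "expectation (X i) = 0" for i
    using mean unfolding distr[of i, symmetric] by (subst (asm) integral_distr) auto
  define s2 where "s2 = (\<integral>x. x\<^sup>2 \<partial>\<mu>)"
  have s2: "expectation (\<lambda>\<omega>. (X i \<omega>)\<^sup>2) = s2" for i
    unfolding s2_def distr[of i, symmetric] by (subst integral_distr) auto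
  have "0 \<le> s2" by (simp add: s2_def)
  show ?thesis
  proof (cases "s2 = 0")
    case True
    have "AE \<omega> in M. (X i \<omega>)\<^sup>2 = 0" for i
      using integral_nonneg_eq_0_iff_AE[OF sqX[of i]] s2[of i] True by simp
    then have "AE \<omega> in M. \<forall>i. X i \<omega> = 0" by (simp add: AE_all_countable)
    then have "(CLINT \<omega>|M. iexp ((\<Sum>i<n. X i \<omega>) / sqrt (real n))) = (CLINT \<omega>|M. 1)" for n
      by (intro integral_cong_AE) auto
    then show ?thesis using True by (simp add: s2_def[symmetric] prob_space)
  next
    case False
    define \<sigma> where "\<sigma> = sqrt s2"
    have \<sigma>: "0 < \<sigma>" "\<sigma>\<^sup>2 = s2" using False \<open>0 \<le> s2\<close> by (auto simp: \<sigma>_def)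
    let ?D = "\<lambda>n. distr M borel (\<lambda>x. (\<Sum>i<n. X i x) / sqrt (real n * \<sigma>\<^sup>2))"
    have "weak_conv_m ?D std_normal_distribution"
      by (rule central_limit_theorem_zero_mean[OF ind meanX \<sigma>(1) sqX _ distr])
         (simp add: meanX s2 \<sigma>)
    then have "(\<lambda>n. char (?D n) \<sigma>) \<longlonglongrightarrow> char std_normal_distribution \<sigma>"
      by (intro levy_continuity1 real_dist_normal_dist real_distribution_distr) auto
    moreover have "char (?D n) \<sigma> = (CLINT \<omega>|M. iexp ((\<Sum>i<n. X i \<omega>) / sqrt (real n)))" for n
    proof -
      have "\<sigma> * ((\<Sum>i<n. X i \<omega>) / sqrt (real n * \<sigma>\<^sup>2)) = (\<Sum>i<n. X i \<omega>) / sqrt (real n)" for \<omega>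
        using \<sigma>(1) by (simp add: real_sqrt_mult)
      then show ?thesis unfolding char_def by (subst integral_distr) (simp_all only: measurable_lborel1, auto)
    qed
    ultimately show ?thesis by (simp add: char_std_normal_distribution \<sigma> s2_def)
  qed
qed

text \<open>Gaussian linearisation of the square, \<open>exp (- t * \<parallel>s\<parallel>\<^sup>2) = E (exp (\<i> * sqrt (2 * t) * (s \<bullet> Z)))\<close>,
  reduces the convergence of the Laplace transform of a quadratic form in normalised sums to the
  one-dimensional central limit theorem for each fixed value of \<open>Z\<close>. The very variables \<open>Z\<close> of the
  limit serve for this.\<close>

lemma Laplace_transform_quadratic_form:
  fixes \<xi> :: "nat \<Rightarrow> 'a \<Rightarrow> 's" and w :: "'j \<Rightarrow> 's \<Rightarrow> real" and Z :: "'j \<Rightarrow> 'b \<Rightarrow> real"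
  assumes M: "prob_space M" and N: "prob_space N" and J: "finite J"
    and ind: "prob_space.indep_vars M (\<lambda>_. S) \<xi> UNIV" and dist: "\<And>i. distr M S (\<xi> i) = D"
    and w: "\<And>j. j \<in> J \<Longrightarrow> square_integrable D (w j)" and mean: "\<And>j. j \<in> J \<Longrightarrow> (\<integral>x. w j x \<partial>D) = 0"
    and orth: "\<And>j k. j \<in> J \<Longrightarrow> k \<in> J \<Longrightarrow> l2_inner D (w j) (w k) = (if j = k then v j else 0)"
    and Zind: "prob_space.indep_vars N (\<lambda>_. borel) Z J"
    and Z: "\<And>j. j \<in> J \<Longrightarrow> distributed N lborel (Z j) std_normal_density" and t: "0 \<le> t"
  shows "(\<lambda>n. \<integral>\<omega>. exp (- t * ((\<Sum>j\<in>J. (\<Sum>i<n. w j (\<xi> i \<omega>))\<^sup>2) / real n)) \<partial>M)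
    \<longlonglongrightarrow> (\<integral>\<omega>. exp (- t * (\<Sum>j\<in>J. v j * (Z j \<omega>)\<^sup>2)) \<partial>N)"
proof -
  interpret M: prob_space M by fact
  interpret N: prob_space N by fact
  interpret P: pair_prob_space M N ..
  have \<xi>m [measurable]: "\<xi> i \<in> measurable M S" for i using ind by (auto simp: M.indep_vars_def2)
  have D_sets [measurable_cong]: "sets D = sets S" using dist[of 0] by auto
  have probD: "prob_space D" using M.prob_space_distr[OF \<xi>m, of 0] dist[of 0] by simp
  interpret D: prob_space D by (rule probD)
  have w_m: "j \<in> J \<Longrightarrow> w j \<in> borel_measurable S" for j
    using w[of j] unfolding square_integrable_def by (simp cong: measurable_cong_sets add: D_sets)
  have Zm: "j \<in> J \<Longrightarrow> Z j \<in> borel_measurable N" for j using N.std_normal_distr(1)[OF Z] .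
  define s where "s n j \<omega> = (\<Sum>i<n. w j (\<xi> i \<omega>)) / sqrt (real n)" for n j \<omega>
  have s_m: "j \<in> J \<Longrightarrow> s n j \<in> borel_measurable M" for n j
    unfolding s_def[abs_def] by (intro borel_measurable_divide borel_measurable_sum
      measurable_compose[OF \<xi>m w_m] borel_measurable_const)
  define c where "c = sqrt (2 * t)"
  have c2: "c\<^sup>2 = 2 * t" using t by (simp add: c_def)
  let ?g = "\<lambda>n \<omega> \<zeta>. iexp (\<Sum>j\<in>J. (c * s n j \<omega>) * Z j \<zeta>)"
  have g_m: "(\<lambda>(\<omega>, \<zeta>). ?g n \<omega> \<zeta>) \<in> borel_measurable (M \<Otimes>\<^sub>M N)" for n
  proof -
    have [measurable]: "(\<lambda>p. \<Sum>j\<in>J. (c * s n j (fst p)) * Z j (snd p)) \<in> borel_measurable (M \<Otimes>\<^sub>M N)"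
      by (intro borel_measurable_sum borel_measurable_times borel_measurable_const
         measurable_compose[OF measurable_fst s_m] measurable_compose[OF measurable_snd Zm])
    show ?thesis unfolding case_prod_unfold by measurable
  qed
  have g_i: "integrable (M \<Otimes>\<^sub>M N) (\<lambda>(\<omega>, \<zeta>). ?g n \<omega> \<zeta>)" for n
    by (rule P.P.integrable_const_bound[of _ 1, OF _ g_m]) auto
  have step1: "complex_of_real (\<integral>\<omega>. exp (- t * ((\<Sum>j\<in>J. (\<Sum>i<n. w j (\<xi> i \<omega>))\<^sup>2) / real n)) \<partial>M)
      = (CLINT \<zeta>|N. CLINT \<omega>|M. ?g n \<omega> \<zeta>)" for n
  proof -
    have "complex_of_real (exp (- t * ((\<Sum>j\<in>J. (\<Sum>i<n. w j (\<xi> i \<omega>))\<^sup>2) / real n))) = (CLINT \<zeta>|N. ?g n \<omega> \<zeta>)" for \<omega>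
    proof -
      have "(\<Sum>j\<in>J. (\<Sum>i<n. w j (\<xi> i \<omega>))\<^sup>2) / real n = (\<Sum>j\<in>J. (s n j \<omega>)\<^sup>2)"
        by (simp add: s_def power_divide sum_divide_distrib[of _ J])
      moreover have "(\<Sum>j\<in>J. (c * s n j \<omega>)\<^sup>2) = 2 * t * (\<Sum>j\<in>J. (s n j \<omega>)\<^sup>2)"
        by (simp add: power_mult_distrib c2 sum_distrib_left)
      ultimately show ?thesis
        using N.gaussian_linear_form_char[OF J Zind Z, of "\<lambda>j. c * s n j \<omega>"] by simp
    qed
    then have "complex_of_real (\<integral>\<omega>. exp (- t * ((\<Sum>j\<in>J. (\<Sum>i<n. w j (\<xi> i \<omega>))\<^sup>2) / real n)) \<partial>M)
       = (CLINT \<omega>|M. CLINT \<zeta>|N. ?g n \<omega> \<zeta>)"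
      by (simp only: integral_complex_of_real[symmetric])
    also have "\<dots> = (CLINT \<zeta>|N. CLINT \<omega>|M. ?g n \<omega> \<zeta>)"
      by (rule P.Fubini_integral[OF g_i, symmetric])
    finally show ?thesis .
  qed
  have lim: "(\<lambda>n. CLINT \<omega>|M. ?g n \<omega> \<zeta>) \<longlonglongrightarrow> complex_of_real (exp (- t * (\<Sum>j\<in>J. v j * (Z j \<zeta>)\<^sup>2)))" for \<zeta>
  proof -
    define b where "b j = c * Z j \<zeta>" for j
    define \<phi> where "\<phi> x = (\<Sum>j\<in>J. b j * w j x)" for x
    have s\<phi>: "square_integrable D \<phi>" unfolding \<phi>_def[abs_def] by (rule square_integrable_sum[OF w])
    have \<phi>m [measurable]: "\<phi> \<in> borel_measurable S"
      using s\<phi> unfolding square_integrable_def by (simp cong: measurable_cong_sets add: D_sets)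
    have iw: "integrable D (w j)" if "j \<in> J" for j
      using square_integrable_mult[OF w[OF that], of "\<lambda>x. 1"] by (simp add: square_integrable_def)
    have m\<phi>: "(\<integral>x. \<phi> x \<partial>D) = 0"
      unfolding \<phi>_def using iw mean by (subst Bochner_Integration.integral_sum) auto
    have v\<phi>: "l2_inner D \<phi> \<phi> = 2 * t * (\<Sum>j\<in>J. v j * (Z j \<zeta>)\<^sup>2)"
    proof -
      have "l2_inner D (w j) \<phi> = b j * v j" if "j \<in> J" for j
      proof -
        have "l2_inner D (w j) \<phi> = (\<Sum>k\<in>J. b k * l2_inner D (w k) (w j))"
          unfolding l2_inner_commute[of D "w j"] \<phi>_def[abs_def] by (rule l2_inner_sum[OF w w[OF that]])
        also have "\<dots> = (\<Sum>k\<in>J. if k = j then b j * v j else 0)"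
          using orth that by (intro sum.cong) auto
        finally show ?thesis using J that by simp
      qed
      moreover have "l2_inner D \<phi> \<phi> = (\<Sum>j\<in>J. b j * l2_inner D (w j) \<phi>)"
        unfolding \<phi>_def[abs_def] by (rule l2_inner_sum[OF w s\<phi>[unfolded \<phi>_def[abs_def]]])
      ultimately have "l2_inner D \<phi> \<phi> = (\<Sum>j\<in>J. b j * (b j * v j))" by simp
      also have "\<dots> = (\<Sum>j\<in>J. c\<^sup>2 * (v j * (Z j \<zeta>)\<^sup>2))"
        by (simp add: b_def power2_eq_square mult_ac)
      finally show ?thesis by (simp add: c2 sum_distrib_left)
    qed
    have indX: "M.indep_vars (\<lambda>_. borel) (\<lambda>i \<omega>. \<phi> (\<xi> i \<omega>)) UNIV"
      by (rule M.indep_vars_compose2[OF ind]) (rule \<phi>m)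
    have dX: "distr M borel (\<lambda>\<omega>. \<phi> (\<xi> i \<omega>)) = distr D borel \<phi>" for i
      unfolding dist[of i, symmetric] by (subst distr_distr) (auto simp: o_def)
    have "(\<lambda>n. CLINT \<omega>|M. iexp ((\<Sum>i<n. \<phi> (\<xi> i \<omega>)) / sqrt (real n)))
        \<longlonglongrightarrow> complex_of_real (exp (- (\<integral>x. x\<^sup>2 \<partial>distr D borel \<phi>) / 2))"
    proof (rule M.CLT_char[OF indX dX])
      show "integrable (distr D borel \<phi>) (\<lambda>x. x\<^sup>2)"
        using s\<phi> by (subst integrable_distr_eq) (auto simp: square_integrable_def)
      show "(\<integral>x. x \<partial>distr D borel \<phi>) = 0"
        using m\<phi> by (subst integral_distr) auto
    qed
    also have "(\<integral>x. x\<^sup>2 \<partial>distr D borel \<phi>) = 2 * t * (\<Sum>j\<in>J. v j * (Z j \<zeta>)\<^sup>2)"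
      unfolding v\<phi>[symmetric] l2_inner_self by (subst integral_distr) auto
    also have "(\<lambda>n. CLINT \<omega>|M. iexp ((\<Sum>i<n. \<phi> (\<xi> i \<omega>)) / sqrt (real n))) = (\<lambda>n. CLINT \<omega>|M. ?g n \<omega> \<zeta>)"
    proof -
      have "(\<Sum>i<n. \<phi> (\<xi> i \<omega>)) / sqrt (real n) = (\<Sum>j\<in>J. (c * s n j \<omega>) * Z j \<zeta>)" for n \<omega>
      proof -
        have "(\<Sum>i<n. \<phi> (\<xi> i \<omega>)) = (\<Sum>j\<in>J. b j * (\<Sum>i<n. w j (\<xi> i \<omega>)))"
          unfolding \<phi>_def sum_distrib_left by (rule sum.swap)
        then show ?thesis by (simp add: s_def b_def sum_divide_distrib[of _ J] mult_ac)
      qed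
      then show ?thesis by simp
    qed
    finally show ?thesis by simp
  qed
  have "(\<lambda>n. CLINT \<zeta>|N. CLINT \<omega>|M. ?g n \<omega> \<zeta>)
      \<longlonglongrightarrow> (CLINT \<zeta>|N. complex_of_real (exp (- t * (\<Sum>j\<in>J. v j * (Z j \<zeta>)\<^sup>2))))"
  proof (rule integral_dominated_convergence[where w = "\<lambda>_. 1"])
    show "(\<lambda>\<zeta>. CLINT \<omega>|M. ?g n \<omega> \<zeta>) \<in> borel_measurable N" for n
      using P.integrable_snd[OF g_i[of n]] by (simp add: borel_measurable_integrable)
    show "(\<lambda>\<zeta>. complex_of_real (exp (- t * (\<Sum>j\<in>J. v j * (Z j \<zeta>)\<^sup>2)))) \<in> borel_measurable N"
      by (rule borel_measurable_LIMSEQ_metric[OF _ lim])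
         (use P.integrable_snd[OF g_i] in \<open>simp add: borel_measurable_integrable\<close>)
    show "AE \<zeta> in N. norm (CLINT \<omega>|M. ?g n \<omega> \<zeta>) \<le> 1" for n
    proof (rule AE_I2)
      fix \<zeta>
      have "norm (CLINT \<omega>|M. ?g n \<omega> \<zeta>) \<le> (\<integral>\<omega>. norm (?g n \<omega> \<zeta>) \<partial>M)" by (rule integral_norm_bound)
      then show "norm (CLINT \<omega>|M. ?g n \<omega> \<zeta>) \<le> 1" by (simp add: M.prob_space)
    qed
  qed (use lim in auto)
  then have "(\<lambda>n. complex_of_real (\<integral>\<omega>. exp (- t * ((\<Sum>j\<in>J. (\<Sum>i<n. w j (\<xi> i \<omega>))\<^sup>2) / real n)) \<partial>M))
      \<longlonglongrightarrow> complex_of_real (\<integral>\<omega>. exp (- t * (\<Sum>j\<in>J. v j * (Z j \<omega>)\<^sup>2)) \<partial>N)"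
    by (simp only: step1 integral_complex_of_real)
  then show ?thesis by (simp only: tendsto_of_real_iff)
qed

text \<open>By convention a sum that does not converge has the value zero. This case distinction makes
  the sum of a series of measurable functions measurable.\<close>

lemma infsum_nat_real_eq:
  fixes f :: "nat \<Rightarrow> real"
  shows "infsum f UNIV = (if (\<Sum>n. ennreal \<bar>f n\<bar>) \<noteq> \<top> then suminf f else 0)"
proof (cases "(\<Sum>n. ennreal \<bar>f n\<bar>) \<noteq> \<top>")
  case True
  then have s: "summable (\<lambda>n. norm (f n))" using summable_suminf_not_top[of "\<lambda>n. \<bar>f n\<bar>"] by simp
  have h: "(f has_sum suminf f) UNIV"
    by (rule norm_summable_imp_has_sum[OF s summable_sums[OF summable_norm_cancel[OF s]]])
  show ?thesis unfolding if_P[OF True] by (rule infsumI[OF h])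
next
  case False
  have "\<not> f summable_on UNIV"
  proof
    assume "f summable_on UNIV"
    then have "(\<lambda>n. norm (f n)) summable_on UNIV" by (rule summable_on_iff_abs_summable_on_real[THEN iffD1])
    then have "summable (\<lambda>n. \<bar>f n\<bar>)" using summable_on_imp_summable[of "\<lambda>n. norm (f n)"] by simp
    then have "(\<Sum>n. ennreal \<bar>f n\<bar>) \<noteq> \<top>" by (rule ennreal_suminf_neq_top) (rule abs_ge_zero)
    then show False using False by blast
  qed
  then show ?thesis unfolding if_not_P[OF False] by (rule infsum_not_exists)
qed

lemma measurable_infsum_nat_pair:
  fixes h :: "nat \<times> nat \<Rightarrow> 'b \<Rightarrow> real"
  assumes [measurable]: "\<And>p. h p \<in> borel_measurable N"
  shows "(\<lambda>\<omega>. \<Sum>\<^sub>\<infinity>p. h p \<omega>) \<in> borel_measurable N"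
proof -
  have "(\<Sum>\<^sub>\<infinity>p. h p \<omega>) = (\<Sum>\<^sub>\<infinity>n. h (prod_decode n) \<omega>)" for \<omega>
    by (rule infsum_reindex_bij_betw[OF bij_prod_decode, symmetric])
  then show ?thesis unfolding infsum_nat_real_eq by simp
qed

text \<open>By monotone convergence the series, summed in the extended reals, has mean \<open>S\<close>, so it is finite
  almost surely.\<close>

lemma gaussian_quadratic_series:
  fixes Z :: "nat \<times> nat \<Rightarrow> 'b \<Rightarrow> real" and c :: "nat \<times> nat \<Rightarrow> real"
  assumes N: "prob_space N" and Z: "\<And>p. distributed N lborel (Z p) std_normal_density"
    and c: "\<And>p. 0 \<le> c p" "(c has_sum S) UNIV"
  shows "\<exists>W. integrable N W \<and> (\<forall>\<omega>. 0 \<le> W \<omega>) \<and> (\<integral>\<omega>. W \<omega> \<partial>N) = S \<and>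
    (AE \<omega> in N. ((\<lambda>p. c p * (Z p \<omega>)\<^sup>2) has_sum W \<omega>) UNIV)"
proof -
  interpret N: prob_space N by fact
  have Zm [measurable]: "Z p \<in> borel_measurable N" for p using N.std_normal_distr(1)[OF Z] .
  define f where "f n \<omega> = c (prod_decode n) * (Z (prod_decode n) \<omega>)\<^sup>2" for n \<omega>
  have f0: "0 \<le> f n \<omega>" for n \<omega> using c by (simp add: f_def)
  have fm [measurable]: "f n \<in> borel_measurable N" for n unfolding f_def[abs_def] by measurable
  define U where "U \<omega> = (\<Sum>n. ennreal (f n \<omega>))" for \<omega>
  have Um [measurable]: "U \<in> borel_measurable N" unfolding U_def[abs_def] by measurable
  have cs: "(\<lambda>n. c (prod_decode n)) sums S"
    using c(2) has_sum_reindex_bij_betw[OF bij_prod_decode, of c S] has_sum_imp_sums by blast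
  have S0: "0 \<le> S" by (rule sums_le[OF _ sums_zero cs]) (rule c(1))
  have "(\<integral>\<^sup>+\<omega>. ennreal (f n \<omega>) \<partial>N) = ennreal (c (prod_decode n))" for n
    using N.std_normal_square[OF Z] c f0 unfolding f_def
    by (subst nn_integral_eq_integral) (auto simp: f_def)
  then have nnU: "(\<integral>\<^sup>+\<omega>. U \<omega> \<partial>N) = ennreal S"
    unfolding U_def using cs by (subst nn_integral_suminf) (simp_all add: suminf_ennreal_eq c(1) sums_unique[OF cs, symmetric])
  have finU: "AE \<omega> in N. U \<omega> \<noteq> \<infinity>"
    by (rule nn_integral_PInf_AE) (use nnU in auto)
  define W where "W \<omega> = enn2real (U \<omega>)" for \<omega>
  have "(\<integral>\<^sup>+\<omega>. ennreal (W \<omega>) \<partial>N) = (\<integral>\<^sup>+\<omega>. U \<omega> \<partial>N)"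
    by (rule nn_integral_cong_AE, use finU in eventually_elim) (simp add: W_def less_top)
  then have "has_bochner_integral N W S"
    using nnU S0 by (intro has_bochner_integral_nn_integral) (auto simp: W_def[abs_def])
  then have 1: "integrable N W" "(\<integral>\<omega>. W \<omega> \<partial>N) = S"
    by (auto simp: has_bochner_integral_iff)
  have "AE \<omega> in N. ((\<lambda>p. c p * (Z p \<omega>)\<^sup>2) has_sum W \<omega>) UNIV"
    using finU
  proof eventually_elim
    case (elim \<omega>)
    then have top: "(\<Sum>n. ennreal (f n \<omega>)) \<noteq> top" by (simp add: U_def)
    have "summable (\<lambda>n. f n \<omega>)" by (rule summable_suminf_not_top[OF f0 top])
    moreover have "W \<omega> = (\<Sum>n. f n \<omega>)"
      unfolding W_def U_def using suminf_ennreal[OF f0 top] suminf_nonneg[OF \<open>summable _\<close> f0] by simp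
    ultimately have "(\<lambda>n. f n \<omega>) sums W \<omega>" by (simp add: summable_sums)
    then have "((\<lambda>n. f n \<omega>) has_sum W \<omega>) UNIV" by (rule sums_nonneg_imp_has_sum[OF _ f0])
    then show ?case
      unfolding f_def using has_sum_reindex_bij_betw[OF bij_prod_decode, of "\<lambda>p. c p * (Z p \<omega>)\<^sup>2" "W \<omega>"] by simp
  qed
  then show ?thesis using 1 by (intro exI[of _ W]) (auto simp: W_def)
qed

section \<open>Independence and negligible sequences\<close>

context prob_space
begin

lemma indep_var_integral_mult:
  fixes f :: "'s \<Rightarrow> real" and g :: "'s \<Rightarrow> real"
  assumes ind: "indep_var S U T V" and f: "f \<in> borel_measurable S" and g: "g \<in> borel_measurable T"
    and iU: "integrable M (\<lambda>\<omega>. f (U \<omega>))" and iV: "integrable M (\<lambda>\<omega>. g (V \<omega>))"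
  shows "integrable M (\<lambda>\<omega>. f (U \<omega>) * g (V \<omega>))"
    and "expectation (\<lambda>\<omega>. f (U \<omega>) * g (V \<omega>)) = expectation (\<lambda>\<omega>. f (U \<omega>)) * expectation (\<lambda>\<omega>. g (V \<omega>))"
proof -
  have i: "indep_var borel (\<lambda>\<omega>. f (U \<omega>)) borel (\<lambda>\<omega>. g (V \<omega>))"
    using indep_var_compose[OF ind f g] by (simp add: o_def)
  show "integrable M (\<lambda>\<omega>. f (U \<omega>) * g (V \<omega>))" by (rule indep_var_integrable[OF i iU iV])
  show "expectation (\<lambda>\<omega>. f (U \<omega>) * g (V \<omega>)) = expectation (\<lambda>\<omega>. f (U \<omega>)) * expectation (\<lambda>\<omega>. g (V \<omega>))"
    by (rule indep_var_lebesgue_integral[OF i iU iV])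
qed

text \<open>Fubini's theorem on the product of the two distributions.\<close>

lemma indep_var_integral_zero:
  fixes f :: "'s \<times> 's \<Rightarrow> real"
  assumes ind: "indep_var S U T V" and f: "f \<in> borel_measurable (S \<Otimes>\<^sub>M T)"
    and int: "integrable M (\<lambda>\<omega>. f (U \<omega>, V \<omega>))"
    and zero: "\<And>v. v \<in> space T \<Longrightarrow> expectation (\<lambda>\<omega>. f (U \<omega>, v)) = 0"
  shows "expectation (\<lambda>\<omega>. f (U \<omega>, V \<omega>)) = 0"
proof -
  have U: "U \<in> measurable M S" and V: "V \<in> measurable M T"
    and eq: "distr M S U \<Otimes>\<^sub>M distr M T V = distr M (S \<Otimes>\<^sub>M T) (\<lambda>\<omega>. (U \<omega>, V \<omega>))"
    using ind by (auto simp: indep_var_distribution_eq)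
  interpret U: prob_space "distr M S U" by (rule prob_space_distr[OF U])
  interpret V: prob_space "distr M T V" by (rule prob_space_distr[OF V])
  interpret P: pair_sigma_finite "distr M S U" "distr M T V" ..
  have UV: "(\<lambda>\<omega>. (U \<omega>, V \<omega>)) \<in> measurable M (S \<Otimes>\<^sub>M T)" using U V by simp
  have i: "integrable (distr M S U \<Otimes>\<^sub>M distr M T V) (case_prod (\<lambda>u v. f (u, v)))"
    unfolding eq using int integrable_distr_eq[OF UV f] by simp
  have "expectation (\<lambda>\<omega>. f (U \<omega>, V \<omega>)) = integral\<^sup>L (distr M S U \<Otimes>\<^sub>M distr M T V) (case_prod (\<lambda>u v. f (u, v)))"
    unfolding eq using integral_distr[OF UV f] by simp
  also have "\<dots> = (\<integral>v. (\<integral>u. f (u, v) \<partial>distr M S U) \<partial>distr M T V)"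
    by (rule P.integral_snd[OF i, symmetric])
  also have "\<dots> = (\<integral>v. 0 \<partial>distr M T V)"
  proof (rule Bochner_Integration.integral_cong[OF refl])
    fix v assume v: "v \<in> space (distr M T V)"
    then have "(\<lambda>u. f (u, v)) \<in> borel_measurable S" using f by simp
    from integral_distr[OF U this] show "(\<integral>u. f (u, v) \<partial>distr M S U) = 0"
      using zero v by simp
  qed
  finally show ?thesis by simp
qed

definition l2_null :: "(nat \<Rightarrow> 'a \<Rightarrow> real) \<Rightarrow> bool" where
  "l2_null D \<longleftrightarrow> (\<forall>n. square_integrable M (D n)) \<and> (\<lambda>n. l2_inner M (D n) (D n)) \<longlonglongrightarrow> 0"

lemma l2_nullI:
  assumes "\<And>n. square_integrable M (D n)" "\<And>n. l2_inner M (D n) (D n) \<le> r n" "r \<longlonglongrightarrow> 0"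
  shows "l2_null D"
proof -
  have "(\<lambda>n. l2_inner M (D n) (D n)) \<longlonglongrightarrow> 0"
    by (rule tendsto_sandwich[OF _ _ tendsto_const assms(3)])
       (auto intro!: always_eventually simp: l2_inner_self_nonneg assms(2))
  then show ?thesis using assms(1) by (simp add: l2_null_def)
qed

lemma l2_null_scaled:
  assumes s: "\<And>n. square_integrable M (D n)" and le: "\<And>n. l2_inner M (D n) (D n) \<le> C * r n"
    and lim: "(\<lambda>n. (c n)\<^sup>2 * r n) \<longlonglongrightarrow> 0"
  shows "l2_null (\<lambda>n \<omega>. c n * D n \<omega>)"
proof (rule l2_nullI)
  show "square_integrable M (\<lambda>\<omega>. c n * D n \<omega>)" for n by (rule square_integrable_cmult[OF s])
  show "l2_inner M (\<lambda>\<omega>. c n * D n \<omega>) (\<lambda>\<omega>. c n * D n \<omega>) \<le> C * ((c n)\<^sup>2 * r n)" for n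
    using mult_left_mono[OF le, of "(c n)\<^sup>2" n] by (simp add: l2_inner_self power_mult_distrib mult_ac)
  show "(\<lambda>n. C * ((c n)\<^sup>2 * r n)) \<longlonglongrightarrow> 0" by (rule tendsto_mult_right_zero[OF lim])
qed

lemma l2_null_cmult:
  assumes D: "l2_null D" and c: "\<And>n. \<bar>c n\<bar> \<le> C"
  shows "l2_null (\<lambda>n \<omega>. c n * D n \<omega>)"
proof (rule l2_nullI)
  show "square_integrable M (\<lambda>\<omega>. c n * D n \<omega>)" for n
    using D by (simp add: l2_null_def square_integrable_cmult)
  show "l2_inner M (\<lambda>\<omega>. c n * D n \<omega>) (\<lambda>\<omega>. c n * D n \<omega>) \<le> C\<^sup>2 * l2_inner M (D n) (D n)" for n
  proof -
    have "(c n)\<^sup>2 \<le> C\<^sup>2" using c[of n] by (metis abs_ge_zero power2_abs power_mono)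
    then show ?thesis
      using mult_right_mono[OF _ l2_inner_self_nonneg[of M "D n"], of "(c n)\<^sup>2" "C\<^sup>2"]
      by (simp add: l2_inner_self power_mult_distrib)
  qed
  show "(\<lambda>n. C\<^sup>2 * l2_inner M (D n) (D n)) \<longlonglongrightarrow> 0"
    using D tendsto_mult_right_zero unfolding l2_null_def by blast
qed

lemma l2_null_add:
  assumes D: "l2_null D" and E: "l2_null E"
  shows "l2_null (\<lambda>n \<omega>. D n \<omega> + E n \<omega>)"
proof (rule l2_nullI)
  have s: "square_integrable M (D n)" "square_integrable M (E n)" for n
    using D E by (auto simp: l2_null_def)
  have sum_diff: "square_integrable M (\<lambda>\<omega>. D n \<omega> + E n \<omega>)" "square_integrable M (\<lambda>\<omega>. D n \<omega> - E n \<omega>)" for n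
    using square_integrable_lincomb[OF s(1)[of n] s(2)[of n], of 1 1]
      square_integrable_lincomb[OF s(1)[of n] s(2)[of n], of 1 "-1"] by auto
  then show "square_integrable M (\<lambda>\<omega>. D n \<omega> + E n \<omega>)" for n by simp
  show "l2_inner M (\<lambda>\<omega>. D n \<omega> + E n \<omega>) (\<lambda>\<omega>. D n \<omega> + E n \<omega>)
      \<le> 2 * l2_inner M (D n) (D n) + 2 * l2_inner M (E n) (E n)" for n
  proof -
    have "l2_inner M (\<lambda>\<omega>. D n \<omega> + E n \<omega>) (\<lambda>\<omega>. D n \<omega> + E n \<omega>)
      \<le> (\<integral>\<omega>. 2 * (D n \<omega>)\<^sup>2 + 2 * (E n \<omega>)\<^sup>2 \<partial>M)"
      unfolding l2_inner_self
    proof (rule integral_mono)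
      show "(D n \<omega> + E n \<omega>)\<^sup>2 \<le> 2 * (D n \<omega>)\<^sup>2 + 2 * (E n \<omega>)\<^sup>2" for \<omega>
        using zero_le_power2[of "D n \<omega> - E n \<omega>"] by (simp add: power2_eq_square algebra_simps)
    qed (use s[of n] sum_diff[of n] in \<open>auto simp: square_integrable_def\<close>)
    then show ?thesis using s[of n] by (simp add: l2_inner_self square_integrable_def)
  qed
  show "(\<lambda>n. 2 * l2_inner M (D n) (D n) + 2 * l2_inner M (E n) (E n)) \<longlonglongrightarrow> 0"
    using D E unfolding l2_null_def by (auto intro!: tendsto_eq_intros)
qed

lemma l2_null_diff: "l2_null D \<Longrightarrow> l2_null E \<Longrightarrow> l2_null (\<lambda>n \<omega>. D n \<omega> - E n \<omega>)"
  using l2_null_add[of D "\<lambda>n \<omega>. (-1) * E n \<omega>"] l2_null_cmult[of E "\<lambda>_. -1" 1] by simp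

lemma l2_null_imp_mean_abs:
  assumes D: "l2_null D"
  shows "(\<lambda>n. expectation (\<lambda>\<omega>. \<bar>D n \<omega>\<bar>)) \<longlonglongrightarrow> 0"
proof (rule tendsto_sandwich[OF _ _ tendsto_const])
  have s: "square_integrable M (D n)" for n using D by (simp add: l2_null_def)
  have "expectation (\<lambda>\<omega>. \<bar>D n \<omega>\<bar>) \<le> sqrt (l2_inner M (D n) (D n))" for n
  proof -
    have "square_integrable M (\<lambda>\<omega>. \<bar>D n \<omega>\<bar>)" "square_integrable M (\<lambda>_. 1)"
      using s[of n] by (auto simp: square_integrable_def)
    from l2_Cauchy_Schwarz_abs[OF this]
    have "\<bar>l2_inner M (\<lambda>\<omega>. \<bar>D n \<omega>\<bar>) (\<lambda>_. 1)\<bar> \<le> sqrt (l2_inner M (\<lambda>\<omega>. \<bar>D n \<omega>\<bar>) (\<lambda>\<omega>. \<bar>D n \<omega>\<bar>)) * sqrt (l2_inner M (\<lambda>_. 1) (\<lambda>_. 1))" .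
    then show ?thesis by (simp add: l2_inner_def prob_space)
  qed
  then show "eventually (\<lambda>n. expectation (\<lambda>\<omega>. \<bar>D n \<omega>\<bar>) \<le> sqrt (l2_inner M (D n) (D n))) sequentially"
    by simp
  show "(\<lambda>n. sqrt (l2_inner M (D n) (D n))) \<longlonglongrightarrow> 0"
    using tendsto_real_sqrt[of "\<lambda>n. l2_inner M (D n) (D n)" 0] D by (simp add: l2_null_def)
qed (simp add: always_eventually)

end

section \<open>Moments of bilinear forms in an independent sample\<close>

locale iid_sample = M: prob_space M + finite_variance_distribution F for M :: "'a measure" and F +
  fixes X :: "nat \<Rightarrow> 'a \<Rightarrow> real"
  assumes indep: "M.indep_vars (\<lambda>_. borel) X UNIV" and distr_X: "\<And>i. distr M borel (X i) = F"
begin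

lemma measurable_X [measurable]: "X i \<in> borel_measurable M"
  using indep by (auto simp: M.indep_vars_def2)

lemma integrable_X: "f \<in> borel_measurable borel \<Longrightarrow> integrable M (\<lambda>\<omega>. f (X i \<omega>)) \<longleftrightarrow> integrable F f" for f :: "real \<Rightarrow> real"
  using integrable_distr_eq[OF measurable_X[of i], of f] by (simp add: distr_X)

lemma integral_X: "f \<in> borel_measurable borel \<Longrightarrow> (\<integral>\<omega>. f (X i \<omega>) \<partial>M) = integral\<^sup>L F f" for f :: "real \<Rightarrow> real"
  using integral_distr[OF measurable_X[of i], of f] by (simp add: distr_X)

lemma integral_ker_left: "(\<integral>x. ker x y \<partial>F) = 0"
proof -
  have "(\<integral>x. ker x y \<partial>F) = T (\<lambda>_. 1) y" by (simp add: integral_op_def ker_commute)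
  also have "\<dots> = 0"
    unfolding T_eq[OF sqi_const] by (simp add: coef_def l2_inner_def integral_centred_step)
  finally show ?thesis .
qed

definition ker_sq :: real where
  "ker_sq = (\<integral>p. (ker (fst p) (snd p))\<^sup>2 \<partial>(F \<Otimes>\<^sub>M F))"

lemma ker_sq_nonneg: "0 \<le> ker_sq" by (simp add: ker_sq_def)

text \<open>The diagonal is set to zero so that sums over pairs of distinct indices become full double sums.\<close>

definition off :: "nat \<Rightarrow> nat \<Rightarrow> 'a \<Rightarrow> real" where
  "off i j \<omega> = (if i = j then 0 else ker (X i \<omega>) (X j \<omega>))"

lemma off_commute: "off i j \<omega> = off j i \<omega>"
  by (simp add: off_def ker_commute)

lemma measurable_off [measurable]: "off i j \<in> borel_measurable M"
  unfolding off_def[abs_def] by measurable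

lemma indep_pair: "i \<noteq> j \<Longrightarrow> M.indep_var borel (X i) borel (X j)"
  using M.indep_vars_sum[of "{j}" i X] M.indep_vars_subset[OF indep, of "{i, j}"] by simp

lemma off_square: 
  assumes "i \<noteq> j"
  shows "integrable M (\<lambda>\<omega>. (off i j \<omega>)\<^sup>2)" "(\<integral>\<omega>. (off i j \<omega>)\<^sup>2 \<partial>M) = ker_sq"
proof -
  have eq: "F \<Otimes>\<^sub>M F = distr M (borel \<Otimes>\<^sub>M borel) (\<lambda>\<omega>. (X i \<omega>, X j \<omega>))"
    using indep_pair[OF assms] by (simp add: M.indep_var_distribution_eq distr_X)
  have m: "(\<lambda>\<omega>. (X i \<omega>, X j \<omega>)) \<in> measurable M (borel \<Otimes>\<^sub>M borel)" by measurable
  have k: "(\<lambda>p. (ker (fst p) (snd p))\<^sup>2) \<in> borel_measurable (borel \<Otimes>\<^sub>M borel)" by measurable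
  show "(\<integral>\<omega>. (off i j \<omega>)\<^sup>2 \<partial>M) = ker_sq"
    unfolding ker_sq_def eq using integral_distr[OF m k] assms by (simp add: off_def)
  have md: "integrable M (\<lambda>\<omega>. mean_dist (X i \<omega>))" for i
    using sqi_integrable[OF sqi_mean_dist] by (simp add: integrable_X)
  have "integrable M (\<lambda>\<omega>. mean_dist (X i \<omega>) * mean_dist (X j \<omega>))"
    by (rule M.indep_var_integral_mult[OF indep_pair[OF assms]]) (auto simp: md)
  then show "integrable M (\<lambda>\<omega>. (off i j \<omega>)\<^sup>2)"
  proof (rule Bochner_Integration.integrable_bound)
    have "(ker x y)\<^sup>2 \<le> mean_dist x * mean_dist y" for x y
    proof -
      have "(ker x y)\<^sup>2 = \<bar>ker x y\<bar> * \<bar>ker y x\<bar>" by (simp add: ker_commute power2_eq_square)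
      also have "\<dots> \<le> mean_dist x * mean_dist y"
        by (intro mult_mono abs_ker_le mean_dist_nonneg) auto
      finally show ?thesis .
    qed
    then show "AE \<omega> in M. norm ((off i j \<omega>)\<^sup>2) \<le> norm (mean_dist (X i \<omega>) * mean_dist (X j \<omega>))"
      using assms by (auto intro!: AE_I2 simp: off_def mean_dist_nonneg)
  qed measurable
qed

lemma sqi_off: "square_integrable M (off i j)"
  using off_square[of i j] square_integrable_zero[of M]
  by (cases "i = j") (auto simp: square_integrable_def off_def[abs_def])

text \<open>Given all the other variables, integrating out \<open>X i\<close> gives zero by \<open>integral_ker_left\<close>.\<close>

lemma off_orthogonal_aux:
  assumes ij: "i \<noteq> j" and i: "i \<noteq> k" "i \<noteq> l"
  shows "(\<integral>\<omega>. off i j \<omega> * off k l \<omega> \<partial>M) = 0"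
proof (cases "k = l")
  case True
  then show ?thesis by (simp add: off_def)
next
  case False
  let ?B = "{j, k, l}"
  let ?U = "\<lambda>\<omega>. restrict (\<lambda>i. X i \<omega>) {i}" and ?V = "\<lambda>\<omega>. restrict (\<lambda>i. X i \<omega>) ?B"
  let ?S = "PiM {i} (\<lambda>_. borel :: real measure)" and ?T = "PiM ?B (\<lambda>_. borel :: real measure)"
  let ?f = "\<lambda>p. ker (fst p i) (snd p j) * ker (snd p k) (snd p l)"
  have ind: "M.indep_var ?S ?U ?T ?V"
    using M.indep_var_restrict[OF indep, of "{i}" ?B] ij i by auto
  have [measurable]: "(\<lambda>p. fst p i) \<in> borel_measurable (?S \<Otimes>\<^sub>M ?T)"
    "(\<lambda>p. snd p j) \<in> borel_measurable (?S \<Otimes>\<^sub>M ?T)" "(\<lambda>p. snd p k) \<in> borel_measurable (?S \<Otimes>\<^sub>M ?T)"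
    "(\<lambda>p. snd p l) \<in> borel_measurable (?S \<Otimes>\<^sub>M ?T)"
    by (auto intro!: measurable_compose[OF measurable_fst] measurable_compose[OF measurable_snd])
  have "(\<integral>\<omega>. ?f (?U \<omega>, ?V \<omega>) \<partial>M) = 0"
  proof (rule M.indep_var_integral_zero[OF ind])
    show "?f \<in> borel_measurable (?S \<Otimes>\<^sub>M ?T)" by measurable
    show "integrable M (\<lambda>\<omega>. ?f (?U \<omega>, ?V \<omega>))"
      using square_integrable_mult[OF sqi_off[of i j] sqi_off[of k l]] ij False by (simp add: off_def)
    show "(\<integral>\<omega>. ?f (?U \<omega>, v) \<partial>M) = 0" for v
      using integral_X[of "\<lambda>x. ker x (v j)" i] by (simp add: integral_ker_left)
  qed
  then show ?thesis using ij False by (simp add: off_def)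
qed

lemma off_orthogonal:
  assumes "i \<noteq> j" "(k, l) \<noteq> (i, j)" "(k, l) \<noteq> (j, i)"
  shows "(\<integral>\<omega>. off i j \<omega> * off k l \<omega> \<partial>M) = 0"
proof (cases "i \<noteq> k \<and> i \<noteq> l")
  case True
  then show ?thesis using off_orthogonal_aux assms by blast
next
  case False
  then have "j \<noteq> k" "j \<noteq> l" if "k \<noteq> l" using assms that by auto
  then show ?thesis
    using off_orthogonal_aux[of j i k l] assms unfolding off_commute[of i j]
    by (cases "k = l") (simp_all add: off_def[of l l])
qed

text \<open>Coefficients independent of the sample can be averaged first; by degeneracy of the kernel only
  the pairs \<open>(i, j)\<close> and \<open>(j, i)\<close> then interact.\<close>

lemma bilinear_form_second_moment:
  fixes a :: "nat \<Rightarrow> nat \<Rightarrow> (nat \<Rightarrow> real) \<Rightarrow> real"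
  assumes ind: "M.indep_var S G (PiM UNIV (\<lambda>_. borel)) (\<lambda>\<omega> i. X i \<omega>)"
    and am [measurable]: "\<And>i j. a i j \<in> borel_measurable S"
    and asq: "\<And>i j. integrable M (\<lambda>\<omega>. (a i j (G \<omega>))\<^sup>2)"
    and t: "\<And>i j. (\<integral>\<omega>. (a i j (G \<omega>))\<^sup>2 \<partial>M) \<le> t"
  shows "square_integrable M (\<lambda>\<omega>. \<Sum>i<n. \<Sum>j<n. a i j (G \<omega>) * off i j \<omega>)"
    and "l2_inner M (\<lambda>\<omega>. \<Sum>i<n. \<Sum>j<n. a i j (G \<omega>) * off i j \<omega>) (\<lambda>\<omega>. \<Sum>i<n. \<Sum>j<n. a i j (G \<omega>) * off i j \<omega>)
      \<le> 2 * ker_sq * t * (real n)\<^sup>2"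
proof -
  let ?I = "{..<n} \<times> {..<n}"
  have Gm [measurable]: "G \<in> measurable M S" using ind by (simp add: M.indep_var_distribution_eq)
  define A where "A p \<omega> = a (fst p) (snd p) (G \<omega>)" for p \<omega>
  define H where "H p \<omega> = off (fst p) (snd p) \<omega>" for p \<omega>
  have sA: "square_integrable M (A p)" for p
    using asq unfolding square_integrable_def A_def[abs_def] by simp
  have sH: "square_integrable M (H p)" for p
    using sqi_off unfolding H_def[abs_def] .
  have prod: "integrable M (\<lambda>\<omega>. (A p \<omega> * A q \<omega>) * (H p \<omega> * H q \<omega>))"
    "(\<integral>\<omega>. (A p \<omega> * A q \<omega>) * (H p \<omega> * H q \<omega>) \<partial>M) = l2_inner M (A p) (A q) * l2_inner M (H p) (H q)" for p q
  proof -
    let ?f = "\<lambda>s. a (fst p) (snd p) s * a (fst q) (snd q) s"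
    let ?h = "\<lambda>i j x. if i = j then 0 else ker (x i) (x j)"
    let ?g = "\<lambda>x :: nat \<Rightarrow> real. ?h (fst p) (snd p) x * ?h (fst q) (snd q) x"
    have g: "?g \<in> borel_measurable (PiM UNIV (\<lambda>_. borel))"
      by (intro borel_measurable_times measurable_If measurable_ker) auto
    have iA: "integrable M (\<lambda>\<omega>. ?f (G \<omega>))"
      using square_integrable_mult[OF sA[of p] sA[of q]] by (simp add: A_def)
    have iH: "integrable M (\<lambda>\<omega>. ?g (\<lambda>i. X i \<omega>))"
      using square_integrable_mult[OF sH[of p] sH[of q]] by (simp add: H_def off_def)
    have f: "?f \<in> borel_measurable S" by measurable
    note * = M.indep_var_integral_mult[OF ind f g, OF iA iH]
    show "integrable M (\<lambda>\<omega>. (A p \<omega> * A q \<omega>) * (H p \<omega> * H q \<omega>))"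
      using *(1) by (simp add: A_def H_def off_def)
    show "(\<integral>\<omega>. (A p \<omega> * A q \<omega>) * (H p \<omega> * H q \<omega>) \<partial>M) = l2_inner M (A p) (A q) * l2_inner M (H p) (H q)"
      using *(2) by (simp add: A_def H_def off_def l2_inner_def)
  qed
  have Q: "(\<Sum>i<n. \<Sum>j<n. a i j (G \<omega>) * off i j \<omega>) = (\<Sum>p\<in>?I. A p \<omega> * H p \<omega>)" for \<omega>
    by (simp add: A_def H_def sum.cartesian_product case_prod_unfold)
  have Q2: "(\<Sum>p\<in>?I. A p \<omega> * H p \<omega>)\<^sup>2 = (\<Sum>p\<in>?I. \<Sum>q\<in>?I. (A p \<omega> * A q \<omega>) * (H p \<omega> * H q \<omega>))" for \<omega>
    by (simp add: power2_eq_square sum_product mult_ac)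
  have "integrable M (\<lambda>\<omega>. (\<Sum>p\<in>?I. A p \<omega> * H p \<omega>)\<^sup>2)"
    unfolding Q2 by (intro Bochner_Integration.integrable_sum prod)
  moreover have "(\<lambda>\<omega>. \<Sum>p\<in>?I. A p \<omega> * H p \<omega>) \<in> borel_measurable M"
    using sA sH by (intro borel_measurable_sum borel_measurable_times) (auto simp: square_integrable_def)
  ultimately show "square_integrable M (\<lambda>\<omega>. \<Sum>i<n. \<Sum>j<n. a i j (G \<omega>) * off i j \<omega>)"
    unfolding Q square_integrable_def by simp
  have AA: "l2_inner M (A p) (A q) \<le> t" for p q
  proof -
    have "l2_inner M (A p) (A q) \<le> (\<integral>\<omega>. ((A p \<omega>)\<^sup>2 + (A q \<omega>)\<^sup>2) / 2 \<partial>M)"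
      unfolding l2_inner_def
    proof (rule integral_mono[OF square_integrable_mult[OF sA sA]])
      show "A p \<omega> * A q \<omega> \<le> ((A p \<omega>)\<^sup>2 + (A q \<omega>)\<^sup>2) / 2" for \<omega>
        using zero_le_power2[of "A p \<omega> - A q \<omega>"] by (simp add: power2_eq_square algebra_simps)
    qed (use sA[of p] sA[of q] in \<open>auto simp: square_integrable_def\<close>)
    also have "\<dots> = ((\<integral>\<omega>. (A p \<omega>)\<^sup>2 \<partial>M) + (\<integral>\<omega>. (A q \<omega>)\<^sup>2 \<partial>M)) / 2"
      using sA[of p] sA[of q] by (simp add: square_integrable_def)
    also have "\<dots> \<le> t" using t[of "fst p" "snd p"] t[of "fst q" "snd q"] by (simp add: A_def)
    finally show ?thesis .
  qed
  have HH: "l2_inner M (H p) (H q) = 0" if "q \<notin> {p, prod.swap p}" for p q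
  proof (cases "fst p = snd p")
    case True
    then show ?thesis by (simp add: H_def[abs_def] off_def l2_inner_def)
  next
    case False
    then show ?thesis
      using off_orthogonal[of "fst p" "snd p" "fst q" "snd q"] that
      by (cases p; cases q) (auto simp: H_def[abs_def] l2_inner_def)
  qed
  have HH': "0 \<le> l2_inner M (H p) (H q) \<and> l2_inner M (H p) (H q) \<le> ker_sq" if "q \<in> {p, prod.swap p}" for p q
  proof -
    have "H q = H p" using that by (auto simp: H_def[abs_def] off_commute)
    then have "l2_inner M (H p) (H q) = (\<integral>\<omega>. (off (fst p) (snd p) \<omega>)\<^sup>2 \<partial>M)"
      by (simp add: l2_inner_self H_def)
    then show ?thesis
      using off_square(2)[of "fst p" "snd p"] ker_sq_nonneg by (cases "fst p = snd p") (auto simp: off_def)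
  qed
  have t0: "0 \<le> t" using order.trans[OF _ t[of 0 0]] by simp
  have "l2_inner M (\<lambda>\<omega>. \<Sum>p\<in>?I. A p \<omega> * H p \<omega>) (\<lambda>\<omega>. \<Sum>p\<in>?I. A p \<omega> * H p \<omega>)
      = (\<Sum>p\<in>?I. \<Sum>q\<in>?I. l2_inner M (A p) (A q) * l2_inner M (H p) (H q))"
    unfolding l2_inner_self Q2 using prod by simp
  also have "\<dots> \<le> (\<Sum>p\<in>?I. \<Sum>q\<in>?I. if q \<in> {p, prod.swap p} then t * ker_sq else 0)"
  proof (intro sum_mono)
    fix p q
    show "l2_inner M (A p) (A q) * l2_inner M (H p) (H q) \<le> (if q \<in> {p, prod.swap p} then t * ker_sq else 0)"
    proof (cases "q \<in> {p, prod.swap p}")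
      case True
      have "l2_inner M (A p) (A q) * l2_inner M (H p) (H q) \<le> t * l2_inner M (H p) (H q)"
        using HH'[OF True] AA by (intro mult_right_mono) auto
      also have "\<dots> \<le> t * ker_sq" using HH'[OF True] t0 by (intro mult_left_mono) auto
      finally show ?thesis using True by simp
    next
      case False
      then show ?thesis by (simp add: HH)
    qed
  qed
  also have "\<dots> \<le> (\<Sum>p\<in>?I. 2 * (t * ker_sq))"
  proof (intro sum_mono)
    fix p
    have "(\<Sum>q\<in>?I. if q \<in> {p, prod.swap p} then t * ker_sq else 0)
        = real (card (?I \<inter> {p, prod.swap p})) * (t * ker_sq)"
      by (subst sum.inter_restrict[symmetric]) simp_all
    also have "\<dots> \<le> 2 * (t * ker_sq)"
    proof (rule mult_right_mono)
      have "card (?I \<inter> {p, prod.swap p}) \<le> card {p, prod.swap p}" by (intro card_mono) auto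
      also have "\<dots> \<le> 2" by (simp add: card_insert_if)
      finally show "real (card (?I \<inter> {p, prod.swap p})) \<le> 2" by simp
    qed (use t0 ker_sq_nonneg in simp)
    finally show "(\<Sum>q\<in>?I. if q \<in> {p, prod.swap p} then t * ker_sq else 0) \<le> 2 * (t * ker_sq)" .
  qed
  also have "\<dots> = 2 * ker_sq * t * (real n)\<^sup>2" by (simp add: power2_eq_square card_cartesian_product)
  finally show "l2_inner M (\<lambda>\<omega>. \<Sum>i<n. \<Sum>j<n. a i j (G \<omega>) * off i j \<omega>) (\<lambda>\<omega>. \<Sum>i<n. \<Sum>j<n. a i j (G \<omega>) * off i j \<omega>)
      \<le> 2 * ker_sq * t * (real n)\<^sup>2"
    unfolding Q .
qed

lemma integral_X_mult:
  assumes u: "square_integrable F u" and mean: "(\<integral>x. u x \<partial>F) = 0"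
  shows "(\<integral>\<omega>. u (X i \<omega>) * u (X j \<omega>) \<partial>M) = (if i = j then l2_inner F u u else 0)"
proof (cases "i = j")
  case True
  have [measurable]: "u \<in> borel_measurable borel" by (rule sqi_borel[OF u])
  show ?thesis using True integral_X[of "\<lambda>x. u x * u x" i] by (simp add: l2_inner_def)
next
  case False
  have [measurable]: "u \<in> borel_measurable borel" by (rule sqi_borel[OF u])
  have "integrable M (\<lambda>\<omega>. u (X i \<omega>))" for i using sqi_integrable[OF u] by (simp add: integrable_X)
  from M.indep_var_integral_mult(2)[OF indep_pair[OF False], of u u, OF _ _ this this]
  show ?thesis using mean False by (simp add: integral_X)
qed

lemma linear_form_second_moment:
  fixes a :: "nat \<Rightarrow> (nat \<Rightarrow> real) \<Rightarrow> real"
  assumes ind: "M.indep_var S G (PiM UNIV (\<lambda>_. borel)) (\<lambda>\<omega> i. X i \<omega>)"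
    and u: "square_integrable F u" and mean: "(\<integral>x. u x \<partial>F) = 0"
    and am [measurable]: "\<And>i. a i \<in> borel_measurable S"
    and asq: "\<And>i. integrable M (\<lambda>\<omega>. (a i (G \<omega>))\<^sup>2)"
    and t: "\<And>i. (\<integral>\<omega>. (a i (G \<omega>))\<^sup>2 \<partial>M) \<le> t"
  shows "square_integrable M (\<lambda>\<omega>. \<Sum>i<n. a i (G \<omega>) * u (X i \<omega>))"
    and "l2_inner M (\<lambda>\<omega>. \<Sum>i<n. a i (G \<omega>) * u (X i \<omega>)) (\<lambda>\<omega>. \<Sum>i<n. a i (G \<omega>) * u (X i \<omega>))
      \<le> l2_inner F u u * t * real n"
proof -
  have [measurable]: "u \<in> borel_measurable borel" by (rule sqi_borel[OF u])
  have Gm [measurable]: "G \<in> measurable M S" using ind by (simp add: M.indep_var_distribution_eq)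
  have sA: "square_integrable M (\<lambda>\<omega>. a i (G \<omega>))" for i
    using asq unfolding square_integrable_def by simp
  have sU: "square_integrable M (\<lambda>\<omega>. u (X i \<omega>))" for i
    using u integrable_X[of "\<lambda>x. (u x)\<^sup>2" i] by (simp add: square_integrable_def)
  note UU = integral_X_mult[OF u mean]
  have prod: "integrable M (\<lambda>\<omega>. (a i (G \<omega>) * a j (G \<omega>)) * (u (X i \<omega>) * u (X j \<omega>)))"
    "(\<integral>\<omega>. (a i (G \<omega>) * a j (G \<omega>)) * (u (X i \<omega>) * u (X j \<omega>)) \<partial>M)
      = (\<integral>\<omega>. a i (G \<omega>) * a j (G \<omega>) \<partial>M) * (\<integral>\<omega>. u (X i \<omega>) * u (X j \<omega>) \<partial>M)" for i j
  proof -
    let ?f = "\<lambda>s. a i s * a j s" and ?g = "\<lambda>x :: nat \<Rightarrow> real. u (x i) * u (x j)"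
    have g: "?g \<in> borel_measurable (PiM UNIV (\<lambda>_. borel))" by measurable
    have f: "?f \<in> borel_measurable S" by measurable
    note * = M.indep_var_integral_mult[OF ind f g, OF square_integrable_mult[OF sA sA] square_integrable_mult[OF sU sU]]
    show "integrable M (\<lambda>\<omega>. (a i (G \<omega>) * a j (G \<omega>)) * (u (X i \<omega>) * u (X j \<omega>)))" by (rule *(1))
    show "(\<integral>\<omega>. (a i (G \<omega>) * a j (G \<omega>)) * (u (X i \<omega>) * u (X j \<omega>)) \<partial>M)
      = (\<integral>\<omega>. a i (G \<omega>) * a j (G \<omega>) \<partial>M) * (\<integral>\<omega>. u (X i \<omega>) * u (X j \<omega>) \<partial>M)" by (rule *(2))
  qed
  have Q2: "(\<Sum>i<n. a i (G \<omega>) * u (X i \<omega>))\<^sup>2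
      = (\<Sum>i<n. \<Sum>j<n. (a i (G \<omega>) * a j (G \<omega>)) * (u (X i \<omega>) * u (X j \<omega>)))" for \<omega>
    by (simp add: power2_eq_square sum_product mult_ac)
  have "integrable M (\<lambda>\<omega>. (\<Sum>i<n. a i (G \<omega>) * u (X i \<omega>))\<^sup>2)"
    unfolding Q2 by (intro Bochner_Integration.integrable_sum prod)
  then show "square_integrable M (\<lambda>\<omega>. \<Sum>i<n. a i (G \<omega>) * u (X i \<omega>))"
    by (simp add: square_integrable_def)
  have "l2_inner M (\<lambda>\<omega>. \<Sum>i<n. a i (G \<omega>) * u (X i \<omega>)) (\<lambda>\<omega>. \<Sum>i<n. a i (G \<omega>) * u (X i \<omega>))
      = (\<Sum>i<n. \<Sum>j<n. (\<integral>\<omega>. a i (G \<omega>) * a j (G \<omega>) \<partial>M) * (\<integral>\<omega>. u (X i \<omega>) * u (X j \<omega>) \<partial>M))"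
    unfolding l2_inner_self Q2 using prod by simp
  also have "\<dots> = (\<Sum>i<n. (\<integral>\<omega>. (a i (G \<omega>))\<^sup>2 \<partial>M) * l2_inner F u u)"
  proof (rule sum.cong[OF refl])
    fix i assume i: "i \<in> {..<n}"
    have "(\<Sum>j<n. (\<integral>\<omega>. a i (G \<omega>) * a j (G \<omega>) \<partial>M) * (\<integral>\<omega>. u (X i \<omega>) * u (X j \<omega>) \<partial>M))
      = (\<Sum>j<n. if j = i then (\<integral>\<omega>. a i (G \<omega>) * a i (G \<omega>) \<partial>M) * l2_inner F u u else 0)"
      by (intro sum.cong) (auto simp: UU)
    then show "(\<Sum>j<n. (\<integral>\<omega>. a i (G \<omega>) * a j (G \<omega>) \<partial>M) * (\<integral>\<omega>. u (X i \<omega>) * u (X j \<omega>) \<partial>M))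
      = (\<integral>\<omega>. (a i (G \<omega>))\<^sup>2 \<partial>M) * l2_inner F u u" using i by (simp add: power2_eq_square)
  qed
  also have "\<dots> \<le> (\<Sum>i<n. t * l2_inner F u u)"
    by (intro sum_mono mult_right_mono t l2_inner_self_nonneg)
  finally show "l2_inner M (\<lambda>\<omega>. \<Sum>i<n. a i (G \<omega>) * u (X i \<omega>)) (\<lambda>\<omega>. \<Sum>i<n. a i (G \<omega>) * u (X i \<omega>))
      \<le> l2_inner F u u * t * real n" by (simp add: mult_ac)
qed

end

section \<open>Algebra of the estimator\<close>

lemma sum_lower_triangle:
  fixes s :: "nat \<Rightarrow> nat \<Rightarrow> real"
  assumes sym: "\<And>i j. s i j = s j i" and diag: "\<And>i. s i i = 0"
  shows "(\<Sum>j<n. \<Sum>i<j. s i j) = (\<Sum>i<n. \<Sum>j<n. s i j) / 2"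
proof (induction n)
  case (Suc n)
  have "(\<Sum>i<Suc n. \<Sum>j<Suc n. s i j) = (\<Sum>i<n. \<Sum>j<n. s i j) + 2 * (\<Sum>i<n. s i n)"
    by (simp add: sum.distrib diag sym[of n])
  then show ?case using Suc by simp
qed simp

text \<open>Both sides count each ordered triple of distinct indices once.\<close>

lemma sum_ordered_triples:
  fixes g :: "nat \<Rightarrow> nat \<Rightarrow> nat \<Rightarrow> real"
  assumes "\<And>i k. g i i k = 0" "\<And>i j. g i j i = 0" "\<And>i j. g i j j = 0"
  shows "(\<Sum>k<n. \<Sum>j<k. \<Sum>i<j. g i j k + g j i k + g i k j + g j k i + g k i j + g k j i)
    = (\<Sum>i<n. \<Sum>j<n. \<Sum>k<n. g i j k)"
proof (induction n)
  case (Suc n)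
  have "(\<Sum>j<n. \<Sum>i<j. g i j n + g j i n + g i n j + g j n i + g n i j + g n j i)
      = (\<Sum>i<n. \<Sum>j<n. g i j n + g j i n + g i n j + g j n i + g n i j + g n j i) / 2"
    by (rule sum_lower_triangle) (auto simp: assms)
  also have "\<dots> = (\<Sum>i<n. \<Sum>j<n. g i j n) + (\<Sum>i<n. \<Sum>j<n. g i n j) + (\<Sum>i<n. \<Sum>j<n. g n i j)"
  proof -
    have "(\<Sum>i<n. \<Sum>j<n. g j i n) = (\<Sum>i<n. \<Sum>j<n. g i j n)"
      "(\<Sum>i<n. \<Sum>j<n. g j n i) = (\<Sum>i<n. \<Sum>j<n. g i n j)"
      "(\<Sum>i<n. \<Sum>j<n. g n j i) = (\<Sum>i<n. \<Sum>j<n. g n i j)" by (rule sum.swap)+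
    then show ?thesis by (simp add: sum.distrib)
  qed
  finally show ?case using Suc by (simp add: sum.distrib assms)
qed simp

lemma real_choose_two: "real (n choose 2) = real n * (real n - 1) / 2"
  by (induction n) (auto simp: numeral_2_eq_2 field_simps)

lemma real_choose_three: "real (n choose 3) = real n * (real n - 1) * (real n - 2) / 6"
proof (induction n)
  case (Suc n)
  have "Suc n choose 3 = (n choose 2) + (n choose 3)" by (simp add: numeral_3_eq_3 numeral_2_eq_2)
  then show ?case using Suc real_choose_two[of n] by (simp add: field_simps)
qed simp

lemma kappa_star_eq:
  fixes x y :: "nat \<Rightarrow> real" and n :: nat
  defines "a \<equiv> \<lambda>i j. \<bar>x i - x j\<bar>" and "b \<equiv> \<lambda>i j. \<bar>y i - y j\<bar>"
  defines "N \<equiv> real n"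
  shows "kappa_star n x y = (1/4) * ((\<Sum>i<n. \<Sum>j<n. a i j * b i j) / (N * (N - 1))
    + (\<Sum>i<n. \<Sum>j<n. a i j) * (\<Sum>i<n. \<Sum>j<n. b i j) / (N * (N - 1))\<^sup>2
    - 2 * ((\<Sum>i<n. (\<Sum>j<n. a i j) * (\<Sum>j<n. b i j)) - (\<Sum>i<n. \<Sum>j<n. a i j * b i j)) / (N * (N - 1) * (N - 2)))"
proof -
  have sym: "a i j = a j i" "b i j = b j i" and diag: "a i i = 0" "b i i = 0" for i j
    by (auto simp: a_def b_def)
  have s2: "(\<Sum>j<n. \<Sum>i<j. s i j) / real (n choose 2) = (\<Sum>i<n. \<Sum>j<n. s i j) / (N * (N - 1))"
    if "\<And>i j. s i j = s j i" "\<And>i. s i i = 0" for s :: "nat \<Rightarrow> nat \<Rightarrow> real"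
    unfolding sum_lower_triangle[of s, OF that] real_choose_two N_def by simp
  have 1: "U1 n x = (\<Sum>i<n. \<Sum>j<n. a i j) / (N * (N - 1))"
    using s2[of a, OF sym(1) diag(1)] by (simp add: U1_def a_def)
  have 2: "U1 n y = (\<Sum>i<n. \<Sum>j<n. b i j) / (N * (N - 1))"
    using s2[of b, OF sym(2) diag(2)] by (simp add: U1_def b_def)
  have 3: "U12 n x y = (\<Sum>i<n. \<Sum>j<n. a i j * b i j) / (N * (N - 1))"
  proof -
    have "a i j * b i j = a j i * b j i" "a i i * b i i = 0" for i j
      using sym[of i j] diag[of i] by simp_all
    from s2[of "\<lambda>i j. a i j * b i j", OF this] show ?thesis by (simp add: U12_def a_def b_def)
  qed
  define g where "g i j k = (if j = k then 0 else a i j * b i k)" for i j k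
  have g0: "g i i k = 0" "g i j i = 0" "g i j j = 0" for i j k by (auto simp: g_def diag)
  have h3: "h3 (x i, y i) (x j, y j) (x k, y k) = (g i j k + g j i k + g i k j + g j k i + g k i j + g k j i) / 6"
    if "i < j" "j < k" for i j k
    using that by (simp add: h3_def g_def a_def b_def)
  have "(\<Sum>k<n. \<Sum>j<k. \<Sum>i<j. h3 (x i, y i) (x j, y j) (x k, y k))
      = (\<Sum>k<n. \<Sum>j<k. \<Sum>i<j. (g i j k + g j i k + g i k j + g j k i + g k i j + g k j i) / 6)"
    by (intro sum.cong refl h3) auto
  also have "\<dots> = (\<Sum>i<n. \<Sum>j<n. \<Sum>k<n. g i j k) / 6"
    using sum_ordered_triples[of g n] g0 by (simp flip: sum_divide_distrib)
  also have "(\<Sum>i<n. \<Sum>j<n. \<Sum>k<n. g i j k)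
      = (\<Sum>i<n. (\<Sum>j<n. a i j) * (\<Sum>j<n. b i j)) - (\<Sum>i<n. \<Sum>j<n. a i j * b i j)"
  proof -
    have "(\<Sum>k<n. g i j k) = a i j * (\<Sum>k<n. b i k) - a i j * b i j" if "j < n" for i j
    proof -
      have "(\<Sum>k<n. g i j k) = (\<Sum>k<n. a i j * b i k - (if k = j then a i j * b i j else 0))"
        by (intro sum.cong) (auto simp: g_def)
      then show ?thesis using that by (simp add: sum_subtractf sum_distrib_left)
    qed
    then show ?thesis by (simp add: sum_subtractf sum_distrib_right)
  qed
  finally have 4: "U3 n x y = ((\<Sum>i<n. (\<Sum>j<n. a i j) * (\<Sum>j<n. b i j)) - (\<Sum>i<n. \<Sum>j<n. a i j * b i j))
      / (N * (N - 1) * (N - 2))"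
    by (simp add: U3_def real_choose_three N_def)
  show ?thesis unfolding kappa_star_def 1 2 3 4 by (simp add: power2_eq_square)
qed

text \<open>The estimator annihilates constants, and on the additive parts \<open>u i + u j\<close> of the distances it is of
  lower order. What remains is the sum of the \<open>H i j * K i j\<close> and terms of small second moment.
  The row sums of the distances are affine in \<open>u\<close> and the row sums of \<open>H\<close>, so all sums reduce to
  the quantities named in the statement.\<close>

lemma kappa_star_expansion:
  fixes x y u v :: "nat \<Rightarrow> real" and H K :: "nat \<Rightarrow> nat \<Rightarrow> real" and n :: nat
  assumes n: "3 \<le> n"
    and a: "\<And>i j. \<bar>x i - x j\<bar> = (if i = j then 0 else u i + u j + m - 2 * H i j)"
    and b: "\<And>i j. \<bar>y i - y j\<bar> = (if i = j then 0 else v i + v j + m' - 2 * K i j)"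
    and H: "\<And>i j. H i j = H j i" "\<And>i. H i i = 0" and K: "\<And>i j. K i j = K j i" "\<And>i. K i i = 0"
  defines "N \<equiv> real n"
  defines "HK \<equiv> \<Sum>i<n. \<Sum>j<n. H i j * K i j"
    and "hk \<equiv> \<Sum>i<n. (\<Sum>j<n. H i j) * (\<Sum>j<n. K i j)"
    and "hv \<equiv> \<Sum>i<n. \<Sum>j<n. H i j * v i" and "uk \<equiv> \<Sum>i<n. \<Sum>j<n. K i j * u i"
    and "h \<equiv> \<Sum>i<n. \<Sum>j<n. H i j" and "k \<equiv> \<Sum>i<n. \<Sum>j<n. K i j"
    and "uv \<equiv> \<Sum>i<n. u i * v i" and "us \<equiv> \<Sum>i<n. u i" and "vs \<equiv> \<Sum>i<n. v i"
  shows "N * kappa_star n x y = HK / (N - 1) + N * h * k / (N * (N - 1))\<^sup>2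
    - 2 * (N * (hk - HK) / (N * (N - 1) * (N - 2)))
    - 2 * N / (N - 2) * ((uk / (N * (N - 1)) - us / N * k / (N * (N - 1)))
                        + (hv / (N * (N - 1)) - vs / N * h / (N * (N - 1))))
    + N / (N - 1) * (uv / N - us / N * (vs / N))"
proof -
  let ?A = "\<lambda>i j. \<bar>x i - x j\<bar>" and ?B = "\<lambda>i j. \<bar>y i - y j\<bar>"
  have a': "?A i j = u i + u j + m - 2 * H i j - (if j = i then 2 * u i + m else 0)" for i j
    by (auto simp: a H)
  have b': "?B i j = v i + v j + m' - 2 * K i j - (if j = i then 2 * v i + m' else 0)" for i j
    by (auto simp: b K)
  define hr where "hr i = (\<Sum>j<n. H i j)" for i
  define kr where "kr i = (\<Sum>j<n. K i j)" for i
  define c where "c = us + (N - 1) * m"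
  define d where "d = vs + (N - 1) * m'"
  have A1: "(\<Sum>j<n. ?A i j) = (N - 2) * u i + c - 2 * hr i" if "i < n" for i
    unfolding a' using that
    by (simp add: sum.distrib sum_subtractf us_def N_def c_def hr_def sum_distrib_left[symmetric])
       (simp add: algebra_simps)
  have B1: "(\<Sum>j<n. ?B i j) = (N - 2) * v i + d - 2 * kr i" if "i < n" for i
    unfolding b' using that
    by (simp add: sum.distrib sum_subtractf vs_def N_def d_def kr_def sum_distrib_left[symmetric])
       (simp add: algebra_simps)
  have sA: "(\<Sum>i<n. \<Sum>j<n. ?A i j) = (N - 2) * us + N * c - 2 * h"
  proof -
    have "(\<Sum>i<n. \<Sum>j<n. ?A i j) = (\<Sum>i<n. (N - 2) * u i + c - 2 * hr i)" using A1 by simp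
    then show ?thesis
      by (simp add: sum.distrib sum_subtractf us_def N_def h_def hr_def sum_distrib_left[symmetric])
  qed
  have sB: "(\<Sum>i<n. \<Sum>j<n. ?B i j) = (N - 2) * vs + N * d - 2 * k"
  proof -
    have "(\<Sum>i<n. \<Sum>j<n. ?B i j) = (\<Sum>i<n. (N - 2) * v i + d - 2 * kr i)" using B1 by simp
    then show ?thesis
      by (simp add: sum.distrib sum_subtractf vs_def N_def k_def kr_def sum_distrib_left[symmetric])
  qed
  have hv: "hv = (\<Sum>i<n. hr i * v i)" "uk = (\<Sum>i<n. kr i * u i)" "hk = (\<Sum>i<n. hr i * kr i)"
    "h = (\<Sum>i<n. hr i)" "k = (\<Sum>i<n. kr i)"
    by (simp_all add: hv_def uk_def hk_def h_def k_def hr_def kr_def sum_distrib_right)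
  have AB: "(\<Sum>i<n. (\<Sum>j<n. ?A i j) * (\<Sum>j<n. ?B i j))
     = (N - 2)\<^sup>2 * uv + (N - 2) * d * us - 2 * (N - 2) * uk + (N - 2) * c * vs + N * c * d - 2 * c * k
       - 2 * (N - 2) * hv - 2 * d * h + 4 * hk"
  proof -
    have "(\<Sum>i<n. (\<Sum>j<n. ?A i j) * (\<Sum>j<n. ?B i j))
      = (\<Sum>i<n. ((N - 2) * u i + c - 2 * hr i) * ((N - 2) * v i + d - 2 * kr i))" using A1 B1 by simp
    also have "\<dots> = (\<Sum>i<n. (N - 2)\<^sup>2 * (u i * v i) + (N - 2) * d * u i - 2 * (N - 2) * (kr i * u i)
        + (N - 2) * c * v i + c * d - 2 * c * kr i - 2 * (N - 2) * (hr i * v i) - 2 * d * hr i + 4 * (hr i * kr i))"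
      by (intro sum.cong refl) (simp add: power2_eq_square algebra_simps)
    finally show ?thesis
      by (simp add: sum.distrib sum_subtractf hv uv_def us_def vs_def N_def sum_distrib_left[symmetric])
  qed
  have A2: "(\<Sum>i<n. \<Sum>j<n. ?A i j * ?B i j)
     = 4 * HK - 4 * hv - 2 * m' * h - 4 * uk - 2 * m * k + 2 * (N - 2) * uv + 2 * us * vs
       + 2 * (N - 1) * (m' * us + m * vs) + N * (N - 1) * m * m'"
  proof -
    have swap: "(\<Sum>i<n. \<Sum>j<n. H i j * v j) = hv" "(\<Sum>i<n. \<Sum>j<n. K i j * u j) = uk"
      unfolding hv_def uk_def by (subst sum.swap, simp add: H(1) K(1))+
    have "?A i j * ?B i j = 4 * (H i j * K i j) - 2 * (H i j * v i) - 2 * (H i j * v j) - 2 * m' * H i j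
        - 2 * (K i j * u i) - 2 * (K i j * u j) - 2 * m * K i j + (u i + u j + m) * (v i + v j + m')
        - (if j = i then (2 * u i + m) * (2 * v i + m') else 0)" for i j
      by (auto simp: a b H(2) K(2) algebra_simps)
    then have "(\<Sum>i<n. \<Sum>j<n. ?A i j * ?B i j) = 4 * HK - 2 * hv - 2 * hv - 2 * m' * h - 2 * uk - 2 * uk - 2 * m * k
        + (\<Sum>i<n. \<Sum>j<n. (u i + u j + m) * (v i + v j + m')) - (\<Sum>i<n. (2 * u i + m) * (2 * v i + m'))"
      by (simp add: sum.distrib sum_subtractf sum_distrib_left[symmetric] swap HK_def h_def k_def
          hv_def[symmetric] uk_def[symmetric])
    also have "(\<Sum>i<n. \<Sum>j<n. (u i + u j + m) * (v i + v j + m'))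
       = 2 * N * uv + 2 * us * vs + 2 * N * (m' * us + m * vs) + N\<^sup>2 * m * m'"
    proof -
      have "(\<Sum>j<n. (u i + u j + m) * (v i + v j + m'))
         = N * (u i * v i) + u i * vs + N * m' * u i + us * v i + uv + m' * us + N * m * v i + m * vs + N * m * m'" for i
      proof -
        have "(\<Sum>j<n. (u i + u j + m) * (v i + v j + m'))
          = (\<Sum>j<n. u i * v i + u i * v j + m' * u i + v i * u j + u j * v j + m' * u j + m * v i + m * v j + m * m')"
          by (intro sum.cong refl) (simp add: algebra_simps)
        then show ?thesis
          by (simp add: sum.distrib sum_distrib_left[symmetric] N_def uv_def us_def vs_def)
      qed
      then have "(\<Sum>i<n. \<Sum>j<n. (u i + u j + m) * (v i + v j + m'))
        = (\<Sum>i<n. N * (u i * v i) + vs * u i + N * m' * u i + us * v i + uv + m' * us + N * m * v i + m * vs + N * m * m')"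
        by (simp add: mult.commute)
      then show ?thesis
        by (simp add: sum.distrib sum_distrib_left[symmetric] N_def uv_def[symmetric] us_def[symmetric] vs_def[symmetric]
            power2_eq_square algebra_simps)
    qed
    also have "(\<Sum>i<n. (2 * u i + m) * (2 * v i + m')) = 4 * uv + 2 * m' * us + 2 * m * vs + N * m * m'"
    proof -
      have "(\<Sum>i<n. (2 * u i + m) * (2 * v i + m')) = (\<Sum>i<n. 4 * (u i * v i) + 2 * m' * u i + 2 * m * v i + m * m')"
        by (intro sum.cong refl) (simp add: algebra_simps)
      then show ?thesis
        by (simp add: sum.distrib sum_distrib_left[symmetric] N_def uv_def us_def vs_def)
    qed
    finally show ?thesis by (simp add: power2_eq_square algebra_simps)
  qed
  have N: "N \<noteq> 0" "N - 1 \<noteq> 0" "N - 2 \<noteq> 0" using n by (auto simp: N_def)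
  show ?thesis
    unfolding kappa_star_eq N_def[symmetric] A2 sA sB AB c_def d_def
    using N by (simp add: divide_simps) algebra
qed

section \<open>Negligible terms of the estimator\<close>

context finite_variance_distribution
begin

lemma abs_diff_eq_ker: "\<bar>x - y\<bar> = ker x x + ker y y - 2 * ker x y"
proof -
  have i: "integrable lborel (\<lambda>t. centred_step t a * centred_step t b)" for a b
    by (rule integrable_centred_step_mult[of _ 1]) (auto simp: abs_centred_step_le_1)
  have "\<bar>x - y\<bar> = (\<integral>t. \<bar>step x t - step y t\<bar> \<partial>lborel)" by (simp add: integral_abs_step_diff)
  also have "\<dots> = (\<integral>t. centred_step t x * centred_step t x + centred_step t y * centred_step t y
      - 2 * (centred_step t x * centred_step t y) \<partial>lborel)"
  proof (rule Bochner_Integration.integral_cong[OF refl])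
    fix t
    have "\<bar>step x t - step y t\<bar> = (centred_step t x - centred_step t y)\<^sup>2"
      by (auto simp: centred_step_def step_def)
    then show "\<bar>step x t - step y t\<bar> = centred_step t x * centred_step t x + centred_step t y * centred_step t y
      - 2 * (centred_step t x * centred_step t y)" by (simp add: power2_eq_square algebra_simps)
  qed
  also have "\<dots> = ker x x + ker y y - 2 * ker x y" using i by (simp add: ker_eq)
  finally show ?thesis .
qed

text \<open>By \<open>abs_diff_eq_ker\<close> the distance is \<open>cdiag x + cdiag y + 2 * tr - 2 * ker x y\<close>: \<open>cdiag\<close> is its
  first order part, the centred mean distance from a point.\<close>

definition cdiag :: "real \<Rightarrow> real" where
  "cdiag x = ker x x - tr"

lemma measurable_cdiag [measurable]: "cdiag \<in> borel_measurable borel"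
  unfolding cdiag_def[abs_def] by measurable

lemma sqi_cdiag: "square_integrable F cdiag"
proof -
  have "square_integrable F (\<lambda>x. ker x x)"
    by (rule sqi_dominated[OF sqi_mean_dist]) (auto simp: abs_ker_le mean_dist_nonneg)
  then show ?thesis unfolding cdiag_def[abs_def] by (rule square_integrable_diff[OF _ sqi_const])
qed

lemma integral_cdiag: "(\<integral>x. cdiag x \<partial>F) = 0"
  using integrable_ker_diag by (simp add: cdiag_def tr_def)

end

lemma (in prob_space) indep_var_swap:
  assumes "indep_var S U T V" shows "indep_var T V S U"
proof -
  have UV: "U \<in> measurable M S" "V \<in> measurable M T"
    and eq: "distr M S U \<Otimes>\<^sub>M distr M T V = distr M (S \<Otimes>\<^sub>M T) (\<lambda>\<omega>. (U \<omega>, V \<omega>))"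
    using assms by (auto simp: indep_var_distribution_eq)
  interpret U: prob_space "distr M S U" by (rule prob_space_distr[OF UV(1)])
  interpret V: prob_space "distr M T V" by (rule prob_space_distr[OF UV(2)])
  interpret P: pair_sigma_finite "distr M T V" "distr M S U" ..
  have "distr M T V \<Otimes>\<^sub>M distr M S U
      = distr (distr M (S \<Otimes>\<^sub>M T) (\<lambda>\<omega>. (U \<omega>, V \<omega>))) (distr M T V \<Otimes>\<^sub>M distr M S U) (\<lambda>(x, y). (y, x))"
    unfolding eq[symmetric] by (rule P.distr_pair_swap)
  also have "\<dots> = distr (distr M (S \<Otimes>\<^sub>M T) (\<lambda>\<omega>. (U \<omega>, V \<omega>))) (T \<Otimes>\<^sub>M S) (\<lambda>(x, y). (y, x))"
    by (rule distr_cong) (auto intro!: sets_pair_measure_cong)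
  also have "\<dots> = distr M (T \<Otimes>\<^sub>M S) (\<lambda>\<omega>. (V \<omega>, U \<omega>))"
    using UV by (subst distr_distr) (auto simp: o_def)
  finally show ?thesis using UV by (simp add: indep_var_distribution_eq)
qed

context iid_sample
begin

definition seq_off :: "nat \<Rightarrow> nat \<Rightarrow> (nat \<Rightarrow> real) \<Rightarrow> real" where
  "seq_off i j x = (if i = j then 0 else ker (x i) (x j))"

lemma measurable_seq_off [measurable]: "seq_off i j \<in> borel_measurable (PiM UNIV (\<lambda>_. borel))"
  unfolding seq_off_def[abs_def] by (intro measurable_If measurable_ker) auto

lemma seq_off_X: "seq_off i j (\<lambda>k. X k \<omega>) = off i j \<omega>"
  by (simp add: seq_off_def off_def)

lemma off_norm_le: "l2_inner M (off i j) (off i j) \<le> ker_sq"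
  using off_square(2)[of i j] ker_sq_nonneg
  by (cases "i = j") (auto simp: l2_inner_self off_def[abs_def])

lemma ker_X_moment: "integrable M (\<lambda>\<omega>. ker (X i \<omega>) (X j \<omega>))" (is ?i)
  "(\<integral>\<omega>. ker (X i \<omega>) (X j \<omega>) \<partial>M) = (if i = j then tr else 0)" (is ?m)
proof -
  have "?i \<and> ?m"
  proof (cases "i = j")
    case True
    then show ?thesis
      using integrable_X[of "\<lambda>x. ker x x" i] integral_X[of "\<lambda>x. ker x x" i] integrable_ker_diag
      by (simp add: tr_def)
  next
    case False
    have i: ?i
      using square_integrable_mult[OF sqi_off[of i j], of "\<lambda>_. 1"] False
      by (simp add: square_integrable_def off_def)
    have "(\<integral>\<omega>. (\<lambda>p. ker (fst p) (snd p)) (X i \<omega>, X j \<omega>) \<partial>M) = 0"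
    proof (rule M.indep_var_integral_zero[OF indep_pair[OF False]])
      show "(\<integral>\<omega>. (\<lambda>p. ker (fst p) (snd p)) (X i \<omega>, v) \<partial>M) = 0" for v
        using integral_X[of "\<lambda>x. ker x v" i] by (simp add: integral_ker_left)
    qed (use i in auto)
    then show ?thesis using i False by simp
  qed
  then show ?i ?m by auto
qed

text \<open>The terms of one row are orthogonal. The resulting factor \<open>n\<close>, in place of the \<open>n\<^sup>2\<close> of
  \<open>bilinear_form_second_moment\<close>, is what makes the three-point part of the estimator negligible.\<close>

lemma row_sum_second_moment:
  fixes c :: "nat \<Rightarrow> real"
  assumes c: "\<And>k. \<bar>c k\<bar> \<le> 1"
  shows "square_integrable M (\<lambda>\<omega>. \<Sum>k<n. c k * off i k \<omega>)"
    and "l2_inner M (\<lambda>\<omega>. \<Sum>k<n. c k * off i k \<omega>) (\<lambda>\<omega>. \<Sum>k<n. c k * off i k \<omega>) \<le> ker_sq * real n"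
proof -
  show s: "square_integrable M (\<lambda>\<omega>. \<Sum>k<n. c k * off i k \<omega>)"
    by (rule square_integrable_sum[OF sqi_off])
  have orth: "l2_inner M (off i l) (off i k) = 0" if "k \<noteq> l" for k l
  proof (cases "i = k")
    case True
    then show ?thesis by (simp add: l2_inner_def off_def)
  next
    case False
    then show ?thesis using off_orthogonal[of i k i l] that by (auto simp: l2_inner_def mult.commute)
  qed
  have inner: "l2_inner M (off i k) (\<lambda>\<omega>. \<Sum>k<n. c k * off i k \<omega>) = c k * l2_inner M (off i k) (off i k)" if "k < n" for k
  proof -
    have "l2_inner M (off i k) (\<lambda>\<omega>. \<Sum>k<n. c k * off i k \<omega>) = (\<Sum>l<n. c l * l2_inner M (off i l) (off i k))"
      unfolding l2_inner_commute[of M "off i k"] by (rule l2_inner_sum[OF sqi_off sqi_off])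
    also have "\<dots> = (\<Sum>l<n. if l = k then c k * l2_inner M (off i k) (off i k) else 0)"
      using orth by (intro sum.cong) auto
    finally show ?thesis using that by simp
  qed
  have "l2_inner M (\<lambda>\<omega>. \<Sum>k<n. c k * off i k \<omega>) (\<lambda>\<omega>. \<Sum>k<n. c k * off i k \<omega>)
    = (\<Sum>k<n. c k * l2_inner M (off i k) (\<lambda>\<omega>. \<Sum>k<n. c k * off i k \<omega>))"
    by (rule l2_inner_sum[OF sqi_off s])
  also have "\<dots> = (\<Sum>k<n. (c k)\<^sup>2 * l2_inner M (off i k) (off i k))"
    using inner by (simp add: power2_eq_square mult.assoc)
  also have "\<dots> \<le> (\<Sum>k<n. 1 * ker_sq)"
    using c by (intro sum_mono mult_mono off_norm_le) (auto simp: abs_square_le_1 l2_inner_self_nonneg)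
  finally show "l2_inner M (\<lambda>\<omega>. \<Sum>k<n. c k * off i k \<omega>) (\<lambda>\<omega>. \<Sum>k<n. c k * off i k \<omega>) \<le> ker_sq * real n" by (simp add: mult.commute)
qed

lemma sqi_X:
  assumes u: "square_integrable F u"
  shows "square_integrable M (\<lambda>\<omega>. u (X i \<omega>))" "l2_inner M (\<lambda>\<omega>. u (X i \<omega>)) (\<lambda>\<omega>. u (X i \<omega>)) = l2_inner F u u"
  using u sqi_borel[OF u] integrable_X[of "\<lambda>x. (u x)\<^sup>2" i] integral_X[of "\<lambda>x. (u x)\<^sup>2" i]
  by (auto simp: square_integrable_def l2_inner_self)

end

locale two_samples = P: iid_sample M F1 X + Q: iid_sample M F2 Y
  for M :: "'a measure" and F1 X F2 Y +
  assumes indep_XY: "P.M.indep_var (PiM UNIV (\<lambda>_. borel)) (\<lambda>\<omega> i. X i \<omega>) (PiM UNIV (\<lambda>_. borel)) (\<lambda>\<omega> i. Y i \<omega>)"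
begin

lemma indep_YX: "P.M.indep_var (PiM UNIV (\<lambda>_. borel)) (\<lambda>\<omega> i. Y i \<omega>) (PiM UNIV (\<lambda>_. borel)) (\<lambda>\<omega> i. X i \<omega>)"
  by (rule P.M.indep_var_swap[OF indep_XY])

lemma two_samples_swap: "two_samples M F2 Y F1 X"
  by unfold_locales (rule indep_YX)

lemma bilinear_null:
  fixes c :: "nat \<Rightarrow> real" and b :: "nat \<Rightarrow> nat \<Rightarrow> nat \<Rightarrow> (nat \<Rightarrow> real) \<Rightarrow> real"
  assumes bm: "\<And>n i j. b n i j \<in> borel_measurable (PiM UNIV (\<lambda>_. borel))"
    and bsq: "\<And>n i j. square_integrable M (\<lambda>\<omega>. b n i j (\<lambda>k. X k \<omega>))"
    and t: "\<And>n i j. l2_inner M (\<lambda>\<omega>. b n i j (\<lambda>k. X k \<omega>)) (\<lambda>\<omega>. b n i j (\<lambda>k. X k \<omega>)) \<le> C * r n"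
    and lim: "(\<lambda>n. (c n)\<^sup>2 * (r n * (real n)\<^sup>2)) \<longlonglongrightarrow> 0"
  shows "P.M.l2_null (\<lambda>n \<omega>. c n * (\<Sum>i<n. \<Sum>j<n. b n i j (\<lambda>k. X k \<omega>) * Q.off i j \<omega>))"
proof (rule P.M.l2_null_scaled[OF _ _ lim])
  fix n
  have b2: "integrable M (\<lambda>\<omega>. (b n i j (\<lambda>k. X k \<omega>))\<^sup>2)" for i j
    using bsq by (simp add: square_integrable_def)
  note * = Q.bilinear_form_second_moment[OF indep_XY, of "b n" "C * r n" n, OF bm b2 t[unfolded l2_inner_self]]
  show "square_integrable M (\<lambda>\<omega>. \<Sum>i<n. \<Sum>j<n. b n i j (\<lambda>k. X k \<omega>) * Q.off i j \<omega>)"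
    by (rule *(1))
  show "l2_inner M (\<lambda>\<omega>. \<Sum>i<n. \<Sum>j<n. b n i j (\<lambda>k. X k \<omega>) * Q.off i j \<omega>) (\<lambda>\<omega>. \<Sum>i<n. \<Sum>j<n. b n i j (\<lambda>k. X k \<omega>) * Q.off i j \<omega>)
      \<le> 2 * Q.ker_sq * C * (r n * (real n)\<^sup>2)"
    using *(2) by (simp add: mult_ac)
qed

lemma linear_null:
  fixes c :: "nat \<Rightarrow> real" and b :: "nat \<Rightarrow> nat \<Rightarrow> (nat \<Rightarrow> real) \<Rightarrow> real"
  assumes bm: "\<And>n i. b n i \<in> borel_measurable (PiM UNIV (\<lambda>_. borel))"
    and bsq: "\<And>n i. square_integrable M (\<lambda>\<omega>. b n i (\<lambda>k. X k \<omega>))"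
    and t: "\<And>n i. l2_inner M (\<lambda>\<omega>. b n i (\<lambda>k. X k \<omega>)) (\<lambda>\<omega>. b n i (\<lambda>k. X k \<omega>)) \<le> C * r n"
    and lim: "(\<lambda>n. (c n)\<^sup>2 * (r n * real n)) \<longlonglongrightarrow> 0"
  shows "P.M.l2_null (\<lambda>n \<omega>. c n * (\<Sum>i<n. b n i (\<lambda>k. X k \<omega>) * Q.cdiag (Y i \<omega>)))"
proof (rule P.M.l2_null_scaled[OF _ _ lim])
  fix n
  have b2: "integrable M (\<lambda>\<omega>. (b n i (\<lambda>k. X k \<omega>))\<^sup>2)" for i
    using bsq by (simp add: square_integrable_def)
  note * = Q.linear_form_second_moment[OF indep_XY Q.sqi_cdiag Q.integral_cdiag, of "b n" "C * r n" n,
      OF bm b2 t[unfolded l2_inner_self]]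
  show "square_integrable M (\<lambda>\<omega>. \<Sum>i<n. b n i (\<lambda>k. X k \<omega>) * Q.cdiag (Y i \<omega>))"
    by (rule *(1))
  show "l2_inner M (\<lambda>\<omega>. \<Sum>i<n. b n i (\<lambda>k. X k \<omega>) * Q.cdiag (Y i \<omega>)) (\<lambda>\<omega>. \<Sum>i<n. b n i (\<lambda>k. X k \<omega>) * Q.cdiag (Y i \<omega>))
      \<le> l2_inner F2 Q.cdiag Q.cdiag * C * (r n * real n)"
    using *(2) by (simp add: mult_ac)
qed

definition wt :: "nat \<Rightarrow> real" where
  "wt n = 1 / (real n * (real n - 1))"

definition usum :: "nat \<Rightarrow> 'a \<Rightarrow> real" where "usum n \<omega> = (\<Sum>i<n. P.cdiag (X i \<omega>))"
definition hsum :: "nat \<Rightarrow> 'a \<Rightarrow> real" where "hsum n \<omega> = (\<Sum>i<n. \<Sum>j<n. P.off i j \<omega>)"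
definition vsum :: "nat \<Rightarrow> 'a \<Rightarrow> real" where "vsum n \<omega> = (\<Sum>i<n. Q.cdiag (Y i \<omega>))"
definition ksum :: "nat \<Rightarrow> 'a \<Rightarrow> real" where "ksum n \<omega> = (\<Sum>i<n. \<Sum>j<n. Q.off i j \<omega>)"

lemma usum_moment: "square_integrable M (usum n)" "l2_inner M (usum n) (usum n) \<le> l2_inner F1 P.cdiag P.cdiag * real n"
  using P.linear_form_second_moment[OF indep_YX P.sqi_cdiag P.integral_cdiag, of "\<lambda>_ _. 1" 1 n]
  by (simp_all add: usum_def[abs_def] P.M.prob_space)

lemma hsum_moment: "square_integrable M (hsum n)" "l2_inner M (hsum n) (hsum n) \<le> 2 * P.ker_sq * (real n)\<^sup>2"
  using P.bilinear_form_second_moment[OF indep_YX, of "\<lambda>_ _ _. 1" 1 n]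
  by (simp_all add: hsum_def[abs_def] P.M.prob_space)

text \<open>The remainder terms of \<open>kappa_star_expansion\<close>, each a bilinear form in the kernel of \<open>Y\<close> or a
  linear form in its diagonal with coefficients depending on \<open>X\<close> only. Terms with the roles of the
  samples exchanged follow by symmetry.\<close>

lemma null_products:
  shows "P.M.l2_null (\<lambda>n \<omega>. wt n * (\<Sum>i<n. \<Sum>j<n. P.off i j \<omega> * Q.off i j \<omega>))" (is ?HK)
    and "P.M.l2_null (\<lambda>n \<omega>. real n * hsum n \<omega> * ksum n \<omega> * (wt n)\<^sup>2)" (is ?hk)
    and "P.M.l2_null (\<lambda>n \<omega>. real n * wt n / (real n - 2) * ((\<Sum>i<n. (\<Sum>j<n. P.off i j \<omega>) * (\<Sum>j<n. Q.off i j \<omega>))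
        - (\<Sum>i<n. \<Sum>j<n. P.off i j \<omega> * Q.off i j \<omega>)))" (is ?S3)
    and "P.M.l2_null (\<lambda>n \<omega>. wt n * (\<Sum>i<n. \<Sum>j<n. Q.off i j \<omega> * P.cdiag (X i \<omega>)))" (is ?uk)
    and "P.M.l2_null (\<lambda>n \<omega>. usum n \<omega> / real n * ksum n \<omega> * wt n)" (is ?usk)
    and "P.M.l2_null (\<lambda>n \<omega>. (\<Sum>i<n. P.cdiag (X i \<omega>) * Q.cdiag (Y i \<omega>)) / real n)" (is ?uv)
    and "P.M.l2_null (\<lambda>n \<omega>. usum n \<omega> / real n * (vsum n \<omega> / real n))" (is ?usvs)
    and "P.M.l2_null (\<lambda>n \<omega>. vsum n \<omega> / real n)" (is ?vs)
proof -
  have row: "square_integrable M (\<lambda>\<omega>. \<Sum>k<n. (if k = j then 0 else 1) * P.off i k \<omega>)"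
    "l2_inner M (\<lambda>\<omega>. \<Sum>k<n. (if k = j then 0 else 1) * P.off i k \<omega>) (\<lambda>\<omega>. \<Sum>k<n. (if k = j then 0 else 1) * P.off i k \<omega>)
       \<le> P.ker_sq * real n" for n i j
    using P.row_sum_second_moment[of "\<lambda>k. if k = j then 0 else 1" i n] by simp_all
  note h = hsum_moment[unfolded hsum_def[abs_def]] and u = usum_moment[unfolded usum_def[abs_def]]
  have "P.M.l2_null (\<lambda>n \<omega>. wt n * (\<Sum>i<n. \<Sum>j<n. P.seq_off i j (\<lambda>k. X k \<omega>) * Q.off i j \<omega>))"
  proof (rule bilinear_null[where b = "\<lambda>n. P.seq_off" and C = P.ker_sq and r = "\<lambda>_. 1"], unfold P.seq_off_X)
    show "(\<lambda>n. (wt n)\<^sup>2 * (1 * (real n)\<^sup>2)) \<longlonglongrightarrow> 0" unfolding wt_def by real_asymp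
  qed (simp_all add: P.sqi_off P.off_norm_le)
  then show ?HK by (simp only: P.seq_off_X)
  have "P.M.l2_null (\<lambda>n \<omega>. (real n * (wt n)\<^sup>2) * (\<Sum>i<n. \<Sum>j<n. (\<Sum>i<n. \<Sum>j<n. P.seq_off i j (\<lambda>k. X k \<omega>)) * Q.off i j \<omega>))"
  proof (rule bilinear_null[where b = "\<lambda>n i j x. \<Sum>i<n. \<Sum>j<n. P.seq_off i j x" and C = "2 * P.ker_sq" and r = "\<lambda>n. (real n)\<^sup>2"], unfold P.seq_off_X)
    show "(\<lambda>n. (real n * (wt n)\<^sup>2)\<^sup>2 * ((real n)\<^sup>2 * (real n)\<^sup>2)) \<longlonglongrightarrow> 0" unfolding wt_def by real_asymp
  qed (measurable, rule h, rule h)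
  moreover have "(real n * (wt n)\<^sup>2) * (\<Sum>i<n. \<Sum>j<n. (\<Sum>i<n. \<Sum>j<n. P.off i j \<omega>) * Q.off i j \<omega>)
      = real n * hsum n \<omega> * ksum n \<omega> * (wt n)\<^sup>2" for n \<omega>
    by (simp only: hsum_def[symmetric] sum_distrib_left[symmetric] ksum_def[symmetric]) simp
  ultimately show ?hk by (simp only: P.seq_off_X)
  have "P.M.l2_null (\<lambda>n \<omega>. (real n * wt n / (real n - 2))
      * (\<Sum>i<n. \<Sum>j<n. (\<Sum>k<n. (if k = j then 0 else 1) * P.seq_off i k (\<lambda>k. X k \<omega>)) * Q.off i j \<omega>))"
  proof (rule bilinear_null[where b = "\<lambda>n i j x. \<Sum>k<n. (if k = j then 0 else 1) * P.seq_off i k x" and C = P.ker_sq and r = real], unfold P.seq_off_X)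
    show "(\<lambda>n. (real n * wt n / (real n - 2))\<^sup>2 * (real n * (real n)\<^sup>2)) \<longlonglongrightarrow> 0" unfolding wt_def by real_asymp
  qed (measurable, rule row, rule row)
  moreover have "(\<Sum>i<n. \<Sum>j<n. (\<Sum>k<n. (if k = j then 0 else 1) * P.off i k \<omega>) * Q.off i j \<omega>)
    = (\<Sum>i<n. (\<Sum>j<n. P.off i j \<omega>) * (\<Sum>j<n. Q.off i j \<omega>)) - (\<Sum>i<n. \<Sum>j<n. P.off i j \<omega> * Q.off i j \<omega>)" for n \<omega>
  proof -
    have "(\<Sum>k<n. (if k = j then 0 else 1) * P.off i k \<omega>) = (\<Sum>k<n. P.off i k \<omega>) - P.off i j \<omega>" if "j < n" for i j
    proof -
      have "(\<Sum>k<n. (if k = j then 0 else 1) * P.off i k \<omega>) = (\<Sum>k<n. P.off i k \<omega> - (if k = j then P.off i j \<omega> else 0))"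
        by (intro sum.cong) auto
      then show ?thesis using that by (simp add: sum_subtractf)
    qed
    then have "(\<Sum>i<n. \<Sum>j<n. (\<Sum>k<n. (if k = j then 0 else 1) * P.off i k \<omega>) * Q.off i j \<omega>)
      = (\<Sum>i<n. \<Sum>j<n. ((\<Sum>k<n. P.off i k \<omega>) - P.off i j \<omega>) * Q.off i j \<omega>)"
      by (intro sum.cong refl) (simp only: lessThan_iff)
    then show ?thesis by (simp only: left_diff_distrib sum_subtractf sum_distrib_left)
  qed
  ultimately show ?S3 by (simp only: P.seq_off_X)
  have "P.M.l2_null (\<lambda>n \<omega>. wt n * (\<Sum>i<n. \<Sum>j<n. P.cdiag (X i \<omega>) * Q.off i j \<omega>))"
  proof (rule bilinear_null[where b = "\<lambda>n i j x. P.cdiag (x i)" and C = "l2_inner F1 P.cdiag P.cdiag" and r = "\<lambda>_. 1"])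
    show "(\<lambda>n. (wt n)\<^sup>2 * (1 * (real n)\<^sup>2)) \<longlonglongrightarrow> 0" unfolding wt_def by real_asymp
  qed (simp_all add: P.sqi_X[OF P.sqi_cdiag])
  then show ?uk by (simp only: mult.commute)
  have "P.M.l2_null (\<lambda>n \<omega>. (wt n / real n) * (\<Sum>i<n. \<Sum>j<n. (\<Sum>l<n. P.cdiag (X l \<omega>)) * Q.off i j \<omega>))"
  proof (rule bilinear_null[where b = "\<lambda>n i j x. \<Sum>l<n. P.cdiag (x l)" and C = "l2_inner F1 P.cdiag P.cdiag" and r = real])
    show "(\<lambda>n. (wt n / real n)\<^sup>2 * (real n * (real n)\<^sup>2)) \<longlonglongrightarrow> 0" unfolding wt_def by real_asymp
  qed (measurable, rule u, rule u)
  moreover have "(wt n / real n) * (\<Sum>i<n. \<Sum>j<n. (\<Sum>l<n. P.cdiag (X l \<omega>)) * Q.off i j \<omega>)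
      = usum n \<omega> / real n * ksum n \<omega> * wt n" for n \<omega>
    by (simp only: usum_def[symmetric] sum_distrib_left[symmetric] ksum_def[symmetric]) simp
  ultimately show ?usk by (simp only:)
  have "P.M.l2_null (\<lambda>n \<omega>. (1 / real n) * (\<Sum>i<n. P.cdiag (X i \<omega>) * Q.cdiag (Y i \<omega>)))"
  proof (rule linear_null[where b = "\<lambda>n i x. P.cdiag (x i)" and C = "l2_inner F1 P.cdiag P.cdiag" and r = "\<lambda>_. 1"])
    show "(\<lambda>n. (1 / real n)\<^sup>2 * (1 * real n)) \<longlonglongrightarrow> 0" by real_asymp
  qed (simp_all add: P.sqi_X[OF P.sqi_cdiag])
  then show ?uv by simp
  have "P.M.l2_null (\<lambda>n \<omega>. (1 / (real n)\<^sup>2) * (\<Sum>i<n. (\<Sum>l<n. P.cdiag (X l \<omega>)) * Q.cdiag (Y i \<omega>)))"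
  proof (rule linear_null[where b = "\<lambda>n i x. \<Sum>l<n. P.cdiag (x l)" and C = "l2_inner F1 P.cdiag P.cdiag" and r = real])
    show "(\<lambda>n. (1 / (real n)\<^sup>2)\<^sup>2 * (real n * real n)) \<longlonglongrightarrow> 0" by real_asymp
  qed (measurable, rule u, rule u)
  moreover have "(1 / (real n)\<^sup>2) * (\<Sum>i<n. (\<Sum>l<n. P.cdiag (X l \<omega>)) * Q.cdiag (Y i \<omega>))
      = usum n \<omega> / real n * (vsum n \<omega> / real n)" for n \<omega>
    by (simp only: usum_def[symmetric] sum_distrib_left[symmetric] vsum_def[symmetric]) (simp add: power2_eq_square)
  ultimately show ?usvs by (simp only:)
  have "P.M.l2_null (\<lambda>n \<omega>. (1 / real n) * (\<Sum>i<n. 1 * Q.cdiag (Y i \<omega>)))"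
  proof (rule linear_null[where b = "\<lambda>n i x. 1" and C = 1 and r = "\<lambda>_. 1"])
    show "(\<lambda>n. (1 / real n)\<^sup>2 * (1 * real n)) \<longlonglongrightarrow> 0" by real_asymp
  qed (simp_all add: square_integrable_def l2_inner_def P.M.prob_space)
  then show ?vs by (simp add: vsum_def)
qed

end

context two_samples
begin

definition vstat :: "nat \<Rightarrow> 'a \<Rightarrow> real" where
  "vstat n \<omega> = (\<Sum>i<n. \<Sum>j<n. P.ker (X i \<omega>) (X j \<omega>) * Q.ker (Y i \<omega>) (Y j \<omega>)) / real n"

text \<open>Including the diagonal makes the V-statistic nonnegative, so that Laplace transforms apply to it.
  The fluctuations of the diagonal around \<open>P.tr * Q.tr\<close> are negligible by the law of large numbers.\<close>

lemma kappa_star_approx: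
  "\<exists>E. P.M.l2_null E \<and> (\<forall>n\<ge>3. \<forall>\<omega>. real n * kappa_star n (\<lambda>i. X i \<omega>) (\<lambda>i. Y i \<omega>)
      = vstat n \<omega> - P.tr * Q.tr + E n \<omega>)"
proof -
  interpret S: two_samples M F2 Y F1 X by (rule two_samples_swap)
  have Ssum: "S.usum = vsum" "S.vsum = usum" "S.ksum = hsum" "S.hsum = ksum"
    by (simp_all add: fun_eq_iff S.usum_def S.vsum_def S.hsum_def S.ksum_def usum_def vsum_def hsum_def ksum_def)
  define HK where "HK n \<omega> = (\<Sum>i<n. \<Sum>j<n. P.off i j \<omega> * Q.off i j \<omega>)" for n \<omega>
  define hk where "hk n \<omega> = (\<Sum>i<n. (\<Sum>j<n. P.off i j \<omega>) * (\<Sum>j<n. Q.off i j \<omega>))" for n \<omega>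
  define hv where "hv n \<omega> = (\<Sum>i<n. \<Sum>j<n. P.off i j \<omega> * Q.cdiag (Y i \<omega>))" for n \<omega>
  define uk where "uk n \<omega> = (\<Sum>i<n. \<Sum>j<n. Q.off i j \<omega> * P.cdiag (X i \<omega>))" for n \<omega>
  define uv where "uv n \<omega> = (\<Sum>i<n. P.cdiag (X i \<omega>) * Q.cdiag (Y i \<omega>))" for n \<omega>
  note n = null_products[folded HK_def hk_def uk_def uv_def]
  note nS = S.null_products(4,5,8)[unfolded Ssum, folded hv_def]
  define r where "r n \<omega> = (wt n * uk n \<omega> - usum n \<omega> / real n * ksum n \<omega> * wt n)
      + (wt n * hv n \<omega> - vsum n \<omega> / real n * hsum n \<omega> * wt n)" for n \<omega>
  define E where "E n \<omega> = real n * hsum n \<omega> * ksum n \<omega> * (wt n)\<^sup>2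
     - 2 * (real n * wt n / (real n - 2) * (hk n \<omega> - HK n \<omega>))
     - 2 * real n / (real n - 2) * r n \<omega>
     + real n / (real n - 1) * (uv n \<omega> / real n - usum n \<omega> / real n * (vsum n \<omega> / real n))
     + wt n * HK n \<omega> - uv n \<omega> / real n - P.tr * (vsum n \<omega> / real n) - Q.tr * (usum n \<omega> / real n)" for n \<omega>
  have r: "P.M.l2_null r"
    unfolding r_def[abs_def] by (intro P.M.l2_null_add P.M.l2_null_diff n nS)
  \<comment> \<open>Division by zero gives zero at \<open>n = 2\<close>; the same holds for the next bound at \<open>n = 1\<close>.\<close>
  have b1: "\<bar>2 * real n / (real n - 2)\<bar> \<le> 6" for n
  proof (cases "n < 3")
    case True
    then have "n = 0 \<or> n = 1 \<or> n = 2" by auto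
    then show ?thesis by auto
  next
    case False
    then show ?thesis by (simp add: field_simps)
  qed
  have b2: "\<bar>real n / (real n - 1)\<bar> \<le> 2" for n
  proof (cases "n < 2")
    case True
    then have "n = 0 \<or> n = 1" by auto
    then show ?thesis by auto
  next
    case False
    then show ?thesis by (simp add: field_simps)
  qed
  have null: "P.M.l2_null E"
    unfolding E_def[abs_def]
    by (intro P.M.l2_null_add P.M.l2_null_diff n nS
        P.M.l2_null_cmult[where c = "\<lambda>_. 2" and C = 2]
        P.M.l2_null_cmult[where c = "\<lambda>_. P.tr" and C = "\<bar>P.tr\<bar>"]
        P.M.l2_null_cmult[where c = "\<lambda>_. Q.tr" and C = "\<bar>Q.tr\<bar>"]
        P.M.l2_null_cmult[where c = "\<lambda>n. 2 * real n / (real n - 2)", OF r b1]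
        P.M.l2_null_cmult[where c = "\<lambda>n. real n / (real n - 1)", OF _ b2]) auto
  have "real n * kappa_star n (\<lambda>i. X i \<omega>) (\<lambda>i. Y i \<omega>) = vstat n \<omega> - P.tr * Q.tr + E n \<omega>" if n3: "3 \<le> n" for n \<omega>
  proof -
    have a: "\<bar>X i \<omega> - X j \<omega>\<bar> = (if i = j then 0 else P.cdiag (X i \<omega>) + P.cdiag (X j \<omega>) + 2 * P.tr - 2 * P.off i j \<omega>)" for i j
      by (auto simp: P.abs_diff_eq_ker P.cdiag_def P.off_def)
    have b: "\<bar>Y i \<omega> - Y j \<omega>\<bar> = (if i = j then 0 else Q.cdiag (Y i \<omega>) + Q.cdiag (Y j \<omega>) + 2 * Q.tr - 2 * Q.off i j \<omega>)" for i j
      by (auto simp: Q.abs_diff_eq_ker Q.cdiag_def Q.off_def)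
    have N: "real n \<noteq> 0" "real n - 1 \<noteq> 0" "real n - 2 \<noteq> 0" using n3 by auto
    have 1: "real n * kappa_star n (\<lambda>i. X i \<omega>) (\<lambda>i. Y i \<omega>) = HK n \<omega> / (real n - 1)
        + real n * hsum n \<omega> * ksum n \<omega> / (real n * (real n - 1))\<^sup>2
      - 2 * (real n * (hk n \<omega> - HK n \<omega>) / (real n * (real n - 1) * (real n - 2)))
      - 2 * real n / (real n - 2) * ((uk n \<omega> / (real n * (real n - 1)) - usum n \<omega> / real n * ksum n \<omega> / (real n * (real n - 1)))
                          + (hv n \<omega> / (real n * (real n - 1)) - vsum n \<omega> / real n * hsum n \<omega> / (real n * (real n - 1))))
      + real n / (real n - 1) * (uv n \<omega> / real n - usum n \<omega> / real n * (vsum n \<omega> / real n))"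
      unfolding HK_def hk_def hv_def uk_def uv_def usum_def vsum_def hsum_def ksum_def
      by (rule kappa_star_expansion[OF n3 a b P.off_commute _ Q.off_commute]) (simp_all add: P.off_def Q.off_def)
    have 2: "vstat n \<omega> = (HK n \<omega> + uv n \<omega> + P.tr * vsum n \<omega> + Q.tr * usum n \<omega> + real n * (P.tr * Q.tr)) / real n"
    proof -
      have "P.ker (X i \<omega>) (X j \<omega>) * Q.ker (Y i \<omega>) (Y j \<omega>) = P.off i j \<omega> * Q.off i j \<omega>
        + (if j = i then (P.cdiag (X i \<omega>) + P.tr) * (Q.cdiag (Y i \<omega>) + Q.tr) else 0)" for i j
        by (auto simp: P.off_def Q.off_def P.cdiag_def Q.cdiag_def)
      then have "(\<Sum>i<n. \<Sum>j<n. P.ker (X i \<omega>) (X j \<omega>) * Q.ker (Y i \<omega>) (Y j \<omega>))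
        = HK n \<omega> + (\<Sum>i<n. (P.cdiag (X i \<omega>) + P.tr) * (Q.cdiag (Y i \<omega>) + Q.tr))"
        by (simp add: sum.distrib HK_def)
      also have "(\<Sum>i<n. (P.cdiag (X i \<omega>) + P.tr) * (Q.cdiag (Y i \<omega>) + Q.tr))
         = (\<Sum>i<n. P.cdiag (X i \<omega>) * Q.cdiag (Y i \<omega>) + P.tr * Q.cdiag (Y i \<omega>) + Q.tr * P.cdiag (X i \<omega>) + P.tr * Q.tr)"
        by (intro sum.cong refl) (simp add: algebra_simps)
      finally show ?thesis
        by (simp add: vstat_def sum.distrib uv_def usum_def vsum_def sum_distrib_left)
    qed
    have 3: "HK n \<omega> / (real n - 1) = HK n \<omega> / real n + wt n * HK n \<omega>"
      using N by (simp add: wt_def field_simps)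
    show ?thesis
      unfolding 1 2 3 E_def r_def using N by (simp add: wt_def power_divide add_divide_distrib diff_divide_distrib)
  qed
  then show ?thesis using null by blast
qed

end

section \<open>Truncation and the limit law\<close>

lemma (in prob_space) expectation_iexp:
  assumes [measurable]: "U \<in> borel_measurable M"
  shows "(CLINT \<omega>|M. iexp (U \<omega>)) = Complex (expectation (\<lambda>\<omega>. cos (U \<omega>))) (expectation (\<lambda>\<omega>. sin (U \<omega>)))"
proof -
  have i: "integrable M (\<lambda>\<omega>. iexp (U \<omega>))" by (rule integrable_const_bound[of _ 1]) auto
  show ?thesis
    using integral_Re[OF i] integral_Im[OF i] by (simp add: complex_eq_iff Re_exp Im_exp)
qed

locale bergsma_pair = two_samples M F1 X F2 Y + SX: bergsma_spectrum F1 lam + SY: bergsma_spectrum F2 eta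
  for M :: "'a measure" and F1 X F2 Y lam eta +
  assumes indep_pairs: "P.M.indep_vars (\<lambda>_. borel \<Otimes>\<^sub>M borel) (\<lambda>i \<omega>. (X i \<omega>, Y i \<omega>)) UNIV"
begin

definition vtrunc :: "nat \<Rightarrow> nat \<Rightarrow> 'a \<Rightarrow> real" where
  "vtrunc K n \<omega> = (\<Sum>p\<in>{..<K} \<times> {..<K}. (\<Sum>i<n. SX.feature (fst p) (X i \<omega>) * SY.feature (snd p) (Y i \<omega>))\<^sup>2) / real n"

text \<open>Both factors of the kernel dominate their truncations in the sense of positive
  semidefiniteness, and products of positive semidefinite kernels are positive semidefinite.\<close>

lemma vtrunc_le_vstat: "vtrunc K n \<omega> \<le> vstat n \<omega>"
proof -
  let ?x = "\<lambda>i. X i \<omega>" and ?y = "\<lambda>i. Y i \<omega>"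
  let ?p = "\<lambda>k i. SX.feature k (?x i)" and ?q = "\<lambda>l i. SY.feature l (?y i)"
  have "(\<Sum>p\<in>{..<K} \<times> {..<K}. (\<Sum>i<n. ?p (fst p) i * ?q (snd p) i)\<^sup>2)
      = (\<Sum>k<K. \<Sum>l<K. (\<Sum>i<n. ?p k i * ?q l i)\<^sup>2)"
    by (simp add: sum.cartesian_product case_prod_unfold)
  also have "\<dots> = (\<Sum>k<K. \<Sum>l<K. \<Sum>i<n. \<Sum>j<n. ?p k i * ?p k j * (?q l i * ?q l j))"
    by (simp add: power2_eq_square sum_product mult_ac)
  also have "\<dots> = (\<Sum>k<K. \<Sum>i<n. \<Sum>l<K. \<Sum>j<n. ?p k i * ?p k j * (?q l i * ?q l j))"
    by (intro sum.cong refl sum.swap)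
  also have "\<dots> = (\<Sum>k<K. \<Sum>i<n. \<Sum>j<n. \<Sum>l<K. ?p k i * ?p k j * (?q l i * ?q l j))"
    by (intro sum.cong refl sum.swap)
  also have "\<dots> = (\<Sum>k<K. \<Sum>i<n. \<Sum>j<n. ?p k i * ?p k j * SY.ker_trunc K (?y i) (?y j))"
    by (simp add: SY.ker_trunc_def sum_distrib_left)
  also have "\<dots> \<le> (\<Sum>k<K. \<Sum>i<n. \<Sum>j<n. ?p k i * ?p k j * Q.ker (?y i) (?y j))"
    by (intro sum_mono SY.ker_residual_psd)
  also have "\<dots> = (\<Sum>i<n. \<Sum>k<K. \<Sum>j<n. ?p k i * ?p k j * Q.ker (?y i) (?y j))"
    by (rule sum.swap)
  also have "\<dots> = (\<Sum>i<n. \<Sum>j<n. \<Sum>k<K. ?p k i * ?p k j * Q.ker (?y i) (?y j))"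
    by (intro sum.cong refl sum.swap)
  also have "\<dots> = (\<Sum>i<n. \<Sum>j<n. SX.ker_trunc K (?x i) (?x j) * Q.ker (?y i) (?y j))"
    by (simp add: SX.ker_trunc_def sum_distrib_right)
  also have "\<dots> \<le> (\<Sum>i<n. \<Sum>j<n. P.ker (?x i) (?x j) * Q.ker (?y i) (?y j))"
  proof -
    have int: "integrable lborel (\<lambda>t. \<Sum>i<n. \<Sum>j<n. Q.centred_step t (?y i) * Q.centred_step t (?y j) * c i j)"
      and eq: "(\<Sum>i<n. \<Sum>j<n. c i j * Q.ker (?y i) (?y j))
        = (\<integral>t. (\<Sum>i<n. \<Sum>j<n. Q.centred_step t (?y i) * Q.centred_step t (?y j) * c i j) \<partial>lborel)"
      for c :: "nat \<Rightarrow> nat \<Rightarrow> real"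
    proof -
      have i: "integrable lborel (\<lambda>t. Q.centred_step t a * Q.centred_step t b)" for a b
        by (rule Q.integrable_centred_step_mult[of _ 1]) (auto simp: Q.abs_centred_step_le_1)
      show "integrable lborel (\<lambda>t. \<Sum>i<n. \<Sum>j<n. Q.centred_step t (?y i) * Q.centred_step t (?y j) * c i j)"
        by (intro Bochner_Integration.integrable_sum integrable_mult_left i)
      show "(\<Sum>i<n. \<Sum>j<n. c i j * Q.ker (?y i) (?y j))
        = (\<integral>t. (\<Sum>i<n. \<Sum>j<n. Q.centred_step t (?y i) * Q.centred_step t (?y j) * c i j) \<partial>lborel)"
        using i by (simp add: Q.ker_eq mult.commute)
    qed
    show ?thesis
      unfolding eq by (intro integral_mono int SX.ker_residual_psd)
  qed
  finally show ?thesis unfolding vtrunc_def vstat_def by (intro divide_right_mono) auto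
qed

lemma vtrunc_nonneg: "0 \<le> vtrunc K n \<omega>"
  by (simp add: vtrunc_def sum_nonneg)

lemma vstat_nonneg: "0 \<le> vstat n \<omega>"
  using order.trans[OF vtrunc_nonneg vtrunc_le_vstat] .

text \<open>By degeneracy only the diagonal of the V-statistic contributes to its mean.\<close>

lemma kernel_product_moment:
  "integrable M (\<lambda>\<omega>. P.ker (X i \<omega>) (X j \<omega>) * Q.ker (Y i \<omega>) (Y j \<omega>))"
  "(\<integral>\<omega>. P.ker (X i \<omega>) (X j \<omega>) * Q.ker (Y i \<omega>) (Y j \<omega>) \<partial>M) = (if i = j then P.tr * Q.tr else 0)"
proof -
  have m: "(\<lambda>x. P.ker (x i) (x j)) \<in> borel_measurable (PiM UNIV (\<lambda>_. borel))"
    "(\<lambda>x. Q.ker (x i) (x j)) \<in> borel_measurable (PiM UNIV (\<lambda>_. borel))" by measurable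
  note * = P.M.indep_var_integral_mult[OF indep_XY m, OF P.ker_X_moment(1) Q.ker_X_moment(1)]
  show "integrable M (\<lambda>\<omega>. P.ker (X i \<omega>) (X j \<omega>) * Q.ker (Y i \<omega>) (Y j \<omega>))" by (rule *(1))
  show "(\<integral>\<omega>. P.ker (X i \<omega>) (X j \<omega>) * Q.ker (Y i \<omega>) (Y j \<omega>) \<partial>M) = (if i = j then P.tr * Q.tr else 0)"
    using *(2) P.ker_X_moment(2)[of i j] Q.ker_X_moment(2)[of i j] by simp
qed

lemma vstat_mean: "integrable M (vstat n)" "(\<integral>\<omega>. vstat n \<omega> \<partial>M) \<le> P.tr * Q.tr"
proof -
  show "integrable M (vstat n)"
    unfolding vstat_def[abs_def] by (intro integrable_divide Bochner_Integration.integrable_sum kernel_product_moment)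
  have "(\<integral>\<omega>. vstat n \<omega> \<partial>M) = real n * (P.tr * Q.tr) / real n"
    unfolding vstat_def[abs_def] using kernel_product_moment by simp
  also have "\<dots> \<le> P.tr * Q.tr" using P.tr_nonneg Q.tr_nonneg by simp
  finally show "(\<integral>\<omega>. vstat n \<omega> \<partial>M) \<le> P.tr * Q.tr" .
qed

lemma feature_product_moment:
  "integrable M (\<lambda>\<omega>. (SX.feature k (X i \<omega>) * SX.feature k (X j \<omega>)) * (SY.feature l (Y i \<omega>) * SY.feature l (Y j \<omega>)))"
  "(\<integral>\<omega>. (SX.feature k (X i \<omega>) * SX.feature k (X j \<omega>)) * (SY.feature l (Y i \<omega>) * SY.feature l (Y j \<omega>)) \<partial>M)
    = (if i = j then lam k * eta l else 0)"
proof -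
  have m: "(\<lambda>x. SX.feature k (x i) * SX.feature k (x j)) \<in> borel_measurable (PiM UNIV (\<lambda>_. borel))"
    "(\<lambda>x. SY.feature l (x i) * SY.feature l (x j)) \<in> borel_measurable (PiM UNIV (\<lambda>_. borel))" by measurable
  note * = P.M.indep_var_integral_mult[OF indep_XY m,
      OF square_integrable_mult[OF P.sqi_X(1)[OF SX.sqi_feature] P.sqi_X(1)[OF SX.sqi_feature]]
         square_integrable_mult[OF Q.sqi_X(1)[OF SY.sqi_feature] Q.sqi_X(1)[OF SY.sqi_feature]]]
  show "integrable M (\<lambda>\<omega>. (SX.feature k (X i \<omega>) * SX.feature k (X j \<omega>)) * (SY.feature l (Y i \<omega>) * SY.feature l (Y j \<omega>)))"
    by (rule *(1))
  show "(\<integral>\<omega>. (SX.feature k (X i \<omega>) * SX.feature k (X j \<omega>)) * (SY.feature l (Y i \<omega>) * SY.feature l (Y j \<omega>)) \<partial>M)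
    = (if i = j then lam k * eta l else 0)"
    using *(2) P.integral_X_mult[OF SX.sqi_feature SX.integral_feature, of k i j]
      Q.integral_X_mult[OF SY.sqi_feature SY.integral_feature, of l i j]
    by (simp add: SX.feature_inner SY.feature_inner)
qed

definition lamsum :: "nat \<Rightarrow> real" where
  "lamsum K = (\<Sum>p\<in>{..<K} \<times> {..<K}. lam (fst p) * eta (snd p))"

lemma lamsum_tendsto: "lamsum \<longlonglongrightarrow> P.tr * Q.tr"
proof -
  have "lamsum = (\<lambda>K. (\<Sum>k<K. lam k) * (\<Sum>l<K. eta l))"
    by (simp add: fun_eq_iff lamsum_def sum_product sum.cartesian_product case_prod_unfold)
  then show ?thesis
    using tendsto_mult[OF SX.lam_sums_tr[unfolded sums_def] SY.lam_sums_tr[unfolded sums_def]] by simp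
qed

lemma vtrunc_mean:
  assumes "1 \<le> n" shows "integrable M (vtrunc K n)" "(\<integral>\<omega>. vtrunc K n \<omega> \<partial>M) = lamsum K"
proof -
  have eq: "vtrunc K n \<omega> = (\<Sum>p\<in>{..<K} \<times> {..<K}. \<Sum>i<n. \<Sum>j<n.
      (SX.feature (fst p) (X i \<omega>) * SX.feature (fst p) (X j \<omega>)) * (SY.feature (snd p) (Y i \<omega>) * SY.feature (snd p) (Y j \<omega>))) / real n" for \<omega>
    by (simp add: vtrunc_def power2_eq_square sum_product mult_ac)
  show "integrable M (vtrunc K n)"
    unfolding eq[abs_def] by (intro integrable_divide Bochner_Integration.integrable_sum feature_product_moment)
  show "(\<integral>\<omega>. vtrunc K n \<omega> \<partial>M) = lamsum K"
    unfolding eq[abs_def] using feature_product_moment assms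
    by (simp add: lamsum_def sum_distrib_left[symmetric])
qed

lemma vtrunc_Laplace:
  fixes Z :: "nat \<times> nat \<Rightarrow> 'b \<Rightarrow> real"
  assumes N: "prob_space N" and Zind: "prob_space.indep_vars N (\<lambda>_. borel) Z UNIV"
    and Z: "\<And>p. distributed N lborel (Z p) std_normal_density" and t: "0 \<le> t"
  shows "(\<lambda>n. \<integral>\<omega>. exp (- t * vtrunc K n \<omega>) \<partial>M)
    \<longlonglongrightarrow> (\<integral>\<omega>. exp (- t * (\<Sum>p\<in>{..<K} \<times> {..<K}. (lam (fst p) * eta (snd p)) * (Z p \<omega>)\<^sup>2)) \<partial>N)"
proof -
  let ?S = "borel \<Otimes>\<^sub>M borel :: (real \<times> real) measure" and ?D = "F1 \<Otimes>\<^sub>M F2"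
  define w where "w p x = SX.feature (fst p) (fst x) * SY.feature (snd p) (snd x)" for p :: "nat \<times> nat" and x :: "real \<times> real"
  have wm [measurable]: "w p \<in> borel_measurable ?S" for p unfolding w_def[abs_def] by measurable
  have ind_i: "P.M.indep_var borel (X i) borel (Y i)" for i
    using P.M.indep_var_compose[OF indep_XY, of "\<lambda>x. x i" borel "\<lambda>x. x i" borel] by (simp add: o_def)
  have dist: "distr M ?S (\<lambda>\<omega>. (X i \<omega>, Y i \<omega>)) = ?D" for i
    using ind_i[of i] by (simp add: P.M.indep_var_distribution_eq P.distr_X Q.distr_X)
  have \<xi>m: "(\<lambda>\<omega>. (X 0 \<omega>, Y 0 \<omega>)) \<in> measurable M ?S" by measurable
  have prod: "integrable M (\<lambda>\<omega>. f (X 0 \<omega>) * g (Y 0 \<omega>))" "(\<integral>\<omega>. f (X 0 \<omega>) * g (Y 0 \<omega>) \<partial>M) = (\<integral>x. f x \<partial>F1) * (\<integral>y. g y \<partial>F2)"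
    if "f \<in> borel_measurable borel" "g \<in> borel_measurable borel" "integrable F1 f" "integrable F2 g" for f g :: "real \<Rightarrow> real"
  proof -
    have i: "integrable M (\<lambda>\<omega>. f (X 0 \<omega>))" "integrable M (\<lambda>\<omega>. g (Y 0 \<omega>))"
      using that by (simp_all add: P.integrable_X Q.integrable_X)
    note * = P.M.indep_var_integral_mult[OF ind_i[of 0] that(1,2), OF i]
    show "integrable M (\<lambda>\<omega>. f (X 0 \<omega>) * g (Y 0 \<omega>))" by (rule *(1))
    show "(\<integral>\<omega>. f (X 0 \<omega>) * g (Y 0 \<omega>) \<partial>M) = (\<integral>x. f x \<partial>F1) * (\<integral>y. g y \<partial>F2)"
      using *(2) that by (simp add: P.integral_X Q.integral_X)
  qed
  have sw: "square_integrable ?D (w p)" for p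
  proof -
    have "integrable M (\<lambda>\<omega>. (SX.feature (fst p) (X 0 \<omega>))\<^sup>2 * (SY.feature (snd p) (Y 0 \<omega>))\<^sup>2)"
      by (rule prod(1)) (use SX.sqi_feature SY.sqi_feature in \<open>auto simp: square_integrable_def\<close>)
    then have "integrable ?D (\<lambda>x. (w p x)\<^sup>2)"
      unfolding dist[of 0, symmetric] by (subst integrable_distr_eq[OF \<xi>m]) (auto simp: w_def power_mult_distrib)
    moreover have "w p \<in> borel_measurable ?D" unfolding dist[of 0, symmetric] by simp
    ultimately show ?thesis by (simp add: square_integrable_def)
  qed
  have mw: "(\<integral>x. w p x \<partial>?D) = 0" for p
  proof -
    have "(\<integral>x. w p x \<partial>?D) = (\<integral>\<omega>. SX.feature (fst p) (X 0 \<omega>) * SY.feature (snd p) (Y 0 \<omega>) \<partial>M)"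
      unfolding dist[of 0, symmetric] by (subst integral_distr[OF \<xi>m]) (auto simp: w_def)
    also have "\<dots> = 0"
      by (subst prod(2)) (auto simp: P.sqi_integrable[OF SX.sqi_feature] Q.sqi_integrable[OF SY.sqi_feature] SX.integral_feature)
    finally show ?thesis .
  qed
  have ow: "l2_inner ?D (w p) (w r) = (if p = r then lam (fst p) * eta (snd p) else 0)" for p r
  proof -
    have "l2_inner ?D (w p) (w r) = (\<integral>\<omega>. (SX.feature (fst p) (X 0 \<omega>) * SX.feature (fst r) (X 0 \<omega>))
         * (SY.feature (snd p) (Y 0 \<omega>) * SY.feature (snd r) (Y 0 \<omega>)) \<partial>M)"
      unfolding dist[of 0, symmetric] l2_inner_def by (subst integral_distr[OF \<xi>m]) (auto simp: w_def mult_ac)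
    also have "\<dots> = l2_inner F1 (SX.feature (fst p)) (SX.feature (fst r)) * l2_inner F2 (SY.feature (snd p)) (SY.feature (snd r))"
      unfolding l2_inner_def
      by (subst prod(2)[of "\<lambda>x. SX.feature (fst p) x * SX.feature (fst r) x" "\<lambda>x. SY.feature (snd p) x * SY.feature (snd r) x"])
         (auto intro!: square_integrable_mult SX.sqi_feature SY.sqi_feature)
    finally show ?thesis by (auto simp: SX.feature_inner SY.feature_inner prod_eq_iff)
  qed
  have "(\<lambda>n. \<integral>\<omega>. exp (- t * ((\<Sum>p\<in>{..<K} \<times> {..<K}. (\<Sum>i<n. w p (X i \<omega>, Y i \<omega>))\<^sup>2) / real n)) \<partial>M)
    \<longlonglongrightarrow> (\<integral>\<omega>. exp (- t * (\<Sum>p\<in>{..<K} \<times> {..<K}. (lam (fst p) * eta (snd p)) * (Z p \<omega>)\<^sup>2)) \<partial>N)"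
  proof (rule Laplace_transform_quadratic_form[where S = ?S and D = ?D])
    show "prob_space M" by (rule P.M.prob_space_axioms)
    show "prob_space.indep_vars N (\<lambda>_. borel) Z ({..<K} \<times> {..<K})"
      using prob_space.indep_vars_subset[OF N Zind] by blast
  qed (use N indep_pairs dist sw mw ow Z t in auto)
  then show ?thesis by (simp add: vtrunc_def w_def)
qed

lemma lam_eta_has_sum: "((\<lambda>p. lam (fst p) * eta (snd p)) has_sum P.tr * Q.tr) UNIV"
proof -
  have 1: "(lam has_sum P.tr) UNIV" by (rule sums_nonneg_imp_has_sum[OF SX.lam_sums_tr SX.lam_nonneg])
  have 2: "(eta has_sum Q.tr) UNIV" by (rule sums_nonneg_imp_has_sum[OF SY.lam_sums_tr SY.lam_nonneg])
  have inner: "((\<lambda>l. lam (fst (k, l)) * eta (snd (k, l))) has_sum lam k * Q.tr) UNIV" for k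
    using has_sum_cmult_right[OF 2] by simp
  have outer: "((\<lambda>k. lam k * Q.tr) has_sum P.tr * Q.tr) UNIV"
    by (rule has_sum_cmult_left[OF 1])
  have "(\<lambda>p. lam (fst p) * eta (snd p)) summable_on (UNIV \<times> UNIV)"
    by (rule summable_on_SigmaI[OF inner has_sum_imp_summable[OF outer]])
       (simp add: SX.lam_nonneg SY.lam_nonneg)
  from has_sum_SigmaI[OF inner outer this] show ?thesis by simp
qed

text \<open>Both truncation errors, \<open>vstat - vtrunc\<close> and that of \<open>W\<close>, are nonnegative with mean at most
  \<open>P.tr * Q.tr - lamsum K\<close>, so the Laplace transforms change by at most \<open>t\<close> times this.\<close>

lemma vstat_Laplace:
  fixes Z :: "nat \<times> nat \<Rightarrow> 'b \<Rightarrow> real"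
  assumes N: "prob_space N" and Zind: "prob_space.indep_vars N (\<lambda>_. borel) Z UNIV"
    and Z: "\<And>p. distributed N lborel (Z p) std_normal_density"
    and W: "integrable N W" "\<And>\<omega>. 0 \<le> W \<omega>" "(\<integral>\<omega>. W \<omega> \<partial>N) = P.tr * Q.tr"
      "AE \<omega> in N. ((\<lambda>p. lam (fst p) * eta (snd p) * (Z p \<omega>)\<^sup>2) has_sum W \<omega>) UNIV"
    and t: "0 \<le> t"
  shows "(\<lambda>n. \<integral>\<omega>. exp (- t * vstat n \<omega>) \<partial>M) \<longlonglongrightarrow> (\<integral>\<omega>. exp (- t * W \<omega>) \<partial>N)"
proof (rule LIMSEQ_I)
  fix r :: real assume r: "0 < r"
  interpret N: prob_space N by fact
  define G where "G K \<omega> = (\<Sum>p\<in>{..<K} \<times> {..<K}. (lam (fst p) * eta (snd p)) * (Z p \<omega>)\<^sup>2)" for K \<omega>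
  have G0: "0 \<le> G K \<omega>" for K \<omega> by (simp add: G_def sum_nonneg SX.lam_nonneg SY.lam_nonneg)
  have Gi: "integrable N (G K)" and GE: "(\<integral>\<omega>. G K \<omega> \<partial>N) = lamsum K" for K
    unfolding G_def[abs_def] lamsum_def using N.std_normal_square[OF Z] by simp_all
  have GW: "AE \<omega> in N. G K \<omega> \<le> W \<omega>" for K
    using W(4)
  proof eventually_elim
    case (elim \<omega>)
    then show ?case unfolding G_def
      by (rule finite_sum_le_has_sum) (auto simp: SX.lam_nonneg SY.lam_nonneg)
  qed
  have diffN: "\<bar>(\<integral>\<omega>. exp (- t * W \<omega>) \<partial>N) - (\<integral>\<omega>. exp (- t * G K \<omega>) \<partial>N)\<bar> \<le> t * (P.tr * Q.tr - lamsum K)" for K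
  proof -
    have [measurable]: "W \<in> borel_measurable N" "G K \<in> borel_measurable N" using W(1) Gi by auto
    have i: "integrable N (\<lambda>\<omega>. exp (- t * W \<omega>))" "integrable N (\<lambda>\<omega>. exp (- t * G K \<omega>))"
      by (rule N.integrable_const_bound[of _ 1]; use W(2) G0 t in auto)+
    have "\<bar>(\<integral>\<omega>. exp (- t * W \<omega>) \<partial>N) - (\<integral>\<omega>. exp (- t * G K \<omega>) \<partial>N)\<bar>
        \<le> (\<integral>\<omega>. \<bar>exp (- t * W \<omega>) - exp (- t * G K \<omega>)\<bar> \<partial>N)"
      unfolding Bochner_Integration.integral_diff[OF i, symmetric] by (rule integral_abs_bound)
    also have "\<dots> \<le> (\<integral>\<omega>. t * (W \<omega> - G K \<omega>) \<partial>N)"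
    proof (rule integral_mono_AE)
      show "AE \<omega> in N. \<bar>exp (- t * W \<omega>) - exp (- t * G K \<omega>)\<bar> \<le> t * (W \<omega> - G K \<omega>)"
        using GW[of K]
      proof eventually_elim
        case (elim \<omega>)
        then show ?case using abs_exp_minus_diff_le[OF W(2) G0 t, of \<omega> K \<omega>] by simp
      qed
    qed (use i W(1) Gi in auto)
    also have "\<dots> = t * (P.tr * Q.tr - lamsum K)" using W(1,3) Gi GE by simp
    finally show ?thesis .
  qed
  have diffM: "\<bar>(\<integral>\<omega>. exp (- t * vstat n \<omega>) \<partial>M) - (\<integral>\<omega>. exp (- t * vtrunc K n \<omega>) \<partial>M)\<bar> \<le> t * (P.tr * Q.tr - lamsum K)"
    if n: "1 \<le> n" for n K
  proof -
    note v = vstat_mean(1)[of n] vtrunc_mean(1)[OF n, of K]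
    have [measurable]: "vstat n \<in> borel_measurable M" "vtrunc K n \<in> borel_measurable M" using v by auto
    have i: "integrable M (\<lambda>\<omega>. exp (- t * vstat n \<omega>))" "integrable M (\<lambda>\<omega>. exp (- t * vtrunc K n \<omega>))"
      by (rule P.M.integrable_const_bound[of _ 1]; use vstat_nonneg vtrunc_nonneg t in auto)+
    have "\<bar>(\<integral>\<omega>. exp (- t * vstat n \<omega>) \<partial>M) - (\<integral>\<omega>. exp (- t * vtrunc K n \<omega>) \<partial>M)\<bar>
        \<le> (\<integral>\<omega>. \<bar>exp (- t * vstat n \<omega>) - exp (- t * vtrunc K n \<omega>)\<bar> \<partial>M)"
      unfolding Bochner_Integration.integral_diff[OF i, symmetric] by (rule integral_abs_bound)
    also have "\<dots> \<le> (\<integral>\<omega>. t * (vstat n \<omega> - vtrunc K n \<omega>) \<partial>M)"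
    proof (rule integral_mono)
      show "\<bar>exp (- t * vstat n \<omega>) - exp (- t * vtrunc K n \<omega>)\<bar> \<le> t * (vstat n \<omega> - vtrunc K n \<omega>)" for \<omega>
        using abs_exp_minus_diff_le[OF vstat_nonneg vtrunc_nonneg t, of n \<omega> K n \<omega>] vtrunc_le_vstat[of K n \<omega>] by simp
    qed (use i v in auto)
    also have "\<dots> = t * ((\<integral>\<omega>. vstat n \<omega> \<partial>M) - lamsum K)" using v vtrunc_mean(2)[OF n] by simp
    also have "\<dots> \<le> t * (P.tr * Q.tr - lamsum K)" using vstat_mean(2) t by (intro mult_left_mono) auto
    finally show ?thesis .
  qed
  have "(\<lambda>K. t * (P.tr * Q.tr - lamsum K)) \<longlonglongrightarrow> t * (P.tr * Q.tr - P.tr * Q.tr)"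
    by (intro tendsto_intros lamsum_tendsto)
  then have "eventually (\<lambda>K. t * (P.tr * Q.tr - lamsum K) < r / 3) sequentially"
    by (rule order_tendstoD) (use r in simp)
  then obtain K where K: "t * (P.tr * Q.tr - lamsum K) < r / 3" by (auto simp: eventually_sequentially)
  have "(\<lambda>n. \<integral>\<omega>. exp (- t * vtrunc K n \<omega>) \<partial>M) \<longlonglongrightarrow> (\<integral>\<omega>. exp (- t * G K \<omega>) \<partial>N)"
    unfolding G_def by (rule vtrunc_Laplace[OF N Zind Z t])
  then obtain n0 where n0: "\<And>n. n \<ge> n0 \<Longrightarrow>
      \<bar>(\<integral>\<omega>. exp (- t * vtrunc K n \<omega>) \<partial>M) - (\<integral>\<omega>. exp (- t * G K \<omega>) \<partial>N)\<bar> < r / 3"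
    using LIMSEQ_D[of _ _ "r / 3"] r by (metis divide_pos_pos real_norm_def zero_less_numeral)
  have "norm ((\<integral>\<omega>. exp (- t * vstat n \<omega>) \<partial>M) - (\<integral>\<omega>. exp (- t * W \<omega>) \<partial>N)) < r" if "n \<ge> max 1 n0" for n
    using diffM[of n K] diffN[of K] n0[of n] that K unfolding real_norm_def by linarith
  then show "\<exists>no. \<forall>n\<ge>no. norm ((\<integral>\<omega>. exp (- t * vstat n \<omega>) \<partial>M) - (\<integral>\<omega>. exp (- t * W \<omega>) \<partial>N)) < r" by blast
qed

lemma measurable_kappa_star [measurable]:
  "(\<lambda>\<omega>. kappa_star n (\<lambda>i. X i \<omega>) (\<lambda>i. Y i \<omega>)) \<in> borel_measurable M"
  unfolding kappa_star_def U1_def U12_def U3_def h3_def by simp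

lemma kappa_star_char:
  fixes Z :: "nat \<times> nat \<Rightarrow> 'b \<Rightarrow> real"
  assumes N: "prob_space N" and Zind: "prob_space.indep_vars N (\<lambda>_. borel) Z UNIV"
    and Z: "\<And>p. distributed N lborel (Z p) std_normal_density"
    and W: "integrable N W" "\<And>\<omega>. 0 \<le> W \<omega>" "(\<integral>\<omega>. W \<omega> \<partial>N) = P.tr * Q.tr"
      "AE \<omega> in N. ((\<lambda>p. lam (fst p) * eta (snd p) * (Z p \<omega>)\<^sup>2) has_sum W \<omega>) UNIV"
  shows "(\<lambda>n. CLINT \<omega>|M. iexp (s * (real n * kappa_star n (\<lambda>i. X i \<omega>) (\<lambda>i. Y i \<omega>))))
    \<longlonglongrightarrow> (CLINT \<omega>|N. iexp (s * (W \<omega> - P.tr * Q.tr)))"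
proof -
  interpret N: prob_space N by fact
  let ?c = "P.tr * Q.tr"
  have Vm [measurable]: "vstat n \<in> borel_measurable M" for n using vstat_mean(1)[of n] by simp
  have Wm [measurable]: "W \<in> borel_measurable N" using W(1) by simp
  note weak = Laplace_convergence_imp_weak_convergence[OF P.M.prob_space_axioms N vstat_mean(1) vstat_nonneg
      vstat_mean(2) W(1,2) vstat_Laplace[OF N Zind Z W]]
  have "(\<lambda>n. \<integral>\<omega>. cos (s * (vstat n \<omega> - ?c)) \<partial>M) \<longlonglongrightarrow> (\<integral>\<omega>. cos (s * (W \<omega> - ?c)) \<partial>N)"
    by (rule weak[where f = "\<lambda>v. cos (s * (v - ?c))" and B = 1]) (auto intro!: continuous_intros)
  moreover have "(\<lambda>n. \<integral>\<omega>. sin (s * (vstat n \<omega> - ?c)) \<partial>M) \<longlonglongrightarrow> (\<integral>\<omega>. sin (s * (W \<omega> - ?c)) \<partial>N)"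
    by (rule weak[where f = "\<lambda>v. sin (s * (v - ?c))" and B = 1]) (auto intro!: continuous_intros)
  ultimately have V: "(\<lambda>n. CLINT \<omega>|M. iexp (s * (vstat n \<omega> - ?c))) \<longlonglongrightarrow> (CLINT \<omega>|N. iexp (s * (W \<omega> - ?c)))"
    by (subst P.M.expectation_iexp, simp, subst N.expectation_iexp, simp) (rule tendsto_Complex)
  obtain E where E: "P.M.l2_null E"
    and eq: "\<And>n \<omega>. 3 \<le> n \<Longrightarrow> real n * kappa_star n (\<lambda>i. X i \<omega>) (\<lambda>i. Y i \<omega>) = vstat n \<omega> - ?c + E n \<omega>"
    using kappa_star_approx by blast
  have Em [measurable]: "E n \<in> borel_measurable M" for n
    using E by (auto simp: P.M.l2_null_def square_integrable_def)
  have Ei: "integrable M (\<lambda>\<omega>. \<bar>E n \<omega>\<bar>)" for n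
  proof -
    have "square_integrable M (E n)" "square_integrable M (\<lambda>_. 1)"
      using E by (auto simp: P.M.l2_null_def square_integrable_def)
    from square_integrable_mult[OF this] show ?thesis by simp
  qed
  let ?A = "\<lambda>n. CLINT \<omega>|M. iexp (s * (real n * kappa_star n (\<lambda>i. X i \<omega>) (\<lambda>i. Y i \<omega>)))"
  let ?B = "\<lambda>n. CLINT \<omega>|M. iexp (s * (vstat n \<omega> - ?c))"
  have le: "norm (?A n - ?B n) \<le> \<bar>s\<bar> * (\<integral>\<omega>. \<bar>E n \<omega>\<bar> \<partial>M)" if n: "3 \<le> n" for n
  proof -
    have i: "integrable M (\<lambda>\<omega>. iexp (s * (real n * kappa_star n (\<lambda>i. X i \<omega>) (\<lambda>i. Y i \<omega>))))"
      "integrable M (\<lambda>\<omega>. iexp (s * (vstat n \<omega> - ?c)))"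
      by (rule P.M.integrable_const_bound[of _ 1]; simp)+
    have "norm (?A n - ?B n) \<le> (\<integral>\<omega>. norm (iexp (s * (real n * kappa_star n (\<lambda>i. X i \<omega>) (\<lambda>i. Y i \<omega>)))
        - iexp (s * (vstat n \<omega> - ?c))) \<partial>M)"
      unfolding Bochner_Integration.integral_diff[OF i, symmetric] by (rule integral_norm_bound)
    also have "\<dots> \<le> (\<integral>\<omega>. \<bar>s\<bar> * \<bar>E n \<omega>\<bar> \<partial>M)"
    proof (rule integral_mono)
      show "norm (iexp (s * (real n * kappa_star n (\<lambda>i. X i \<omega>) (\<lambda>i. Y i \<omega>))) - iexp (s * (vstat n \<omega> - ?c))) \<le> \<bar>s\<bar> * \<bar>E n \<omega>\<bar>" for \<omega>
      proof -
        have "s * (real n * kappa_star n (\<lambda>i. X i \<omega>) (\<lambda>i. Y i \<omega>)) - s * (vstat n \<omega> - ?c) = s * E n \<omega>"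
          unfolding eq[OF n] by (simp add: algebra_simps)
        then show ?thesis
          using norm_iexp_diff_le[of "s * (real n * kappa_star n (\<lambda>i. X i \<omega>) (\<lambda>i. Y i \<omega>))" "s * (vstat n \<omega> - ?c)"]
          by (simp only: abs_mult)
      qed
    qed (use i Ei in auto)
    finally show ?thesis by simp
  qed
  have lim0: "(\<lambda>n. \<bar>s\<bar> * (\<integral>\<omega>. \<bar>E n \<omega>\<bar> \<partial>M)) \<longlonglongrightarrow> 0"
    by (rule tendsto_mult_right_zero[OF P.M.l2_null_imp_mean_abs[OF E]])
  have "eventually (\<lambda>n. norm (?A n - ?B n) \<le> \<bar>s\<bar> * (\<integral>\<omega>. \<bar>E n \<omega>\<bar> \<partial>M)) sequentially"
    using le unfolding eventually_sequentially by blast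
  from Lim_null_comparison[OF this lim0] have "(\<lambda>n. ?A n - ?B n) \<longlonglongrightarrow> 0" .
  from tendsto_add[OF this V] show ?thesis by simp
qed

end

theorem theorem4:
  fixes M :: "'a measure" and X Y :: "nat \<Rightarrow> 'a \<Rightarrow> real"
    and F1 F2 :: "real measure"
    and lam eta :: "nat \<Rightarrow> real"
    and N :: "'b measure" and Z :: "nat \<Rightarrow> nat \<Rightarrow> 'b \<Rightarrow> real"
  assumes "prob_space M"
    and "prob_space.indep_vars M (\<lambda>_. borel) (case_sum X Y) (UNIV :: (nat + nat) set)"
    and "\<And>i. distr M borel (X i) = F1"
    and "\<And>i. distr M borel (Y i) = F2"
    and "\<And>i. integrable M (\<lambda>\<omega>. (X i \<omega>)\<^sup>2)"
    and "\<And>i. integrable M (\<lambda>\<omega>. (Y i \<omega>)\<^sup>2)"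
    and "integrable M (\<lambda>\<omega>. (bergsma_kernel F1 (X 0 \<omega>) (X 1 \<omega>))\<^sup>2)"
    and "integrable M (\<lambda>\<omega>. (bergsma_kernel F2 (Y 0 \<omega>) (Y 1 \<omega>))\<^sup>2)"
    and "eigenvalue_sequence F1 (bergsma_kernel F1) lam"
    and "eigenvalue_sequence F2 (bergsma_kernel F2) eta"
    and "prob_space N"
    and "prob_space.indep_vars N (\<lambda>_. borel) (\<lambda>(k, l). Z k l) (UNIV :: (nat \<times> nat) set)"
    and "\<And>k l. distributed N lborel (Z k l) std_normal_density"
  shows "(AE \<omega> in N. (\<lambda>(k, l). lam k * eta l * ((Z k l \<omega>)\<^sup>2 - 1)) summable_on UNIV) \<and>
    weak_conv_m
      (\<lambda>n. distr M borel (\<lambda>\<omega>. real n * kappa_star n (\<lambda>i. X i \<omega>) (\<lambda>i. Y i \<omega>)))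
      (distr N borel (\<lambda>\<omega>. \<Sum>\<^sub>\<infinity>(k, l)\<in>UNIV. lam k * eta l * ((Z k l \<omega>)\<^sup>2 - 1)))"
proof -
  interpret M: prob_space M by fact
  interpret N: prob_space N by fact
  note ind = assms(2)
  have rv: "case_sum X Y i \<in> borel_measurable M" for i using ind by (auto simp: M.indep_vars_def2)
  have Xm [measurable]: "X i \<in> borel_measurable M" and Ym [measurable]: "Y i \<in> borel_measurable M" for i
    using rv[of "Inl i"] rv[of "Inr i"] by simp_all
  have rd: "real_distribution F1" "real_distribution F2"
    using M.real_distribution_distr[OF Xm, of 0] M.real_distribution_distr[OF Ym, of 0] assms(3)[of 0] assms(4)[of 0]
    by simp_all
  have sq: "integrable F1 (\<lambda>x. x\<^sup>2)" "integrable F2 (\<lambda>x. x\<^sup>2)"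
    unfolding assms(3)[of 0, symmetric] assms(4)[of 0, symmetric]
    using assms(5)[of 0] assms(6)[of 0] by (simp_all add: integrable_distr_eq)
  have pairs: "M.indep_vars (\<lambda>_. borel \<Otimes>\<^sub>M borel) (\<lambda>i \<omega>. (X i \<omega>, Y i \<omega>)) UNIV"
  proof -
    let ?K = "\<lambda>i :: nat. {Inl i, Inr i} :: (nat + nat) set"
    have "M.indep_vars (\<lambda>i. PiM (?K i) (\<lambda>_. borel)) (\<lambda>i \<omega>. restrict (\<lambda>j. case_sum X Y j \<omega>) (?K i)) UNIV"
      by (rule M.indep_vars_restrict[OF ind]) (auto simp: disjoint_family_on_def)
    from M.indep_vars_compose2[OF this, of "\<lambda>i f. (f (Inl i), f (Inr i))" "\<lambda>_. borel \<Otimes>\<^sub>M borel"]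
    show ?thesis by simp
  qed
  have indX: "M.indep_vars (\<lambda>_. borel) X UNIV" and indY: "M.indep_vars (\<lambda>_. borel) Y UNIV"
    using M.indep_vars_compose2[OF pairs, of "\<lambda>_. fst" "\<lambda>_. borel"]
      M.indep_vars_compose2[OF pairs, of "\<lambda>_. snd" "\<lambda>_. borel"] by simp_all
  have indXY: "M.indep_var (PiM UNIV (\<lambda>_. borel)) (\<lambda>\<omega> i. X i \<omega>) (PiM UNIV (\<lambda>_. borel)) (\<lambda>\<omega> i. Y i \<omega>)"
  proof -
    let ?A = "range Inl :: (nat + nat) set" and ?B = "range Inr :: (nat + nat) set"
    have "M.indep_var (PiM ?A (\<lambda>_. borel)) (\<lambda>\<omega>. restrict (\<lambda>j. case_sum X Y j \<omega>) ?A)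
        (PiM ?B (\<lambda>_. borel)) (\<lambda>\<omega>. restrict (\<lambda>j. case_sum X Y j \<omega>) ?B)"
      by (rule M.indep_var_restrict[OF ind]) auto
    moreover have "(\<lambda>f i. f (Inl i)) \<in> measurable (PiM ?A (\<lambda>_. borel)) (PiM UNIV (\<lambda>_. borel :: real measure))"
      "(\<lambda>f i. f (Inr i)) \<in> measurable (PiM ?B (\<lambda>_. borel)) (PiM UNIV (\<lambda>_. borel :: real measure))"
      by (rule measurable_PiM_single'; auto)+
    ultimately have "M.indep_var (PiM UNIV (\<lambda>_. borel)) ((\<lambda>f i. f (Inl i)) \<circ> (\<lambda>\<omega>. restrict (\<lambda>j. case_sum X Y j \<omega>) ?A))
      (PiM UNIV (\<lambda>_. borel)) ((\<lambda>f i. f (Inr i)) \<circ> (\<lambda>\<omega>. restrict (\<lambda>j. case_sum X Y j \<omega>) ?B))"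
      by (rule M.indep_var_compose)
    then show ?thesis by (simp add: o_def)
  qed
  interpret F1: real_distribution F1 by (rule rd)
  interpret F2: real_distribution F2 by (rule rd)
  interpret B: bergsma_pair M F1 X F2 Y lam eta
    by unfold_locales (use sq indX indY indXY pairs assms(3,4,9,10) in auto)
  let ?c = "\<lambda>p. lam (fst p) * eta (snd p)"
  define Zp where "Zp p = Z (fst p) (snd p)" for p
  have Zind: "N.indep_vars (\<lambda>_. borel) Zp UNIV"
    using assms(12) by (simp add: Zp_def[abs_def] case_prod_unfold)
  have Zd: "distributed N lborel (Zp p) std_normal_density" for p
    unfolding Zp_def by (rule assms(13))
  have Zm [measurable]: "Zp p \<in> borel_measurable N" for p by (rule N.std_normal_distr(1)[OF Zd])
  have c0: "0 \<le> ?c p" for p by (simp add: B.SX.lam_nonneg B.SY.lam_nonneg)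
  obtain W where W: "integrable N W" "\<And>\<omega>. 0 \<le> W \<omega>" "(\<integral>\<omega>. W \<omega> \<partial>N) = B.P.tr * B.Q.tr"
      "AE \<omega> in N. ((\<lambda>p. ?c p * (Zp p \<omega>)\<^sup>2) has_sum W \<omega>) UNIV"
    using gaussian_quadratic_series[where Z = Zp and c = ?c, OF assms(11) Zd c0 B.lam_eta_has_sum] by blast
  have [measurable]: "W \<in> borel_measurable N" using W(1) by simp
  let ?h = "\<lambda>\<omega> p. ?c p * ((Zp p \<omega>)\<^sup>2 - 1)"
  have h_eq: "(\<lambda>(k, l). lam k * eta l * ((Z k l \<omega>)\<^sup>2 - 1)) = ?h \<omega>" for \<omega>
    by (simp add: fun_eq_iff Zp_def)
  \<comment> \<open>The centring constants \<open>- ?c p\<close> are summable on their own.\<close>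
  have has: "AE \<omega> in N. (?h \<omega> has_sum (W \<omega> - B.P.tr * B.Q.tr)) UNIV"
    using W(4)
  proof eventually_elim
    case (elim \<omega>)
    have "((\<lambda>p. - 1 * ?c p) has_sum - 1 * (B.P.tr * B.Q.tr)) UNIV"
      by (rule has_sum_cmult_right[OF B.lam_eta_has_sum])
    from has_sum_add[OF elim this] show ?case by (simp add: algebra_simps)
  qed
  have summ: "AE \<omega> in N. (\<lambda>(k, l). lam k * eta l * ((Z k l \<omega>)\<^sup>2 - 1)) summable_on UNIV"
    using has unfolding h_eq by eventually_elim (rule has_sum_imp_summable)
  define L where "L \<omega> = (\<Sum>\<^sub>\<infinity>p. ?h \<omega> p)" for \<omega>
  have Lm [measurable]: "L \<in> borel_measurable N"
    unfolding L_def[abs_def] by (rule measurable_infsum_nat_pair) measurable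
  have LW: "AE \<omega> in N. L \<omega> = W \<omega> - B.P.tr * B.Q.tr"
    using has unfolding L_def by eventually_elim (rule infsumI)
  let ?K = "\<lambda>n \<omega>. real n * kappa_star n (\<lambda>i. X i \<omega>) (\<lambda>i. Y i \<omega>)"
  have "weak_conv_m (\<lambda>n. distr M borel (?K n)) (distr N borel L)"
  proof (rule levy_continuity)
    show "real_distribution (distr M borel (?K n))" for n by (rule M.real_distribution_distr) measurable
    show "real_distribution (distr N borel L)" by (rule N.real_distribution_distr) measurable
    fix s
    have "char (distr M borel (?K n)) s = (CLINT \<omega>|M. iexp (s * ?K n \<omega>))" for n
      unfolding char_def by (subst integral_distr) auto
    moreover have "char (distr N borel L) s = (CLINT \<omega>|N. iexp (s * (W \<omega> - B.P.tr * B.Q.tr)))"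
    proof -
      have "char (distr N borel L) s = (CLINT \<omega>|N. iexp (s * L \<omega>))"
        unfolding char_def by (subst integral_distr) auto
      also have "\<dots> = (CLINT \<omega>|N. iexp (s * (W \<omega> - B.P.tr * B.Q.tr)))"
      proof (rule integral_cong_AE)
        show "AE \<omega> in N. iexp (s * L \<omega>) = iexp (s * (W \<omega> - B.P.tr * B.Q.tr))"
          using LW by eventually_elim simp
      qed measurable
      finally show ?thesis .
    qed
    ultimately show "(\<lambda>n. char (distr M borel (?K n)) s) \<longlonglongrightarrow> char (distr N borel L) s"
      using B.kappa_star_char[OF assms(11) Zind Zd W] by simp
  qed
  then show ?thesis using summ by (simp only: L_def[abs_def] h_eq)
qed

end
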